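(* Let $d\ge1$, $m\ge-d$, $\nu>0$, and let $\phi$, $P_a^*$ and $\mathcal{M}^{\rm loc}$ be as defined in the context. Let $1<p<\infty$ be fixed, $1/p+1/p'=1$, and let $w(x)>0$ be a weight on $\mathbb{R}^d$ satisfying $$\big\|w^{-\frac1p}\,\phi\big\|_{L^{p'}(\mathbb{R}^d)}<\infty.$$ For every $\alpha>1$ there is a number $N_0=N_0(\alpha,p,d,m,\nu)$, depending only on the indicated parameters, such that for every $N>N_0$ the weight $$v(x)=\Big[\mathcal{M}^{\rm loc}\big(w^{-\frac{p'}{p}}\,e^{-\frac{p'|y|^2}{2}}\big)(x)\Big]^{-\frac{\alpha}{p'/p}}\,e^{-\frac{p|x|^2}{2}}\,(1+|x|)^{-N}$$ has the property that $P_a^*:L^p(w)\to L^p(v)$ boundedly for all $a>0$.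
   Context: Fix $d\ge1$, $m\ge -d$, $\nu>0$, and let $L=-\Delta+|x|^2+m$ on $\mathbb{R}^d$. Its heat semigroup is $e^{-vL}f(x)=\int_{\mathbb{R}^d}h_v(x,y)f(y)\,dy$, $v>0$, with (positive) kernel $$h_v(x,y)=e^{-vm}\,[2\pi\sinh(2v)]^{-d/2}\,\exp\Big(-\frac{|x-y|^2}{2\tanh(2v)}-\tanh(v)\,x\cdot y\Big).$$ For measurable $f$ on $\mathbb{R}^d$, $$P_tf(x)=\frac{t^{2\nu}}{4^\nu\Gamma(\nu)}\int_0^\infty e^{-\frac{t^2}{4u}}\,\big[e^{-uL}f\big](x)\,\frac{du}{u^{1+\nu}},\quad t>0,\qquad P_a^*f(x)=\sup_{0<t<a}|P_tf(x)|.$$ The function $\phi:\mathbb{R}^d\to(0,\infty)$ is $$\phi(y)=\frac{e^{-|y|^2/2}}{(1+|y|)^{\frac{d+m}{2}}[\ln(e+|y|)]^{1+\nu}}\ \text{ if } m>-d,\qquad \phi(y)=\frac{e^{-|y|^2/2}}{[\ln(e+|y|)]^{\nu}}\ \text{ if } m=-d.$$ The local Hardy-Littlewood maximal operator is $$\mathcal{M}^{\rm loc}f(x)=\sup_{r>0}\frac{1}{|B_r|}\int_{B_r(x)}|f(y)|\,\chi_{\{|y|\le 3\max(|x|,1)\}}\,dy,$$ where $B_r(x)$ is the Euclidean ball of center $x$ and radius $r$ and $|B_r|$ its Lebesgue measure. In the claim it is applied to the function $y\mapsto w(y)^{-p'/p}e^{-p'|y|^2/2}$. A weight is a measurable function on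 $\mathbb{R}^d$ with values in $(0,\infty)$ a.e.; $L^p(w)$ is the space of measurable $f$ with $\|f\|_{L^p(w)}=(\int_{\mathbb{R}^d}|f|^p w\,dx)^{1/p}<\infty$. "$P_a^*:L^p(w)\to L^p(v)$ boundedly" means there is a constant $C$ (which may depend on $a$) with $\|P_a^*f\|_{L^p(v)}\le C\|f\|_{L^p(w)}$ for all $f\in L^p(w)$. *)

theory Defs
  imports "HOL-Analysis.Analysis"
begin

text \<open>
  The space \<open>R^d\<close> is \<^typ>\<open>real ^ 'n\<close>, with \<open>d = CARD('n)\<close>. Measurable means Lebesgue measurable.
\<close>

section \<open>Weighted Lebesgue spaces\<close>

definition weight :: "(real ^ 'n \<Rightarrow> real) \<Rightarrow> bool" where
  "weight w \<longleftrightarrow> w \<in> borel_measurable lebesgue \<and> (AE x in lebesgue. 0 < w x)"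

text \<open>Only used for positive exponents, hence \<open>top\<close> is mapped to \<open>top\<close>.\<close>

definition ennpowr :: "ennreal \<Rightarrow> real \<Rightarrow> ennreal" where
  "ennpowr x r = (if x = top then top else ennreal (enn2real x powr r))"

text \<open>
  The norm is defined for functions with values in \<open>[0, \<infinity>]\<close>, because a maximal function may be
  infinite at some points; a real function \<open>f\<close> is measured through \<open>\<bar>f\<bar>\<close>.
\<close>

definition Lp_norm :: "real \<Rightarrow> (real ^ 'n \<Rightarrow> real) \<Rightarrow> (real ^ 'n \<Rightarrow> ennreal) \<Rightarrow> ennreal" where
  "Lp_norm p w g = ennpowr (\<integral>\<^sup>+ x. ennpowr (g x) p * ennreal (w x) \<partial>lebesgue) (1 / p)"

definition Lp :: "real \<Rightarrow> (real ^ 'n \<Rightarrow> real) \<Rightarrow> (real ^ 'n \<Rightarrow> real) set" where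
  "Lp p w = {f \<in> borel_measurable lebesgue. Lp_norm p w (\<lambda>x. ennreal \<bar>f x\<bar>) < top}"

section \<open>Heat and Poisson semigroups of \<open>L = -\<Delta> + |x|^2 + m\<close>\<close>

definition heat_kernel :: "real \<Rightarrow> real \<Rightarrow> real ^ 'n \<Rightarrow> real ^ 'n \<Rightarrow> real" where
  "heat_kernel m v x y =
     exp (- v * m) * (2 * pi * sinh (2 * v)) powr (- real CARD('n) / 2) *
     exp (- (norm (x - y))\<^sup>2 / (2 * tanh (2 * v)) - tanh v * (x \<bullet> y))"

definition heat :: "real \<Rightarrow> real \<Rightarrow> (real ^ 'n \<Rightarrow> real) \<Rightarrow> real ^ 'n \<Rightarrow> real" where
  "heat m v f x = (LINT y|lebesgue. heat_kernel m v x y * f y)"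

definition Poisson :: "real \<Rightarrow> real \<Rightarrow> real \<Rightarrow> (real ^ 'n \<Rightarrow> real) \<Rightarrow> real ^ 'n \<Rightarrow> real" where
  "Poisson m \<nu> t f x =
     t powr (2 * \<nu>) / (4 powr \<nu> * Gamma \<nu>) *
     (LINT u:{0<..}|lebesgue. exp (- t\<^sup>2 / (4 * u)) * heat m u f x / u powr (1 + \<nu>))"

text \<open>
  The Bochner integral is \<open>0\<close> for non-integrable functions, so the convergence of the integrals
  in \<^const>\<open>heat\<close> and \<^const>\<open>Poisson\<close> has to be recorded separately.
\<close>

definition Poisson_exists :: "real \<Rightarrow> real \<Rightarrow> real \<Rightarrow> (real ^ 'n \<Rightarrow> real) \<Rightarrow> real ^ 'n \<Rightarrow> bool" where
  "Poisson_exists m \<nu> t f x \<longleftrightarrow>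
     (\<forall>u>0. integrable lebesgue (\<lambda>y. heat_kernel m u x y * f y)) \<and>
     set_integrable lebesgue {0<..}
       (\<lambda>u. exp (- t\<^sup>2 / (4 * u)) * heat m u f x / u powr (1 + \<nu>))"

definition Poisson_max ::
  "real \<Rightarrow> real \<Rightarrow> real \<Rightarrow> (real ^ 'n \<Rightarrow> real) \<Rightarrow> real ^ 'n \<Rightarrow> ennreal" where
  "Poisson_max m \<nu> a f x = (SUP t\<in>{0<..<a}. ennreal \<bar>Poisson m \<nu> t f x\<bar>)"

text \<open>
  Boundedness from \<open>L^p(w)\<close> to \<open>L^p(v)\<close>. Besides the norm inequality this contains what is needed
  for \<open>P_a^* f\<close> to be an element of \<open>L^p(v)\<close>: the integrals defining \<open>P_t f\<close> converge almost
  everywhere and \<open>P_a^* f\<close> is measurable.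
\<close>

definition Poisson_max_bounded ::
  "real \<Rightarrow> real \<Rightarrow> real \<Rightarrow> real \<Rightarrow> (real ^ 'n \<Rightarrow> real) \<Rightarrow> (real ^ 'n \<Rightarrow> real) \<Rightarrow> bool" where
  "Poisson_max_bounded m \<nu> a p w v \<longleftrightarrow>
     (\<forall>f\<in>Lp p w. (AE x in lebesgue. \<forall>t\<in>{0<..<a}. Poisson_exists m \<nu> t f x) \<and>
        Poisson_max m \<nu> a f \<in> borel_measurable lebesgue) \<and>
     (\<exists>C::real. \<forall>f\<in>Lp p w.
        Lp_norm p v (Poisson_max m \<nu> a f) \<le> ennreal C * Lp_norm p w (\<lambda>x. ennreal \<bar>f x\<bar>))"

text \<open>In the second branch \<open>m = -d\<close>, since only \<open>m \<ge> -d\<close> is considered.\<close>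

definition phi :: "real \<Rightarrow> real \<Rightarrow> real ^ 'n \<Rightarrow> real" where
  "phi m \<nu> y =
     (if m > - real CARD('n)
      then exp (- (norm y)\<^sup>2 / 2) /
           ((1 + norm y) powr ((real CARD('n) + m) / 2) * ln (exp 1 + norm y) powr (1 + \<nu>))
      else exp (- (norm y)\<^sup>2 / 2) / ln (exp 1 + norm y) powr \<nu>)"

section \<open>Local maximal operator and the second weight\<close>

definition local_max :: "(real ^ 'n \<Rightarrow> real) \<Rightarrow> real ^ 'n \<Rightarrow> ennreal" where
  "local_max f x =
     (SUP r\<in>{0<..}. (\<integral>\<^sup>+ y\<in>ball x r. ennreal \<bar>f y\<bar> * indicator {y. norm y \<le> 3 * max (norm x) 1} y
        \<partial>lebesgue) / emeasure lebesgue (ball x r))"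

text \<open>
  The exponent of the maximal function is negative. Where the maximal function is infinite,
  \<^const>\<open>enn2real\<close> and \<open>0 powr r = 0\<close> give the value \<open>0\<close>, as it should be. The maximal
  function of an almost everywhere positive function is nowhere \<open>0\<close>.
\<close>

definition dual_weight ::
  "real \<Rightarrow> real \<Rightarrow> real \<Rightarrow> real \<Rightarrow> (real ^ 'n \<Rightarrow> real) \<Rightarrow> real ^ 'n \<Rightarrow> real" where
  "dual_weight p p' \<alpha> N w x =
     enn2real (local_max (\<lambda>y. w y powr (- p' / p) * exp (- p' * (norm y)\<^sup>2 / 2)) x)
       powr (- \<alpha> / (p' / p)) *
     exp (- p * (norm x)\<^sup>2 / 2) * (1 + norm x) powr (- N)"

end

theory Submission
  imports Defs
begin

text \<open>
  Put \<open>r = exp (- 2 * u)\<close> and \<open>\<kappa> = (m + d) / 2\<close>, so \<open>\<kappa> \<ge> 0\<close>. Mehler's formula (\<open>heat_kernel_eq\<close>) writes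
  the heat kernel at time \<open>u\<close> as \<open>exp (\<bar>x\<bar>\<^sup>2 / 2) * k u x y * exp (- \<bar>y\<bar>\<^sup>2 / 2)\<close>, where
  \<open>k u x y = r powr \<kappa> * (\<pi> * (1 - r\<^sup>2)) powr (- d / 2) * exp (- \<bar>x - r y\<bar>\<^sup>2 / (1 - r\<^sup>2))\<close>.
  The first exponential is cancelled by the factor \<open>exp (- p * \<bar>x\<bar>\<^sup>2 / 2)\<close> of the target weight, and
  the last one turns \<open>f\<close> into \<open>F y = \<bar>f y\<bar> * exp (- \<bar>y\<bar>\<^sup>2 / 2)\<close>. Only losses polynomial in \<open>x\<close>
  remain, and the factor \<open>(1 + \<bar>x\<bar>) powr (- N)\<close> pays for them. The proof joins two estimates.

  Pointwise bound (\<open>subordinated_kernel_bound\<close>, \<open>Poisson_pointwise_bound\<close>): with an exponent \<open>A\<close>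
  depending only on \<open>d\<close>, \<open>m\<close> and \<open>\<nu>\<close>, the maximal function of \<open>f\<close> is at most
  \<open>C * exp (\<bar>x\<bar>\<^sup>2 / 2) * (1 + \<bar>x\<bar>) powr A * (loc_max F x + \<integral> \<bar>f\<bar> \<phi>)\<close>. The region
  \<open>\<bar>y\<bar> \<le> 3 * max \<bar>x\<bar> 1\<close> produces the maximal function: there \<open>k\<close> is dominated by a Gaussian centred
  at \<open>x\<close> while \<open>1 - r \<le> 1 / (max \<bar>x\<bar> 1)\<^sup>2\<close>, and by a power of \<open>1 + \<bar>x\<bar>\<close> afterwards. Outside this region
  small times contribute an arbitrary inverse power of \<open>\<bar>y\<bar>\<close>. For large times the inequality
  \<open>1 + r * \<bar>y\<bar> \<le> (1 + \<bar>x\<bar>) * (1 + \<bar>x - r y\<bar>)\<close> separates \<open>x\<close> from \<open>y\<close> and leaves the scalar integral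
  of \<open>u powr (- 1 - \<nu>) * r powr \<kappa> * (1 + r * \<bar>y\<bar>) powr (- B)\<close>. It is concentrated where \<open>r\<close> is about
  \<open>1 / \<bar>y\<bar>\<close>, that is \<open>u\<close> about \<open>ln \<bar>y\<bar> / 2\<close>, if \<open>\<kappa> > 0\<close>, and spread over all later times if
  \<open>\<kappa> = 0\<close>; hence the two shapes of \<open>\<phi>\<close> (\<open>large_time_integral_le_decay\<close>).

  Two-weight bound (\<open>loc_max_two_weight\<close>): let \<open>W y = w y powr (- p' / p) * exp (- p' * \<bar>y\<bar>\<^sup>2 / 2)\<close>,
  so that \<open>\<integral> F powr p * W powr (1 - p) = \<integral> \<bar>f\<bar> powr p * w\<close>. On the set where \<open>loc_max W \<le> b\<close> the
  operator taking \<open>g\<close> to \<open>loc_max (g W)\<close> is bounded by \<open>b\<close> from \<open>L\<^sup>\<infinity>\<close> to \<open>L\<^sup>\<infinity>\<close> and of weak type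
  from \<open>L\<^sup>1(W dx)\<close> to \<open>L\<^sup>1(dx)\<close> uniformly in \<open>b\<close>, so Marcinkiewicz interpolation bounds it from
  \<open>L\<^sup>p(W dx)\<close> to \<open>L\<^sup>p(dx)\<close>, the \<open>p\<close>-th power of the norm being a multiple of \<open>b powr (p - 1)\<close>
  (\<open>loc_max_sublevel_bound\<close>). Against the weight \<open>loc_max W powr (- \<alpha> * (p - 1))\<close> with \<open>\<alpha> > 1\<close> the
  bounds for dyadic \<open>b\<close> form a convergent geometric series. The series starts at a positive \<open>b\<close>
  because \<open>loc_max W x\<close> is at least a multiple of \<open>(1 + \<bar>x\<bar>) powr (- d)\<close>.

  The integrability hypothesis on \<open>w\<close> enters twice: Hoelder's inequality turns it into a bound of
  \<open>\<integral> \<bar>f\<bar> \<phi>\<close> by the norm of \<open>f\<close>, and it makes \<open>W\<close> locally integrable, so that \<open>loc_max W\<close> is finite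
  and the target weight positive almost everywhere.
\<close>

section \<open>The Hardy-Littlewood maximal function\<close>

lemma ball_borel [measurable]: "ball (x::'a::metric_space) r \<in> sets borel"
  by simp

lemma emeasure_ball_pos: "0 < r \<Longrightarrow> 0 < emeasure lborel (ball (x::'a::euclidean_space) r)"
  by (simp add: emeasure_ball)

lemma emeasure_ball_finite: "emeasure lborel (ball (x::'a::euclidean_space) r) \<noteq> top"
  using emeasure_lborel_ball_finite[of x r] by auto

lemma emeasure_ball_mult_divide:
  assumes "0 < r"
  shows "emeasure lborel (ball (x::'a::euclidean_space) r) * (a / emeasure lborel (ball x r)) = a"
  using emeasure_ball_pos[OF assms, of x] emeasure_ball_finite[of x r]
  by (metis ennreal_times_divide mult.commute mult_divide_eq_ennreal not_gr_zero)

text \<open>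
  The operator acts on functions with values in \<open>[0, \<infinity>]\<close>, so that truncations and sums of functions,
  and the value \<open>\<infinity>\<close> of a maximal function, need no side conditions.
\<close>

definition hl_max :: "('a::euclidean_space \<Rightarrow> ennreal) \<Rightarrow> 'a \<Rightarrow> ennreal" where
  "hl_max G x =
     (SUP r\<in>{0<..}. (\<integral>\<^sup>+ y\<in>ball x r. G y \<partial>lborel) / emeasure lborel (ball x r))"

lemma nn_integral_ball_le_hl_max:
  assumes "0 < r"
  shows "(\<integral>\<^sup>+ y\<in>ball x r. G y \<partial>lborel) \<le> emeasure lborel (ball x r) * hl_max G x"
proof -
  let ?I = "\<integral>\<^sup>+ y\<in>ball x r. G y \<partial>lborel" and ?e = "emeasure lborel (ball x r)"
  have "?I / ?e \<le> hl_max G x"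
    unfolding hl_max_def using assms by (intro SUP_upper) auto
  then have "?e * (?I / ?e) \<le> ?e * hl_max G x"
    by (intro mult_left_mono) auto
  moreover have "?e * (?I / ?e) = ?I"
    by (rule emeasure_ball_mult_divide[OF assms])
  ultimately show ?thesis by simp
qed

lemma hl_max_leI:
  assumes "\<And>r. 0 < r \<Longrightarrow> (\<integral>\<^sup>+ y\<in>ball x r. G y \<partial>lborel) \<le> emeasure lborel (ball x r) * b"
  shows "hl_max G x \<le> b"
  unfolding hl_max_def
proof (rule SUP_least)
  fix r :: real assume "r \<in> {0<..}"
  then have r: "0 < r" by simp
  show "(\<integral>\<^sup>+ y\<in>ball x r. G y \<partial>lborel) / emeasure lborel (ball x r) \<le> b"
    using assms[OF r] emeasure_ball_pos[OF r, of x]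
    by (intro divide_le_posI_ennreal) (auto simp: mult.commute)
qed

lemma hl_max_mono:
  assumes "\<And>y. G y \<le> H y"
  shows "hl_max G x \<le> hl_max H x"
  unfolding hl_max_def
  by (intro SUP_mono' divide_right_mono_ennreal nn_integral_mono mult_right_mono assms) auto

text \<open>
  Homogeneity and subadditivity are used to split a function into two parts.
\<close>

lemma hl_max_cmult_le:
  assumes [measurable]: "G \<in> borel_measurable borel"
  shows "hl_max (\<lambda>y. c * G y) x \<le> c * hl_max G x"
proof (rule hl_max_leI)
  fix r :: real assume r: "0 < r"
  have "(\<integral>\<^sup>+ y\<in>ball x r. c * G y \<partial>lborel) = c * (\<integral>\<^sup>+ y\<in>ball x r. G y \<partial>lborel)"
    by (subst nn_integral_cmult[symmetric]) (auto simp: mult.assoc)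
  also have "\<dots> \<le> c * (emeasure lborel (ball x r) * hl_max G x)"
    by (intro mult_left_mono nn_integral_ball_le_hl_max r) auto
  finally show "(\<integral>\<^sup>+ y\<in>ball x r. c * G y \<partial>lborel) \<le> emeasure lborel (ball x r) * (c * hl_max G x)"
    by (simp add: mult_ac)
qed

lemma hl_max_add_le:
  assumes [measurable]: "G \<in> borel_measurable borel" "H \<in> borel_measurable borel"
  shows "hl_max (\<lambda>y. G y + H y) x \<le> hl_max G x + hl_max H x"
proof (rule hl_max_leI)
  fix r :: real assume r: "0 < r"
  have "(\<integral>\<^sup>+ y\<in>ball x r. G y + H y \<partial>lborel)
      = (\<integral>\<^sup>+ y\<in>ball x r. G y \<partial>lborel) + (\<integral>\<^sup>+ y\<in>ball x r. H y \<partial>lborel)"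
    by (subst nn_integral_add[symmetric]) (auto simp: distrib_right)
  also have "\<dots> \<le> emeasure lborel (ball x r) * hl_max G x + emeasure lborel (ball x r) * hl_max H x"
    by (intro add_mono nn_integral_ball_le_hl_max r)
  finally show "(\<integral>\<^sup>+ y\<in>ball x r. G y + H y \<partial>lborel)
      \<le> emeasure lborel (ball x r) * (hl_max G x + hl_max H x)"
    by (simp add: distrib_left)
qed

lemma hl_max_cong_AE:
  assumes "AE y in lborel. G y = H y"
  shows "hl_max G x = hl_max H x"
proof -
  have "(\<integral>\<^sup>+ y\<in>ball x r. G y \<partial>lborel) = (\<integral>\<^sup>+ y\<in>ball x r. H y \<partial>lborel)" for r
    using assms by (intro nn_integral_cong_AE) auto
  then show ?thesis unfolding hl_max_def by simp
qed

text \<open>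
  Around every point of \<open>S\<close> there is a ball on which the integral of \<open>G\<close> exceeds \<open>l\<close> times the volume.
  By Vitali's lemma a disjoint subfamily still covers \<open>S\<close> after dilation by \<open>5\<close>, and disjointness bounds
  the sum of the integrals. The set \<open>S\<close> is arbitrary; a set that is not measurable has measure \<open>0\<close> by
  convention, which is harmless on the left hand side.
\<close>

theorem hl_max_weak_type:
  fixes G :: "'a::euclidean_space \<Rightarrow> ennreal"
  assumes G[measurable]: "G \<in> borel_measurable borel" and l: "0 < l"
    and S: "S \<subseteq> {x. ennreal l < hl_max G x}"
  shows "ennreal l * emeasure lborel S \<le> 5 ^ DIM('a) * (\<integral>\<^sup>+ y. G y \<partial>lborel)"
proof (cases "(\<integral>\<^sup>+ y. G y \<partial>lborel) = top")
  case True
  then show ?thesis by (simp add: ennreal_mult_top)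
next
  case False
  define I where "I = enn2real (\<integral>\<^sup>+ y. G y \<partial>lborel)"
  have I: "(\<integral>\<^sup>+ y. G y \<partial>lborel) = ennreal I" "I \<ge> 0"
    using False by (auto simp: I_def less_top)
  let ?d = "DIM('a)"
  let ?w = "unit_ball_vol (real ?d)"
  have "\<exists>r>0. ennreal l * emeasure lborel (ball x r) \<le> (\<integral>\<^sup>+ y\<in>ball x r. G y \<partial>lborel)"
    if x: "x \<in> S" for x
  proof -
    have "ennreal l < hl_max G x" using S x by auto
    then obtain r where r: "r > 0"
      "ennreal l < (\<integral>\<^sup>+ y\<in>ball x r. G y \<partial>lborel) / emeasure lborel (ball x r)"
      unfolding hl_max_def less_SUP_iff by auto
    let ?e = "emeasure lborel (ball x r)"
    have "?e * ennreal l \<le> ?e * ((\<integral>\<^sup>+ y\<in>ball x r. G y \<partial>lborel) / ?e)"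
      using r by (intro mult_left_mono) auto
    also have "\<dots> = (\<integral>\<^sup>+ y\<in>ball x r. G y \<partial>lborel)"
      by (rule emeasure_ball_mult_divide[OF r(1)])
    finally show ?thesis using r by (auto simp: mult.commute)
  qed
  then obtain \<rho> where \<rho>: "\<And>x. x \<in> S \<Longrightarrow> \<rho> x > 0"
    "\<And>x. x \<in> S \<Longrightarrow> ennreal l * emeasure lborel (ball x (\<rho> x)) \<le> (\<integral>\<^sup>+ y\<in>ball x (\<rho> x). G y \<partial>lborel)"
    by metis
  have w: "?w > 0" by simp
  \<comment> \<open>Vitali's lemma needs bounded radii. A radius above \<open>1\<close> is at most its \<open>d\<close>-th power,
    and the volume of the ball is at most \<open>I / l\<close>.\<close>
  have bd: "\<rho> x \<le> max 1 (I / (l * ?w))" if x: "x \<in> S" for x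
  proof -
    have "ennreal l * emeasure lborel (ball x (\<rho> x)) \<le> ennreal I"
      unfolding I(1)[symmetric] using \<rho>(2)[OF x]
      by (rule order_trans) (auto intro!: nn_integral_mono simp: indicator_def)
    then have "l * (?w * \<rho> x ^ ?d) \<le> I"
      using \<rho>(1)[OF x] l I(2) w
      by (simp add: emeasure_ball ennreal_mult[symmetric])
    then have *: "\<rho> x ^ ?d \<le> I / (l * ?w)"
      using l w by (simp add: field_simps)
    show ?thesis
    proof (cases "\<rho> x \<le> 1")
      case False
      then have "\<rho> x \<le> \<rho> x ^ ?d" by (simp add: self_le_power)
      then show ?thesis using * by simp
    qed auto
  qed
  obtain C where C: "countable C" "C \<subseteq> S"
    "pairwise (\<lambda>i j. disjnt (ball i (\<rho> i)) (ball j (\<rho> j))) C"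
    "S \<subseteq> (\<Union>i\<in>C. ball i (5 * \<rho> i))"
    by (rule Vitali_covering_lemma_balls[where K=S and a="\<lambda>x. x" and r=\<rho> and S=S])
       (use \<rho> bd in force)+
  have "emeasure lborel S \<le> emeasure lborel (\<Union>i\<in>C. ball i (5 * \<rho> i))"
    using C by (intro emeasure_mono) auto
  also have "\<dots> = (\<integral>\<^sup>+ y. indicator (\<Union>i\<in>C. ball i (5 * \<rho> i)) y \<partial>lborel)"
    using C(1) by (subst nn_integral_indicator) auto
  also have "\<dots> \<le> (\<integral>\<^sup>+ y. \<integral>\<^sup>+ i. indicator (ball i (5 * \<rho> i)) y \<partial>count_space C \<partial>lborel)"
  proof (intro nn_integral_mono)
    fix y :: 'a
    show "indicator (\<Union>i\<in>C. ball i (5 * \<rho> i)) y \<le> (\<integral>\<^sup>+ i. indicator (ball i (5 * \<rho> i)) y \<partial>count_space C)"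
    proof (cases "y \<in> (\<Union>i\<in>C. ball i (5 * \<rho> i))")
      case True
      then obtain i where i: "i \<in> C" "y \<in> ball i (5 * \<rho> i)" by auto
      then have "(1::ennreal) = indicator (ball i (5 * \<rho> i)) y" by simp
      also have "\<dots> \<le> (\<integral>\<^sup>+ i. indicator (ball i (5 * \<rho> i)) y \<partial>count_space C)"
        using i by (intro nn_integral_ge_point)
      finally show ?thesis using True by simp
    qed simp
  qed
  also have "\<dots> = (\<integral>\<^sup>+ i. \<integral>\<^sup>+ y. indicator (ball i (5 * \<rho> i)) y \<partial>lborel \<partial>count_space C)"
    using C(1) by (intro nn_integral_count_space_nn_integral) auto
  also have "\<dots> = (\<integral>\<^sup>+ i. 5 ^ ?d * emeasure lborel (ball i (\<rho> i)) \<partial>count_space C)"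
  proof (intro nn_integral_cong)
    fix i assume "i \<in> space (count_space C)"
    then have "\<rho> i > 0" using C \<rho> by auto
    moreover have "(5::ennreal) ^ ?d = ennreal (5 ^ ?d)"
      by (metis ennreal_numeral ennreal_power zero_le_numeral)
    ultimately show "(\<integral>\<^sup>+ y. indicator (ball i (5 * \<rho> i)) y \<partial>lborel) = 5 ^ ?d * emeasure lborel (ball i (\<rho> i))"
      by (simp add: emeasure_ball ennreal_mult[symmetric] power_mult_distrib mult_ac)
  qed
  finally have "ennreal l * emeasure lborel S
      \<le> ennreal l * (\<integral>\<^sup>+ i. 5 ^ ?d * emeasure lborel (ball i (\<rho> i)) \<partial>count_space C)"
    by (intro mult_left_mono) auto
  also have "\<dots> = 5 ^ ?d * (\<integral>\<^sup>+ i. ennreal l * emeasure lborel (ball i (\<rho> i)) \<partial>count_space C)"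
  proof -
    have "(\<integral>\<^sup>+ i. 5 ^ ?d * emeasure lborel (ball i (\<rho> i)) \<partial>count_space C)
        = 5 ^ ?d * (\<integral>\<^sup>+ i. emeasure lborel (ball i (\<rho> i)) \<partial>count_space C)"
      by (rule nn_integral_cmult) simp
    moreover have "(\<integral>\<^sup>+ i. ennreal l * emeasure lborel (ball i (\<rho> i)) \<partial>count_space C)
        = ennreal l * (\<integral>\<^sup>+ i. emeasure lborel (ball i (\<rho> i)) \<partial>count_space C)"
      by (rule nn_integral_cmult) simp
    ultimately show ?thesis by (simp only: mult.left_commute)
  qed
  also have "\<dots> \<le> 5 ^ ?d * (\<integral>\<^sup>+ i. emeasure (density lborel G) (ball i (\<rho> i)) \<partial>count_space C)"
    using C \<rho> by (intro mult_left_mono nn_integral_mono) (auto simp: emeasure_density)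
  \<comment> \<open>Disjointness of the balls enters through additivity of the measure with density \<open>G\<close>.\<close>
  also have "(\<integral>\<^sup>+ i. emeasure (density lborel G) (ball i (\<rho> i)) \<partial>count_space C)
      = emeasure (density lborel G) (\<Union>i\<in>C. ball i (\<rho> i))"
    using C(1,3) by (subst emeasure_UN_countable)
      (auto simp: disjoint_family_on_def pairwise_def disjnt_def)
  also have "\<dots> \<le> (\<integral>\<^sup>+ y. G y \<partial>lborel)"
    using C(1) by (subst emeasure_density)
      (auto intro!: nn_integral_mono simp: indicator_def)
  finally show ?thesis by (simp add: mult_left_mono)
qed

text \<open>
  An open ball is the increasing union of the concentric balls with smaller rational radii, so the
  averages over the latter have a limit inferior at least as large (Fatou). A countable supremum is what
  makes the maximal function measurable.
\<close>

lemma hl_max_eq_SUP_rational: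
  assumes [measurable]: "G \<in> borel_measurable borel"
  shows "hl_max G x =
    (SUP r\<in>{0<..} \<inter> \<rat>. (\<integral>\<^sup>+ y\<in>ball x r. G y \<partial>lborel) / emeasure lborel (ball x r))"
    (is "_ = ?R")
proof (rule antisym)
  show "?R \<le> hl_max G x"
    unfolding hl_max_def by (rule SUP_subset_mono) auto
  show "hl_max G x \<le> ?R"
  proof (rule hl_max_leI)
    fix r :: real assume r: "0 < r"
    have "\<exists>q\<in>\<rat>. r - r / (real n + 2) < q \<and> q < r" for n
      by (rule Rats_dense_in_real) (use r in auto)
    then obtain q where q: "\<And>n. q n \<in> \<rat>" "\<And>n. r - r / (real n + 2) < q n" "\<And>n. q n < r"
      by metis
    have q0: "0 < q n" for n
    proof -
      have "r / (real n + 2) < r" using r by (simp add: divide_less_eq)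
      then show ?thesis using q(2)[of n] by simp
    qed
    have lim: "q \<longlonglongrightarrow> r"
    proof (rule tendsto_sandwich)
      show "\<forall>\<^sub>F n in sequentially. r - r / (real n + 2) \<le> q n" using q(2) by (simp add: less_imp_le)
      show "\<forall>\<^sub>F n in sequentially. q n \<le> r" using q(3) by (simp add: less_imp_le)
      show "(\<lambda>n. r - r / (real n + 2)) \<longlonglongrightarrow> r" by real_asymp
    qed simp
    have "(\<integral>\<^sup>+ y\<in>ball x r. G y \<partial>lborel)
        \<le> (\<integral>\<^sup>+ y. liminf (\<lambda>n. G y * indicator (ball x (q n)) y) \<partial>lborel)"
    proof (rule nn_integral_mono)
      fix y
      show "G y * indicator (ball x r) y \<le> liminf (\<lambda>n. G y * indicator (ball x (q n)) y)"
      proof (cases "y \<in> ball x r")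
        case True
        then have "\<forall>\<^sub>F n in sequentially. dist x y < q n"
          using lim by (intro order_tendstoD) auto
        then have "\<forall>\<^sub>F n in sequentially. G y \<le> G y * indicator (ball x (q n)) y"
          by eventually_elim auto
        then show ?thesis using True by (simp add: Liminf_bounded)
      qed simp
    qed
    also have "\<dots> \<le> liminf (\<lambda>n. \<integral>\<^sup>+ y\<in>ball x (q n). G y \<partial>lborel)"
      by (intro nn_integral_liminf) measurable
    also have "\<dots> \<le> liminf (\<lambda>n. emeasure lborel (ball x r) * ?R)"
    proof (rule Liminf_mono, rule always_eventually, rule allI)
      fix n
      let ?e = "emeasure lborel (ball x (q n))"
      have "(\<integral>\<^sup>+ y\<in>ball x (q n). G y \<partial>lborel) = ?e * ((\<integral>\<^sup>+ y\<in>ball x (q n). G y \<partial>lborel) / ?e)"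
        by (rule emeasure_ball_mult_divide[OF q0, symmetric])
      also have "\<dots> \<le> emeasure lborel (ball x r) * ?R"
      proof (rule mult_mono)
        show "?e \<le> emeasure lborel (ball x r)"
          using q(3)[of n] by (intro emeasure_mono subset_ball) auto
        show "(\<integral>\<^sup>+ y\<in>ball x (q n). G y \<partial>lborel) / ?e \<le> ?R"
          using q0 q(1) by (intro SUP_upper) auto
      qed auto
      finally show "(\<integral>\<^sup>+ y\<in>ball x (q n). G y \<partial>lborel) \<le> emeasure lborel (ball x r) * ?R" .
    qed
    also have "\<dots> = emeasure lborel (ball x r) * ?R"
      by (simp add: Liminf_const)
    finally show "(\<integral>\<^sup>+ y\<in>ball x r. G y \<partial>lborel) \<le> emeasure lborel (ball x r) * ?R" .
  qed
qed

text \<open>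
  The function may depend on the point of evaluation, as it does in the truncation of the local
  operator.
\<close>

lemma borel_measurable_hl_max:
  fixes G :: "'a::euclidean_space \<Rightarrow> 'a \<Rightarrow> ennreal"
  assumes G[measurable]: "(\<lambda>(x, y). G x y) \<in> borel_measurable (borel \<Otimes>\<^sub>M borel)"
  shows "(\<lambda>x. hl_max (G x) x) \<in> borel_measurable borel"
proof -
  have m: "G x \<in> borel_measurable borel" for x
    using measurable_compose[OF measurable_Pair1'[of x borel borel] G] by simp
  have "(\<lambda>x. hl_max (G x) x) =
      (\<lambda>x. SUP r\<in>{0<..} \<inter> \<rat>. (\<integral>\<^sup>+ y. G x y * indicator {y. dist x y < r} y \<partial>lborel)
          / emeasure lborel (ball (0::'a) r))"
    unfolding hl_max_eq_SUP_rational[OF m]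
    by (intro ext SUP_cong) (auto simp: emeasure_ball ball_def[symmetric])
  also have "\<dots> \<in> borel_measurable borel"
  proof (rule borel_measurable_SUP)
    show "countable ({0<..} \<inter> \<rat> :: real set)" using countable_rat by blast
    fix r :: real
    have "(\<lambda>x. \<integral>\<^sup>+ y. G x y * indicator {y. dist x y < r} y \<partial>lborel) \<in> borel_measurable borel"
      by (rule sigma_finite_measure.borel_measurable_nn_integral)
         (auto simp: sigma_finite_lborel split_beta' intro!: measurable_compose[OF _ G])
    then show "(\<lambda>x. (\<integral>\<^sup>+ y. G x y * indicator {y. dist x y < r} y \<partial>lborel)
        / emeasure lborel (ball (0::'a) r)) \<in> borel_measurable borel"
      by simp
  qed
  finally show ?thesis .
qed

text \<open>
  The set where the maximal function is infinite lies in all the level sets, whose measures tend to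
  \<open>0\<close> by the weak type inequality.
\<close>

lemma AE_hl_max_finite:
  fixes G :: "'a::euclidean_space \<Rightarrow> ennreal"
  assumes G[measurable]: "G \<in> borel_measurable borel" and fin: "(\<integral>\<^sup>+ y. G y \<partial>lborel) < top"
  shows "AE x in lborel. hl_max G x < top"
proof -
  have [measurable]: "hl_max G \<in> borel_measurable borel"
    using borel_measurable_hl_max[of "\<lambda>_. G"] by simp
  let ?S = "{x. hl_max G x = top}"
  have "ennreal (real n) * emeasure lborel ?S \<le> 5 ^ DIM('a) * (\<integral>\<^sup>+ y. G y \<partial>lborel)" for n
  proof (cases "n = 0")
    case False
    then show ?thesis by (intro hl_max_weak_type) auto
  qed auto
  moreover have f: "5 ^ DIM('a) * (\<integral>\<^sup>+ y. G y \<partial>lborel) < top"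
    using fin by (simp add: ennreal_mult_less_top power_less_top_ennreal)
  ultimately have *: "of_nat n * emeasure lborel ?S \<le> 5 ^ DIM('a) * (\<integral>\<^sup>+ y. G y \<partial>lborel)" for n
    by (simp only: ennreal_of_nat_eq_real_of_nat)
  have "emeasure lborel ?S = 0"
  proof (rule ccontr)
    assume "emeasure lborel ?S \<noteq> 0"
    then have "(SUP n. of_nat n * emeasure lborel ?S) = (top::ennreal)"
      unfolding SUP_mult_right_ennreal[symmetric] ennreal_SUP_of_nat_eq_top
      by (simp add: ennreal_top_mult)
    moreover have "(SUP n. of_nat n * emeasure lborel ?S) \<le> 5 ^ DIM('a) * (\<integral>\<^sup>+ y. G y \<partial>lborel)"
      using * by (intro SUP_least) auto
    ultimately have "top \<le> 5 ^ DIM('a) * (\<integral>\<^sup>+ y. G y \<partial>lborel)" by (rule ord_eq_le_trans[OF sym])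
    then show False using f leD by blast
  qed
  then have "?S \<in> null_sets lborel" by (auto simp: null_sets_def)
  from AE_not_in[OF this] show ?thesis
    by eventually_elim (auto simp: less_top)
qed

text \<open>
  At the least \<open>j\<close> with \<open>z < 2 ^ j\<close> the sum already has a large enough term, since then
  \<open>2 ^ j \<le> 2 * (1 + z)\<close>.
\<close>

lemma inverse_power_le_dyadic_sum:
  fixes z :: real
  assumes "0 \<le> z"
  shows "ennreal (1 / (1 + z) ^ k)
    \<le> (\<Sum>j. ennreal ((2 / 2 ^ j) ^ k) * indicator {..<2 ^ j} z)"
proof -
  obtain n0 where "z < 2 ^ n0" using real_arch_pow[of 2 z] by auto
  then have ex: "\<exists>n. z < 2 ^ n" by blast
  define n where "n = (LEAST n. z < 2 ^ n)"
  have n: "z < 2 ^ n" unfolding n_def using ex by (rule LeastI_ex)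
  have "2 ^ n \<le> 2 * (1 + z)"
  proof (cases n)
    case 0
    then show ?thesis using assms by simp
  next
    case (Suc m)
    then have "\<not> z < 2 ^ m" unfolding n_def by (metis lessI not_less_Least)
    then show ?thesis using Suc by simp
  qed
  then have "1 / (1 + z) \<le> 2 / 2 ^ n" using assms by (simp add: field_simps)
  then have "(1 / (1 + z)) ^ k \<le> (2 / 2 ^ n) ^ k" using assms by (intro power_mono) auto
  then have "ennreal (1 / (1 + z) ^ k) \<le> ennreal ((2 / 2 ^ n) ^ k) * indicator {..<2 ^ n} z"
    using n by (simp add: power_one_over power_divide ennreal_leI)
  also have "\<dots> = (\<Sum>j\<in>{n}. ennreal ((2 / 2 ^ j) ^ k) * indicator {..<2 ^ j} z)"
    by (simp del: sum_mult_indicator sum_ennreal)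
  also have "\<dots> \<le> (\<Sum>j. ennreal ((2 / 2 ^ j) ^ k) * indicator {..<2 ^ j} z)"
    by (intro sum_le_suminf) auto
  finally show ?thesis .
qed

text \<open>
  The bump is a superposition of indicators of balls with radii \<open>2 ^ j * \<rho>\<close>. The exponent \<open>d + 1\<close>
  beats the growth of their volumes by the factor \<open>2 ^ j\<close>, which makes the sum converge.
\<close>

lemma nn_integral_bump_le_hl_max:
  fixes x :: "'a::euclidean_space"
  assumes [measurable]: "G \<in> borel_measurable borel" and \<rho>: "0 < \<rho>"
  shows "(\<integral>\<^sup>+ y. ennreal (1 / (1 + dist x y / \<rho>) ^ (DIM('a) + 1)) * G y \<partial>lborel)
    \<le> ennreal (2 ^ (DIM('a) + 2) * unit_ball_vol (DIM('a)) * \<rho> ^ DIM('a)) * hl_max G x"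
proof -
  let ?d = "DIM('a)" let ?w = "unit_ball_vol (real ?d)"
  have G_ball: "(\<lambda>y. G y * indicator (ball x (2 ^ j * \<rho>)) y) \<in> borel_measurable lborel" for j :: nat
    by simp
  have w: "?w > 0" by simp
  have "(\<integral>\<^sup>+ y. ennreal (1 / (1 + dist x y / \<rho>) ^ (?d + 1)) * G y \<partial>lborel)
     \<le> (\<integral>\<^sup>+ y. (\<Sum>j. ennreal ((2 / 2 ^ j) ^ (?d + 1)) * indicator {..<2 ^ j} (dist x y / \<rho>)) * G y \<partial>lborel)"
    using \<rho> by (intro nn_integral_mono mult_right_mono inverse_power_le_dyadic_sum) auto
  also have "\<dots> = (\<integral>\<^sup>+ y. (\<Sum>j. ennreal ((2 / 2 ^ j) ^ (?d + 1)) * (G y * indicator (ball x (2 ^ j * \<rho>)) y)) \<partial>lborel)"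
  proof (rule nn_integral_cong)
    fix y
    have "indicator {..<2 ^ j} (dist x y / \<rho>) = (indicator (ball x (2 ^ j * \<rho>)) y :: ennreal)" for j :: nat
      using \<rho> by (auto simp: indicator_def field_simps)
    then show "(\<Sum>j. ennreal ((2 / 2 ^ j) ^ (?d + 1)) * indicator {..<2 ^ j} (dist x y / \<rho>)) * G y
      = (\<Sum>j. ennreal ((2 / 2 ^ j) ^ (?d + 1)) * (G y * indicator (ball x (2 ^ j * \<rho>)) y))"
      by (subst ennreal_suminf_multc[symmetric]) (auto simp: mult_ac)
  qed
  also have "\<dots> = (\<Sum>j. ennreal ((2 / 2 ^ j) ^ (?d + 1)) * (\<integral>\<^sup>+ y\<in>ball x (2 ^ j * \<rho>). G y \<partial>lborel))"
  proof -
    have "(\<integral>\<^sup>+ y. (\<Sum>j. ennreal ((2 / 2 ^ j) ^ (?d + 1)) * (G y * indicator (ball x (2 ^ j * \<rho>)) y)) \<partial>lborel)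
      = (\<Sum>j. \<integral>\<^sup>+ y. ennreal ((2 / 2 ^ j) ^ (?d + 1)) * (G y * indicator (ball x (2 ^ j * \<rho>)) y) \<partial>lborel)"
      by (intro nn_integral_suminf borel_measurable_times_ennreal G_ball borel_measurable_const)
    also have "\<dots> = (\<Sum>j. ennreal ((2 / 2 ^ j) ^ (?d + 1)) * (\<integral>\<^sup>+ y\<in>ball x (2 ^ j * \<rho>). G y \<partial>lborel))"
      by (rule suminf_cong, rule nn_integral_cmult) (rule G_ball)
    finally show ?thesis .
  qed
  also have "\<dots> \<le> (\<Sum>j. ennreal (2 ^ (?d + 1) * ?w * \<rho> ^ ?d * (1/2) ^ j) * hl_max G x)"
  proof (intro suminf_le summableI)
    fix j :: nat
    have r: "0 < 2 ^ j * \<rho>" using \<rho> by simp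
    have "(2 / 2 ^ j) ^ (?d + 1) * (?w * (2 ^ j * \<rho>) ^ ?d) = 2 ^ (?d + 1) * ?w * \<rho> ^ ?d * (1/2) ^ j"
      by (simp add: power_divide power_mult_distrib field_simps power_add)
    then have e: "ennreal ((2 / 2 ^ j) ^ (?d + 1)) * emeasure lborel (ball x (2 ^ j * \<rho>))
      = ennreal (2 ^ (?d + 1) * ?w * \<rho> ^ ?d * (1/2) ^ j)"
      using r by (subst emeasure_ball) (auto simp: ennreal_mult[symmetric])
    have "ennreal ((2 / 2 ^ j) ^ (?d + 1)) * (\<integral>\<^sup>+ y\<in>ball x (2 ^ j * \<rho>). G y \<partial>lborel)
      \<le> ennreal ((2 / 2 ^ j) ^ (?d + 1)) * (emeasure lborel (ball x (2 ^ j * \<rho>)) * hl_max G x)"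
      by (intro mult_left_mono nn_integral_ball_le_hl_max r) auto
    then show "ennreal ((2 / 2 ^ j) ^ (?d + 1)) * (\<integral>\<^sup>+ y\<in>ball x (2 ^ j * \<rho>). G y \<partial>lborel)
      \<le> ennreal (2 ^ (?d + 1) * ?w * \<rho> ^ ?d * (1/2) ^ j) * hl_max G x"
      using e by (simp only: mult.assoc[symmetric])
  qed
  also have "\<dots> = (\<Sum>j. ennreal (2 ^ (?d + 1) * ?w * \<rho> ^ ?d * (1/2) ^ j)) * hl_max G x"
    by simp
  also have "(\<Sum>j. ennreal (2 ^ (?d + 1) * ?w * \<rho> ^ ?d * (1/2) ^ j))
     = ennreal (2 ^ (?d + 2) * ?w * \<rho> ^ ?d)"
    using w \<rho> by (subst suminf_ennreal2)
      (auto simp: suminf_mult suminf_geometric intro!: summable_mult arg_cong[where f=ennreal])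
  finally show ?thesis .
qed

text \<open>
  This is the previous estimate for the constant function \<open>1\<close>, whose maximal function is at most \<open>1\<close>.
\<close>

lemma nn_integral_inverse_power_finite:
  "(\<integral>\<^sup>+ y. ennreal (1 / (1 + norm (y::'a::euclidean_space)) ^ (DIM('a) + 1)) \<partial>lborel) < top"
proof -
  have "hl_max (\<lambda>_. 1) (0::'a) \<le> 1"
    by (rule hl_max_leI) simp
  then have "ennreal (2 ^ (DIM('a) + 2) * unit_ball_vol (DIM('a)) * 1 ^ DIM('a)) * hl_max (\<lambda>_. 1) (0::'a)
    \<le> ennreal (2 ^ (DIM('a) + 2) * unit_ball_vol (DIM('a)) * 1 ^ DIM('a)) * 1"
    by (intro mult_left_mono) auto
  moreover have "\<dots> < top" by simp
  ultimately show ?thesis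
    using nn_integral_bump_le_hl_max[of "\<lambda>_. 1" 1 "0::'a"]
    by (simp add: le_less_trans)
qed

section \<open>Powers and layer cakes with values in the extended half line\<close>

text \<open>
  The formula \<open>c powr q = \<integral> q * l powr (q - 1) dl\<close> over \<open>0 < l < c\<close> expresses a power through level
  sets; the interval is open so that it matches strict inequalities between values and levels.
\<close>

lemma layer_cake_real:
  fixes q c :: real
  assumes "0 < q" "0 \<le> c"
  shows "(\<integral>\<^sup>+ l. ennreal (q * l powr (q - 1)) * indicator {0<..<c} l \<partial>lborel) = ennreal (c powr q)"
proof -
  have "((\<lambda>l. l powr (q - 1)) has_integral (c powr q / q)) {0..c}"
    using has_integral_powr_from_0[of "q - 1" c] assms by simp
  from has_integral_mult_right[OF this, of q]
  have "((\<lambda>l. q * l powr (q - 1)) has_integral (c powr q)) {0..c}"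
    using assms by simp
  from nn_integral_has_integral_lebesgue[OF _ this]
  have "(\<integral>\<^sup>+ l. ennreal (indicator {0..c} l * (q * l powr (q - 1))) \<partial>lborel) = ennreal (c powr q)"
    using assms by simp
  moreover have "(\<integral>\<^sup>+ l. ennreal (q * l powr (q - 1)) * indicator {0<..<c} l \<partial>lborel)
     = (\<integral>\<^sup>+ l. ennreal (indicator {0..c} l * (q * l powr (q - 1))) \<partial>lborel)"
    using AE_lborel_singleton[of 0] AE_lborel_singleton[of c]
    by (intro nn_integral_cong_AE, eventually_elim) (auto simp: indicator_def)
  ultimately show ?thesis by simp
qed

lemma ennpowr_ennreal: "0 \<le> x \<Longrightarrow> ennpowr (ennreal x) r = ennreal (x powr r)"
  by (simp add: ennpowr_def)

lemma ennpowr_top [simp]: "ennpowr top r = top"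
  by (simp add: ennpowr_def)

lemma ennpowr_eq_top_iff [simp]: "ennpowr x r = top \<longleftrightarrow> x = top"
  by (simp add: ennpowr_def)

lemma ennpowr_less_top_iff [simp]: "ennpowr x r < top \<longleftrightarrow> x < top"
  by (metis ennpowr_eq_top_iff less_top)

lemma ennpowr_mono:
  assumes "0 \<le> r" "x \<le> y"
  shows "ennpowr x r \<le> ennpowr y r"
proof (cases "y = top")
  case False
  then have "enn2real x \<le> enn2real y" "x \<noteq> top"
    using assms by (auto simp: enn2real_mono less_top top_unique)
  then show ?thesis
    using False assms by (simp add: ennpowr_def powr_mono2 ennreal_leI)
qed auto

lemma borel_measurable_ennpowr [measurable]:
  "f \<in> borel_measurable M \<Longrightarrow> (\<lambda>x. ennpowr (f x) r) \<in> borel_measurable M"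
proof -
  assume [measurable]: "f \<in> borel_measurable M"
  have "(\<lambda>x. if f x \<in> {top} then top else ennreal (enn2real (f x) powr r)) \<in> borel_measurable M"
    by measurable
  then show ?thesis by (simp add: ennpowr_def)
qed

text \<open>
  For the value \<open>\<infinity>\<close> every level is exceeded and the integral diverges.
\<close>

lemma ennpowr_layer_cake:
  assumes "0 < q"
  shows "ennpowr a q = (\<integral>\<^sup>+ l. ennreal (q * l powr (q - 1)) * indicator {l. 0 < l \<and> ennreal l < a} l \<partial>lborel)"
proof (cases a)
  case (real c)
  have "{l. 0 < l \<and> ennreal l < a} = {0<..<c}"
    using real by (auto simp: ennreal_less_iff)
  then show ?thesis
    using layer_cake_real[OF assms, of c] real by (simp add: ennpowr_ennreal)
next
  case top
  have "ennreal (real n) \<le> (\<integral>\<^sup>+ l. ennreal (q * l powr (q - 1)) * indicator {l. 0 < l \<and> ennreal l < a} l \<partial>lborel)" for n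
  proof -
    have "ennreal (real n) = ennreal ((real n powr (1/q)) powr q)"
      using assms by (simp add: powr_powr)
    also have "\<dots> = (\<integral>\<^sup>+ l. ennreal (q * l powr (q - 1)) * indicator {0<..<real n powr (1/q)} l \<partial>lborel)"
      by (rule layer_cake_real[symmetric]) (use assms in auto)
    also have "\<dots> \<le> (\<integral>\<^sup>+ l. ennreal (q * l powr (q - 1)) * indicator {l. 0 < l \<and> ennreal l < a} l \<partial>lborel)"
      using top by (intro nn_integral_mono) (auto simp: indicator_def)
    finally show ?thesis .
  qed
  then have "(SUP n. of_nat n) \<le> (\<integral>\<^sup>+ l. ennreal (q * l powr (q - 1)) * indicator {l. 0 < l \<and> ennreal l < a} l \<partial>lborel)"
    by (intro SUP_least) (simp add: ennreal_of_nat_eq_real_of_nat)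
  then show ?thesis
    using top by (simp add: ennreal_SUP_of_nat_eq_top top_unique)
qed

section \<open>The local maximal function and its two-weight inequality\<close>

text \<open>
  The cutoff depends on the point \<open>x\<close> of evaluation, but at that point \<open>loc_max\<close> is the ordinary
  maximal operator of the truncated function, and therefore inherits its properties.
\<close>

definition loc_max :: "('a::euclidean_space \<Rightarrow> ennreal) \<Rightarrow> 'a \<Rightarrow> ennreal" where
  "loc_max G x = hl_max (\<lambda>y. G y * indicator {y. norm y \<le> 3 * max (norm x) 1} y) x"

lemma local_max_eq_loc_max: "local_max f x = loc_max (\<lambda>y. ennreal \<bar>f y\<bar>) x"
  unfolding local_max_def loc_max_def hl_max_def
  by (simp add: nn_integral_completion)

lemma loc_max_cong_AE:
  assumes "AE y in lborel. G y = H y"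
  shows "loc_max G x = loc_max H x"
  unfolding loc_max_def using assms by (intro hl_max_cong_AE) auto

lemma borel_measurable_loc_max [measurable]:
  fixes G :: "'a::euclidean_space \<Rightarrow> ennreal"
  assumes [measurable]: "G \<in> borel_measurable borel"
  shows "loc_max G \<in> borel_measurable borel"
  unfolding loc_max_def by (rule borel_measurable_hl_max) (simp add: split_beta')

text \<open>
  The ball with centre \<open>x\<close> and radius \<open>1 + norm x\<close> contains the unit ball around \<open>0\<close>, which the cutoff
  never removes.
\<close>

lemma loc_max_lower_bound:
  fixes G :: "'a::euclidean_space \<Rightarrow> ennreal"
  assumes [measurable]: "G \<in> borel_measurable borel" and pos: "AE y in lborel. 0 < G y"
  obtains c :: real where "0 < c" "\<And>x. ennreal (c / (1 + norm x) ^ DIM('a)) \<le> loc_max G x"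
proof -
  let ?I = "\<integral>\<^sup>+ y\<in>ball 0 1. G y \<partial>lborel" let ?w = "unit_ball_vol (real DIM('a))"
  have "?I \<noteq> 0"
  proof
    assume "?I = 0"
    then have "AE y in lborel. G y * indicator (ball 0 1) y = 0"
      by (subst (asm) nn_integral_0_iff_AE) auto
    with pos have "AE y::'a in lborel. y \<notin> ball 0 1"
      by eventually_elim (auto simp: indicator_def split: if_splits)
    then have "emeasure lborel (ball (0::'a) 1) = 0"
      by (subst (asm) AE_iff_measurable[OF _ refl]) (auto simp: ball_def)
    then show False using emeasure_ball_pos[of 1 "0::'a"] by simp
  qed
  then obtain c0 where c0: "0 < c0" "ennreal c0 \<le> ?I"
  proof (cases ?I)
    case (real r)
    then show ?thesis using that[of r] \<open>?I \<noteq> 0\<close> by (auto simp: less_le)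
  next
    case top
    then show ?thesis using that[of 1] by simp
  qed
  show ?thesis
  proof
    show "0 < c0 / ?w" using c0 by simp
    fix x :: 'a
    define e where "e = ?w * (1 + norm x) ^ DIM('a)"
    have e: "e > 0" unfolding e_def by (intro mult_pos_pos zero_less_power) (auto intro: add_pos_nonneg)
    have "?I \<le> (\<integral>\<^sup>+ y\<in>ball x (1 + norm x). G y * indicator {y. norm y \<le> 3 * max (norm x) 1} y \<partial>lborel)"
    proof (intro nn_integral_mono)
      fix y :: 'a
      have "norm y < 1 \<Longrightarrow> dist x y < 1 + norm x" using dist_triangle2[of x y 0] by simp
      then show "G y * indicator (ball 0 1) y
        \<le> G y * indicator {y. norm y \<le> 3 * max (norm x) 1} y * indicator (ball x (1 + norm x)) y"
        by (auto simp: indicator_def)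
    qed
    also have "\<dots> \<le> emeasure lborel (ball x (1 + norm x)) * loc_max G x"
      unfolding loc_max_def by (intro nn_integral_ball_le_hl_max) (auto intro: add_pos_nonneg)
    also have "emeasure lborel (ball x (1 + norm x)) = ennreal e"
      by (simp add: emeasure_ball e_def)
    finally have "ennreal c0 \<le> ennreal e * loc_max G x" using c0(2) by (rule order_trans[rotated])
    then have "ennreal (1 / e) * ennreal c0 \<le> ennreal (1 / e) * (ennreal e * loc_max G x)"
      by (intro mult_left_mono) auto
    also have "\<dots> = loc_max G x"
      using e by (simp add: mult.assoc[symmetric] ennreal_mult[symmetric])
    also have "ennreal (1 / e) * ennreal c0 = ennreal (c0 / ?w / (1 + norm x) ^ DIM('a))"
      using e c0 by (simp add: ennreal_mult[symmetric] e_def)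
    finally show "ennreal (c0 / ?w / (1 + norm x) ^ DIM('a)) \<le> loc_max G x" .
  qed
qed

text \<open>
  On a ball of radius \<open>n\<close> the local operator only sees the values of \<open>G\<close> on a fixed larger ball, where
  \<open>G\<close> is integrable.
\<close>

lemma AE_loc_max_finite:
  fixes G :: "'a::euclidean_space \<Rightarrow> ennreal"
  assumes [measurable]: "G \<in> borel_measurable borel"
    and fin: "\<And>R. (\<integral>\<^sup>+ y\<in>{y. norm y \<le> R}. G y \<partial>lborel) < top"
  shows "AE x in lborel. loc_max G x < top"
proof -
  have "AE x in lborel. \<forall>n. hl_max (\<lambda>y. G y * indicator {y. norm y \<le> 3 * max (real n) 1} y) x < top"
    unfolding AE_all_countable by (intro allI AE_hl_max_finite fin) auto
  then show ?thesis
  proof eventually_elim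
    case (elim x)
    obtain n where n: "norm x \<le> real n" using real_arch_simple by blast
    have "loc_max G x \<le> hl_max (\<lambda>y. G y * indicator {y. norm y \<le> 3 * max (real n) 1} y) x"
      unfolding loc_max_def using n by (intro hl_max_mono mult_left_mono) (auto simp: indicator_def)
    then show ?case using elim[rule_format, of n] by (rule le_less_trans)
  qed
qed

text \<open>
  The weak type half of the interpolation. The part of \<open>F\<close> below \<open>l / (2 * b) * W\<close> has a maximal
  function of at most \<open>l / 2\<close> at points with \<open>loc_max W \<le> b\<close>, so exceeding \<open>l\<close> is due to the part
  of \<open>F\<close> above that height.
\<close>

lemma loc_max_weak_type_truncated:
  fixes F W :: "'a::euclidean_space \<Rightarrow> real"
  assumes [measurable]: "F \<in> borel_measurable borel" "W \<in> borel_measurable borel"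
    and nn: "\<And>y. 0 \<le> F y" "\<And>y. 0 \<le> W y" and b: "0 < b" and l: "0 < l"
  shows "ennreal l * emeasure lborel {x. loc_max (\<lambda>y. ennreal (W y)) x \<le> ennreal b
            \<and> ennreal l < loc_max (\<lambda>y. ennreal (F y)) x}
    \<le> 2 * 5 ^ DIM('a) * (\<integral>\<^sup>+ y. ennreal (F y) * indicator {y. l * W y < 2 * b * F y} y \<partial>lborel)"
proof -
  define F1 where "F1 y = ennreal (F y) * indicator {y. l * W y < 2 * b * F y} y" for y
  have [measurable]: "F1 \<in> borel_measurable borel" unfolding F1_def by measurable
  let ?S = "{x. loc_max (\<lambda>y. ennreal (W y)) x \<le> ennreal b \<and> ennreal l < loc_max (\<lambda>y. ennreal (F y)) x}"
  have "?S \<subseteq> {x. ennreal (l / 2) < hl_max F1 x}"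
  proof safe
    fix x assume x: "loc_max (\<lambda>y. ennreal (W y)) x \<le> ennreal b" "ennreal l < loc_max (\<lambda>y. ennreal (F y)) x"
    let ?c = "\<lambda>y. indicator {y. norm y \<le> 3 * max (norm x) 1} y :: ennreal"
    have "ennreal (F y) \<le> F1 y + ennreal (l / (2 * b)) * ennreal (W y)" for y
    proof (cases "l * W y < 2 * b * F y")
      case False
      then have "F y \<le> l / (2 * b) * W y" using b by (simp add: field_simps)
      then have "ennreal (F y) \<le> ennreal (l / (2 * b) * W y)" by (rule ennreal_leI)
      also have "\<dots> = ennreal (l / (2 * b)) * ennreal (W y)" using l b nn by (intro ennreal_mult) auto
      finally show ?thesis by (rule order_trans) (simp add: add_increasing)
    qed (simp add: F1_def)
    then have "ennreal (F y) * ?c y \<le> F1 y + ennreal (l / (2 * b)) * (ennreal (W y) * ?c y)" for y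
      by (auto simp: indicator_def)
    then have "loc_max (\<lambda>y. ennreal (F y)) x
        \<le> hl_max (\<lambda>y. F1 y + ennreal (l / (2 * b)) * (ennreal (W y) * ?c y)) x"
      unfolding loc_max_def by (intro hl_max_mono)
    also have "\<dots> \<le> hl_max F1 x + hl_max (\<lambda>y. ennreal (l / (2 * b)) * (ennreal (W y) * ?c y)) x"
      by (intro hl_max_add_le) auto
    also have "\<dots> \<le> hl_max F1 x + ennreal (l / (2 * b)) * loc_max (\<lambda>y. ennreal (W y)) x"
      unfolding loc_max_def by (intro add_left_mono hl_max_cmult_le) auto
    also have "\<dots> \<le> hl_max F1 x + ennreal (l / (2 * b)) * ennreal b"
      by (intro add_left_mono mult_left_mono x) auto
    also have "ennreal (l / (2 * b)) * ennreal b = ennreal (l / 2)"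
      using b l by (simp add: ennreal_mult[symmetric])
    finally have "ennreal l < hl_max F1 x + ennreal (l / 2)" using x(2) by (rule less_le_trans[rotated])
    then show "ennreal (l / 2) < hl_max F1 x"
    proof (rule contrapos_pp)
      assume "\<not> ennreal (l / 2) < hl_max F1 x"
      then have "hl_max F1 x + ennreal (l / 2) \<le> ennreal (l / 2) + ennreal (l / 2)"
        by (intro add_right_mono) simp
      also have "\<dots> = ennreal l" using l by (simp flip: ennreal_plus)
      finally show "\<not> ennreal l < hl_max F1 x + ennreal (l / 2)" by simp
    qed
  qed
  then have "ennreal (l / 2) * emeasure lborel ?S \<le> 5 ^ DIM('a) * (\<integral>\<^sup>+ y. F1 y \<partial>lborel)"
    using l by (intro hl_max_weak_type) auto
  then have "2 * (ennreal (l / 2) * emeasure lborel ?S) \<le> 2 * (5 ^ DIM('a) * (\<integral>\<^sup>+ y. F1 y \<partial>lborel))"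
    by (intro mult_left_mono) auto
  moreover have "ennreal l = 2 * ennreal (l / 2)"
    using l by (metis ennreal_mult' ennreal_numeral field_sum_of_halves mult_2 zero_le_numeral)
  ultimately show ?thesis
    by (simp only: F1_def mult.assoc)
qed


text \<open>
  Marcinkiewicz interpolation: integrate the truncated weak type inequality against
  \<open>p * l powr (p - 2)\<close> and exchange the integrals. For fixed \<open>y\<close> the levels that count are those with
  \<open>l < 2 * b * F y / W y\<close>, which yields \<open>F * (b * F / W) powr (p - 1)\<close>. The constant grows only
  like \<open>b powr (p - 1)\<close>.
\<close>

theorem loc_max_sublevel_bound:
  fixes F W :: "'a::euclidean_space \<Rightarrow> real"
  assumes [measurable]: "F \<in> borel_measurable borel" "W \<in> borel_measurable borel"
    and nn: "\<And>y. 0 \<le> F y" "\<And>y. 0 \<le> W y" and pos: "AE y in lborel. 0 < W y"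
    and b: "0 < b" and p: "1 < p"
  shows "(\<integral>\<^sup>+ x\<in>{x. loc_max (\<lambda>y. ennreal (W y)) x \<le> ennreal b}.
            ennpowr (loc_max (\<lambda>y. ennreal (F y)) x) p \<partial>lborel)
    \<le> ennreal (5 ^ DIM('a) * 2 powr p * p / (p - 1) * b powr (p - 1))
      * (\<integral>\<^sup>+ y. ennreal (F y powr p * W y powr (1 - p)) \<partial>lborel)"
proof -
  define T where "T = loc_max (\<lambda>y. ennreal (F y))"
  define E where "E = {x. loc_max (\<lambda>y. ennreal (W y)) x \<le> ennreal b}"
  have T[measurable]: "T \<in> borel_measurable borel" unfolding T_def by measurable
  have E[measurable]: "E \<in> sets borel" unfolding E_def by measurable
  let ?g = "\<lambda>l. ennreal (p * l powr (p - 1)) * indicator {0<..} l"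
  let ?A = "\<lambda>y. {l. l * W y < 2 * b * F y}"
  have "(\<integral>\<^sup>+ x\<in>E. ennpowr (T x) p \<partial>lborel)
      = (\<integral>\<^sup>+ x. \<integral>\<^sup>+ l. ?g l * indicator {z. z \<in> E \<and> ennreal l < T z} x \<partial>lborel \<partial>lborel)"
  proof (rule nn_integral_cong)
    fix x
    show "ennpowr (T x) p * indicator E x
      = (\<integral>\<^sup>+ l. ?g l * indicator {z. z \<in> E \<and> ennreal l < T z} x \<partial>lborel)"
      unfolding ennpowr_layer_cake[OF less_trans[OF zero_less_one p]]
      by (subst nn_integral_multc[symmetric]) (auto intro!: nn_integral_cong simp: indicator_def)
  qed
  also have "\<dots> = (\<integral>\<^sup>+ l. \<integral>\<^sup>+ x. ?g l * indicator {z. z \<in> E \<and> ennreal l < T z} x \<partial>lborel \<partial>lborel)"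
    by (rule lborel_pair.Fubini') (simp add: split_beta')
  also have "\<dots> = (\<integral>\<^sup>+ l. ?g l * emeasure lborel {z. z \<in> E \<and> ennreal l < T z} \<partial>lborel)"
    by (intro nn_integral_cong) (simp add: nn_integral_cmult)
  also have "\<dots> \<le> (\<integral>\<^sup>+ l. ennreal (p * l powr (p - 2)) * indicator {0<..} l *
      (2 * 5 ^ DIM('a) * (\<integral>\<^sup>+ y. ennreal (F y) * indicator (?A y) l \<partial>lborel)) \<partial>lborel)"
  proof (intro nn_integral_mono)
    fix l :: real
    show "?g l * emeasure lborel {z. z \<in> E \<and> ennreal l < T z} \<le>
       ennreal (p * l powr (p - 2)) * indicator {0<..} l *
      (2 * 5 ^ DIM('a) * (\<integral>\<^sup>+ y. ennreal (F y) * indicator (?A y) l \<partial>lborel))"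
    proof (cases "0 < l")
      case True
      have "l powr (p - 1) = l powr (p - 2) * l"
        using True powr_add[of l "p - 2" 1] by (simp add: algebra_simps)
      then have "p * l powr (p - 1) = (p * l powr (p - 2)) * l" by simp
      then have "ennreal (p * l powr (p - 1)) = ennreal (p * l powr (p - 2)) * ennreal l"
        using True p by (simp only: ennreal_mult'')
      moreover have "ennreal l * emeasure lborel {z. z \<in> E \<and> ennreal l < T z}
        \<le> 2 * 5 ^ DIM('a) * (\<integral>\<^sup>+ y. ennreal (F y) * indicator (?A y) l \<partial>lborel)"
        using loc_max_weak_type_truncated[OF assms(1,2) nn b True]
        unfolding E_def T_def by (simp add: indicator_def)
      ultimately show ?thesis using True
        by (simp add: mult.assoc mult_left_mono)
    qed simp
  qed
  also have "\<dots> = (\<integral>\<^sup>+ l. \<integral>\<^sup>+ y. 2 * 5 ^ DIM('a) * (ennreal (F y) *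
      (ennreal (p * l powr (p - 2)) * (indicator {0<..} l * indicator (?A y) l))) \<partial>lborel \<partial>lborel)"
    by (intro nn_integral_cong, subst nn_integral_cmult[symmetric], simp,
        subst nn_integral_cmult[symmetric], simp) (simp add: mult_ac)
  also have "\<dots> = (\<integral>\<^sup>+ y. \<integral>\<^sup>+ l. 2 * 5 ^ DIM('a) * (ennreal (F y) *
      (ennreal (p * l powr (p - 2)) * (indicator {0<..} l * indicator (?A y) l))) \<partial>lborel \<partial>lborel)"
    by (rule lborel_pair.Fubini') (simp add: split_beta')
  also have "\<dots> = (\<integral>\<^sup>+ y. 2 * 5 ^ DIM('a) * (ennreal (F y) * (\<integral>\<^sup>+ l. ennreal (p * l powr (p - 2))
        * (indicator {0<..} l * indicator (?A y) l) \<partial>lborel)) \<partial>lborel)"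
    by (intro nn_integral_cong) (simp add: nn_integral_cmult)
  also have "\<dots> = (\<integral>\<^sup>+ y. ennreal (5 ^ DIM('a) * 2 powr p * p / (p - 1) * b powr (p - 1))
      * ennreal (F y powr p * W y powr (1 - p)) \<partial>lborel)"
  proof (rule nn_integral_cong_AE, use pos in eventually_elim)
    fix y assume W: "0 < W y"
    have "(\<integral>\<^sup>+ l. ennreal (p * l powr (p - 2)) * (indicator {0<..} l * indicator (?A y) l) \<partial>lborel)
       = (\<integral>\<^sup>+ l. ennreal (p / (p - 1)) * (ennreal ((p - 1) * l powr ((p - 1) - 1)) *
            indicator {0<..<2 * b * F y / W y} l) \<partial>lborel)"
      using W p by (intro nn_integral_cong) (auto simp: indicator_def field_simps ennreal_mult'[symmetric])
    also have "\<dots> = ennreal (p / (p - 1)) * ennreal ((2 * b * F y / W y) powr (p - 1))"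
      using p W b nn by (subst nn_integral_cmult, simp, subst layer_cake_real) auto
    also have "(2 * b * F y / W y) powr (p - 1) = 2 powr (p - 1) * b powr (p - 1) * F y powr (p - 1) * W y powr (1 - p)"
      using W b nn powr_minus[of "W y" "p - 1"] by (simp add: powr_divide powr_mult field_simps)
    also have "ennreal (p / (p - 1)) * ennreal (2 powr (p - 1) * b powr (p - 1) * F y powr (p - 1) * W y powr (1 - p))
        = ennreal (p / (p - 1) * (2 powr (p - 1) * b powr (p - 1) * F y powr (p - 1) * W y powr (1 - p)))"
      using p by (intro ennreal_mult[symmetric]) auto
    finally have 1: "(\<integral>\<^sup>+ l. ennreal (p * l powr (p - 2)) * (indicator {0<..} l * indicator (?A y) l) \<partial>lborel)
      = ennreal (p / (p - 1) * (2 powr (p - 1) * b powr (p - 1) * F y powr (p - 1) * W y powr (1 - p)))" .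
    have 2: "(2 * 5 ^ DIM('a) :: ennreal) = ennreal (2 * 5 ^ DIM('a))"
      by (simp add: ennreal_mult ennreal_power[symmetric])
    have 3: "F y * F y powr (p - 1) = F y powr p"
      using nn(1)[of y] p powr_mult_base[of "F y" "p - 1"] by simp
    have "2 * 5 ^ DIM('a) * (F y * (p / (p - 1) * (2 powr (p - 1) * b powr (p - 1) * F y powr (p - 1) * W y powr (1 - p))))
       = 5 ^ DIM('a) * (2 * 2 powr (p - 1)) * p / (p - 1) * b powr (p - 1) * ((F y * F y powr (p - 1)) * W y powr (1 - p))"
      by simp
    also have "2 * 2 powr (p - 1) = 2 powr p"
      using powr_mult_base[of 2 "p - 1"] by simp
    finally show "2 * 5 ^ DIM('a) * (ennreal (F y) * (\<integral>\<^sup>+ l. ennreal (p * l powr (p - 2))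
        * (indicator {0<..} l * indicator (?A y) l) \<partial>lborel))
      = ennreal (5 ^ DIM('a) * 2 powr p * p / (p - 1) * b powr (p - 1)) * ennreal (F y powr p * W y powr (1 - p))"
      unfolding 1 2 3 using nn p
      by (simp add: ennreal_mult[symmetric] del: ennreal_power)
  qed
  also have "\<dots> = ennreal (5 ^ DIM('a) * 2 powr p * p / (p - 1) * b powr (p - 1))
      * (\<integral>\<^sup>+ y. ennreal (F y powr p * W y powr (1 - p)) \<partial>lborel)"
    by (rule nn_integral_cmult) simp
  finally show ?thesis by (simp add: T_def E_def)
qed

text \<open>
  The term with \<open>2 ^ k \<le> t < 2 ^ (k + 1)\<close> alone dominates.
\<close>

lemma negative_powr_le_dyadic_sum:
  fixes t \<gamma> :: real
  assumes t: "1 \<le> t" and \<gamma>: "0 \<le> \<gamma>"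
  shows "ennreal (t powr (- \<gamma>)) \<le> (\<Sum>k. ennreal ((2 powr (- \<gamma>)) ^ k) * indicator {..2 ^ Suc k} t)"
proof -
  obtain n0 where "t < 2 ^ n0" using real_arch_pow[of 2 t] by auto
  then have ex: "\<exists>n. t < 2 ^ Suc n" using t by (intro exI[of _ n0]) simp
  define n where "n = (LEAST n. t < 2 ^ Suc n)"
  have n: "t < 2 ^ Suc n" unfolding n_def using ex by (rule LeastI_ex)
  have "2 ^ n \<le> t"
  proof (cases n)
    case (Suc m)
    then have "\<not> t < 2 ^ Suc m" unfolding n_def by (metis lessI not_less_Least)
    then show ?thesis using Suc by simp
  qed (use t in simp)
  then have "t powr (- \<gamma>) \<le> (2 ^ n) powr (- \<gamma>)"
    using \<gamma> by (intro powr_mono2') auto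
  also have "\<dots> = (2 powr (- \<gamma>)) ^ n"
    by (simp add: powr_realpow[symmetric] powr_powr mult.commute)
  finally have "ennreal (t powr (- \<gamma>)) \<le> ennreal ((2 powr (- \<gamma>)) ^ n) * indicator {..2 ^ Suc n} t"
    using n by (simp add: ennreal_leI)
  also have "\<dots> = (\<Sum>k\<in>{n}. ennreal ((2 powr (- \<gamma>)) ^ k) * indicator {..2 ^ Suc k} t)"
    by (simp del: sum_mult_indicator sum_ennreal)
  also have "\<dots> \<le> (\<Sum>k. ennreal ((2 powr (- \<gamma>)) ^ k) * indicator {..2 ^ Suc k} t)"
    by (intro sum_le_suminf) auto
  finally show ?thesis .
qed

text \<open>
  The weight is a superposition of indicators of the sets \<open>loc_max W \<le> b\<close> with dyadic \<open>b\<close>, on each of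
  which the previous theorem applies. Since \<open>\<gamma> > p - 1\<close>, the coefficients \<open>b powr (- \<gamma>)\<close> beat the
  constants \<open>b powr (p - 1)\<close>.
\<close>

theorem loc_max_two_weight:
  fixes W :: "'a::euclidean_space \<Rightarrow> real"
  assumes W[measurable]: "W \<in> borel_measurable borel" and nnW: "\<And>y. 0 \<le> W y"
    and pos: "AE y in lborel. 0 < W y"
    and p: "1 < p" and \<gamma>: "p - 1 < \<gamma>" and s: "real DIM('a) * \<gamma> \<le> s"
  shows "\<exists>K\<ge>0. \<forall>F. F \<in> borel_measurable borel \<longrightarrow> (\<forall>y. 0 \<le> F y) \<longrightarrow>
    (\<integral>\<^sup>+ x. ennpowr (loc_max (\<lambda>y. ennreal (F y)) x) p *
       ennreal (enn2real (loc_max (\<lambda>y. ennreal (W y)) x) powr (- \<gamma>) * (1 + norm x) powr (- s)) \<partial>lborel)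
    \<le> ennreal K * (\<integral>\<^sup>+ y. ennreal (F y powr p * W y powr (1 - p)) \<partial>lborel)"
proof -
  let ?d = "DIM('a)"
  define M where "M = loc_max (\<lambda>y. ennreal (W y))"
  have M[measurable]: "M \<in> borel_measurable borel" unfolding M_def by measurable
  have "AE y in lborel. 0 < ennreal (W y)" using pos by simp
  then obtain c where c: "0 < c" "\<And>x. ennreal (c / (1 + norm x) ^ ?d) \<le> M x"
    using loc_max_lower_bound[of "\<lambda>y. ennreal (W y)"] unfolding M_def by auto
  define b where "b k = c * 2 ^ Suc k" for k :: nat
  define a where "a k = (2 powr (- \<gamma>)) ^ k" for k :: nat
  have b0: "0 < b k" for k using c by (simp add: b_def)
  have a0: "0 \<le> a k" for k by (simp add: a_def)
  have pw: "ennreal (enn2real (M x) powr (- \<gamma>) * (1 + norm x) powr (- s))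
    \<le> (\<Sum>k. ennreal (c powr (- \<gamma>) * a k) * indicator {x. M x \<le> ennreal (b k)} x)" for x
  proof (cases "M x")
    case (real m)
    define R where "R = 1 + norm x"
    have R: "1 \<le> R" by (simp add: R_def)
    have cm: "c / R ^ ?d \<le> m" using c(2)[of x] real by (simp add: R_def)
    then have m: "0 < m" using c(1) R by (meson divide_pos_pos less_le_trans zero_less_one zero_less_power)
    define t where "t = m * R ^ ?d / c"
    \<comment> \<open>The lower bound of the maximal function normalises it to values \<open>t \<ge> 1\<close>, so that no
      dyadic level below \<open>1\<close> occurs; \<open>s \<ge> d * \<gamma>\<close> absorbs the power of \<open>R\<close> lost in this step.\<close>
    have t1: "1 \<le> t" using cm c(1) R by (simp add: t_def field_simps)
    have mt: "m \<le> c * t" using c R m by (simp add: t_def)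
    have "m = c * t * R powr (- real ?d)"
      using R c by (simp add: t_def powr_minus powr_realpow field_simps)
    then have "m powr (- \<gamma>) = c powr (- \<gamma>) * t powr (- \<gamma>) * R powr (real ?d * \<gamma>)"
      using c t1 R by (simp add: powr_mult powr_powr)
    then have "m powr (- \<gamma>) * R powr (- s) = c powr (- \<gamma>) * t powr (- \<gamma>) * R powr (real ?d * \<gamma> - s)"
      using R by (simp add: powr_add[symmetric] mult.assoc)
    also have "\<dots> \<le> c powr (- \<gamma>) * t powr (- \<gamma>) * R powr 0"
      using R s by (intro mult_left_mono powr_mono) auto
    finally have "m powr (- \<gamma>) * R powr (- s) \<le> c powr (- \<gamma>) * t powr (- \<gamma>)" using R by simp
    then have "ennreal (m powr (- \<gamma>) * R powr (- s)) \<le> ennreal (c powr (- \<gamma>)) * ennreal (t powr (- \<gamma>))"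
      by (simp add: ennreal_mult[symmetric] ennreal_leI)
    also have "\<dots> \<le> ennreal (c powr (- \<gamma>)) * (\<Sum>k. ennreal (a k) * indicator {..2 ^ Suc k} t)"
      unfolding a_def using t1 \<gamma> p by (intro mult_left_mono negative_powr_le_dyadic_sum) auto
    also have "\<dots> = (\<Sum>k. ennreal (c powr (- \<gamma>)) * (ennreal (a k) * indicator {..2 ^ Suc k} t))"
      by simp
    also have "\<dots> \<le> (\<Sum>k. ennreal (c powr (- \<gamma>) * a k) * indicator {x. M x \<le> ennreal (b k)} x)"
    proof (intro suminf_le summableI)
      fix k
      have "M x \<le> ennreal (b k)" if "t \<le> 2 ^ Suc k"
      proof -
        have "m \<le> b k" unfolding b_def using mt that c(1) by (meson mult_left_mono order_trans less_imp_le)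
        then show ?thesis using real by (simp add: ennreal_leI)
      qed
      then show "ennreal (c powr (- \<gamma>)) * (ennreal (a k) * indicator {..2 ^ Suc k} t)
        \<le> ennreal (c powr (- \<gamma>) * a k) * indicator {x. M x \<le> ennreal (b k)} x"
        using a0[of k] by (auto simp: indicator_def ennreal_mult)
    qed
    finally show ?thesis using real by (simp add: R_def)
  qed simp
  define C where "C = 5 ^ ?d * 2 powr p * p / (p - 1)"
  have C0: "0 \<le> C" using p by (simp add: C_def)
  define q where "q = 2 powr (p - 1 - \<gamma>)"
  have q: "0 < q" "q < 1" using \<gamma> by (auto simp: q_def powr_less_one)
  define K where "K = c powr (- \<gamma>) * C * (2 * c) powr (p - 1) / (1 - q)"
  have "(\<integral>\<^sup>+ x. ennpowr (loc_max (\<lambda>y. ennreal (F y)) x) p *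
       ennreal (enn2real (M x) powr (- \<gamma>) * (1 + norm x) powr (- s)) \<partial>lborel)
    \<le> ennreal K * (\<integral>\<^sup>+ y. ennreal (F y powr p * W y powr (1 - p)) \<partial>lborel)"
    if F[measurable]: "F \<in> borel_measurable borel" and nnF: "\<And>y. 0 \<le> F y" for F :: "'a \<Rightarrow> real"
  proof -
    define T where "T x = ennpowr (loc_max (\<lambda>y. ennreal (F y)) x) p" for x
    have T[measurable]: "T \<in> borel_measurable borel" unfolding T_def by measurable
    let ?J = "\<integral>\<^sup>+ y. ennreal (F y powr p * W y powr (1 - p)) \<partial>lborel"
    have "(\<integral>\<^sup>+ x. T x * ennreal (enn2real (M x) powr (- \<gamma>) * (1 + norm x) powr (- s)) \<partial>lborel)
      \<le> (\<integral>\<^sup>+ x. T x * (\<Sum>k. ennreal (c powr (- \<gamma>) * a k) * indicator {x. M x \<le> ennreal (b k)} x) \<partial>lborel)"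
      by (intro nn_integral_mono mult_left_mono pw) auto
    also have "\<dots> = (\<integral>\<^sup>+ x. (\<Sum>k. ennreal (c powr (- \<gamma>) * a k) * (T x * indicator {x. M x \<le> ennreal (b k)} x)) \<partial>lborel)"
      by (subst ennreal_suminf_cmult[symmetric]) (simp add: mult_ac)
    also have "\<dots> = (\<Sum>k. \<integral>\<^sup>+ x. ennreal (c powr (- \<gamma>) * a k) * (T x * indicator {x. M x \<le> ennreal (b k)} x) \<partial>lborel)"
      by (rule nn_integral_suminf) simp
    also have "\<dots> = (\<Sum>k. ennreal (c powr (- \<gamma>) * a k) * (\<integral>\<^sup>+ x\<in>{x. M x \<le> ennreal (b k)}. T x \<partial>lborel))"
      by (rule suminf_cong, rule nn_integral_cmult) simp
    also have "\<dots> \<le> (\<Sum>k. ennreal (c powr (- \<gamma>) * a k) * (ennreal (C * b k powr (p - 1)) * ?J))"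
      unfolding T_def M_def C_def
      by (intro suminf_le summableI mult_left_mono loc_max_sublevel_bound that W nnW pos b0 p) auto
    also have "\<dots> = (\<Sum>k. ennreal (c powr (- \<gamma>) * C * (2 * c) powr (p - 1) * q ^ k) * ?J)"
    proof (rule suminf_cong)
      fix k
      have "b k = (2 * c) * 2 powr real k" by (simp add: b_def powr_realpow)
      then have "b k powr (p - 1) = (2 * c) powr (p - 1) * 2 powr (real k * (p - 1))"
        using c(1) by (simp add: powr_mult powr_powr)
      moreover have "a k * 2 powr (real k * (p - 1)) = q ^ k"
        unfolding a_def q_def
        by (simp add: powr_realpow[symmetric] powr_powr powr_add[symmetric] algebra_simps)
      ultimately have e: "(c powr (- \<gamma>) * a k) * (C * b k powr (p - 1)) = c powr (- \<gamma>) * C * (2 * c) powr (p - 1) * q ^ k"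
        by (metis (no_types, opaque_lifting) mult.assoc mult.left_commute)
      then show "ennreal (c powr (- \<gamma>) * a k) * (ennreal (C * b k powr (p - 1)) * ?J)
        = ennreal (c powr (- \<gamma>) * C * (2 * c) powr (p - 1) * q ^ k) * ?J"
        using a0[of k] C0
        by (subst mult.assoc[symmetric], subst ennreal_mult[symmetric], simp, simp) (simp only: e)
    qed
    also have "\<dots> = (\<Sum>k. ennreal (c powr (- \<gamma>) * C * (2 * c) powr (p - 1) * q ^ k)) * ?J"
      by simp
    also have "(\<Sum>k. ennreal (c powr (- \<gamma>) * C * (2 * c) powr (p - 1) * q ^ k)) = ennreal K"
      unfolding K_def using q C0
      by (subst suminf_ennreal2)
         (auto simp: suminf_mult suminf_geometric intro!: summable_mult)
    finally show ?thesis by (simp add: T_def)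
  qed
  moreover have "0 \<le> K" using q C0 by (simp add: K_def)
  ultimately show ?thesis unfolding M_def by blast
qed

section \<open>Mehler's formula and the kernel near the diagonal\<close>

text \<open>
  The Mehler kernel in the variable \<open>exp (- 2 * u)\<close>, stripped of the two Gaussian factors that
  the weights absorb.
\<close>

definition reduced_kernel :: "real \<Rightarrow> real \<Rightarrow> real ^ 'n \<Rightarrow> real ^ 'n \<Rightarrow> real" where
  "reduced_kernel m u x y =
     exp (- 2 * u) powr ((m + real CARD('n)) / 2) * (pi * (1 - exp (- 4 * u))) powr (- real CARD('n) / 2) *
     exp (- (norm (x - exp (- 2 * u) *\<^sub>R y))\<^sup>2 / (1 - exp (- 4 * u)))"

lemma reduced_kernel_nonneg: "0 \<le> reduced_kernel m u x y"
  by (simp add: reduced_kernel_def)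

text \<open>
  With \<open>r = exp (- 2 * u)\<close>, \<open>tanh (2 * u) = (1 - r\<^sup>2) / (1 + r\<^sup>2)\<close> and \<open>tanh u = (1 - r) / (1 + r)\<close> this
  completes the square in the exponent of the heat kernel.
\<close>

lemma mehler_exponent:
  fixes x y :: "'a::real_inner"
  assumes r: "0 < r" "r < 1"
  shows "- (norm (x - y))\<^sup>2 / (2 * ((1 - r\<^sup>2) / (1 + r\<^sup>2))) - (1 - r) / (1 + r) * (x \<bullet> y)
    = (norm x)\<^sup>2 / 2 - (norm (x - r *\<^sub>R y))\<^sup>2 / (1 - r\<^sup>2) - (norm y)\<^sup>2 / 2"
proof -
  define X Y Z where "X = x \<bullet> x" and "Y = y \<bullet> y" and "Z = x \<bullet> y"
  have "r\<^sup>2 < 1" using r by (simp add: power_less_one_iff)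
  then have nz: "1 - r\<^sup>2 \<noteq> 0" "1 + r \<noteq> 0" "1 + r\<^sup>2 \<noteq> 0" "1 - r \<noteq> 0"
    using r by (auto simp: add_nonneg_eq_0_iff)
  have f: "1 - r\<^sup>2 = (1 - r) * (1 + r)" by (simp add: power2_eq_square algebra_simps)
  have "(norm (x - y))\<^sup>2 = X - 2 * Z + Y" "(norm (x - r *\<^sub>R y))\<^sup>2 = X - 2 * r * Z + r\<^sup>2 * Y"
    "(norm x)\<^sup>2 = X" "(norm y)\<^sup>2 = Y"
    unfolding X_def Y_def Z_def power2_norm_eq_inner
    by (auto simp: inner_diff inner_commute power2_eq_square algebra_simps)
  then show ?thesis
    using nz unfolding f Z_def[symmetric]
    by (simp add: divide_simps) (simp add: power2_eq_square algebra_simps)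
qed

lemma heat_kernel_eq:
  fixes x y :: "real ^ 'n"
  assumes u: "0 < u"
  shows "heat_kernel m u x y =
    exp ((norm x)\<^sup>2 / 2) * reduced_kernel m u x y * exp (- (norm y)\<^sup>2 / 2)"
proof -
  define r where "r = exp (- 2 * u)"
  let ?d = "real CARD('n)"
  have r: "0 < r" "r < 1" using u by (auto simp: r_def)
  have r2: "exp (- 4 * u) = r\<^sup>2" unfolding r_def by (simp add: exp_double[symmetric])
  then have t2: "tanh (2 * u) = (1 - r\<^sup>2) / (1 + r\<^sup>2)" by (simp add: tanh_real_altdef)
  have t1: "tanh u = (1 - r) / (1 + r)" by (simp add: tanh_real_altdef r_def)
  have r2l: "r\<^sup>2 < 1" using r by (simp add: power_less_one_iff)
  have s: "2 * pi * sinh (2 * u) = pi * (1 - r\<^sup>2) / r"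
  proof -
    have "sinh (2 * u) = (1 / r - r) / 2"
      unfolding sinh_field_def r_def by (simp add: exp_minus field_simps)
    then have "2 * pi * sinh (2 * u) = 2 * pi * ((1 / r - r) / 2)" by (simp only:)
    also have "\<dots> = pi * (1 - r\<^sup>2) / r" using r by (simp add: field_simps power2_eq_square)
    finally show ?thesis .
  qed
  have "(2 * pi * sinh (2 * u)) powr (- ?d / 2) = (pi * (1 - r\<^sup>2)) powr (- ?d / 2) * r powr (?d / 2)"
    unfolding s using r r2l by (simp add: powr_divide powr_minus field_simps)
  moreover have "exp (- u * m) = r powr (m / 2)"
    by (simp add: r_def powr_def)
  moreover have "r powr (m / 2) * r powr (?d / 2) = r powr ((m + ?d) / 2)"
    by (simp add: powr_add[symmetric] add_divide_distrib)
  ultimately have A: "exp (- u * m) * (2 * pi * sinh (2 * u)) powr (- ?d / 2)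
      = r powr ((m + ?d) / 2) * (pi * (1 - r\<^sup>2)) powr (- ?d / 2)"
    by simp
  let ?q = "(norm (x - r *\<^sub>R y))\<^sup>2 / (1 - r\<^sup>2)"
  have E: "exp ((norm x)\<^sup>2 / 2 - ?q - (norm y)\<^sup>2 / 2) = exp ((norm x)\<^sup>2 / 2) * exp (- ?q) * exp (- (norm y)\<^sup>2 / 2)"
    by (simp add: exp_add[symmetric])
  show ?thesis
    unfolding heat_kernel_def reduced_kernel_def t1 t2 mehler_exponent[OF r] r2 r_def[symmetric] A E
    by (simp only: minus_divide_left mult_ac)
qed

text \<open>
  For an integer exponent \<open>k\<close> one term of the exponential series gives \<open>(1 + z) ^ k \<le> fact k * exp (1 + z)\<close>.
\<close>

lemma exp_minus_le_polynomial_decay: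
  fixes s :: real
  assumes "0 \<le> s"
  obtains C where "0 < C" "\<And>z. 0 \<le> z \<Longrightarrow> exp (- z) \<le> C * (1 + z) powr (- s)"
proof -
  define k where "k = nat \<lceil>s\<rceil>"
  have k: "s \<le> real k" by (simp add: k_def of_nat_ceiling)
  have "exp (- z) \<le> (fact k * exp 1) * (1 + z) powr (- s)" if z: "0 \<le> z" for z :: real
  proof -
    have "(1 + z) powr s \<le> (1 + z) powr (real k)" using k z by (intro powr_mono) auto
    also have "\<dots> = (1 + z) ^ k" using z by (simp add: powr_realpow)
    also have "\<dots> \<le> fact k * exp (1 + z)"
    proof -
      have "(1 + z) ^ k /\<^sub>R fact k \<le> (\<Sum>n. (1 + z) ^ n /\<^sub>R fact n)"
        using z by (intro sum_le_suminf[of _ "{k}", simplified] summable_exp_generic) auto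
      then show ?thesis by (simp add: exp_def field_simps)
    qed
    finally have "(1 + z) powr s * exp (- z) \<le> fact k * exp (1 + z) * exp (- z)"
      by (intro mult_right_mono) auto
    also have "\<dots> = fact k * exp 1" by (simp add: exp_add exp_minus)
    finally show ?thesis using z by (simp add: powr_minus field_simps)
  qed
  then show ?thesis by (intro that[of "fact k * exp 1"]) auto
qed

text \<open>
  Completing the square, \<open>- z\<^sup>2 / 2 \<le> 1 - z\<close>, reduces this to the exponential.
\<close>

lemma gaussian_le_polynomial_decay:
  fixes s :: real
  assumes "0 \<le> s"
  obtains C where "0 < C" "\<And>z. 0 \<le> z \<Longrightarrow> exp (- z\<^sup>2 / 2) \<le> C * (1 + z) powr (- s)"
proof -
  obtain C where C: "0 < C" "\<And>z. 0 \<le> z \<Longrightarrow> exp (- z) \<le> C * (1 + z) powr (- s)"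
    using exp_minus_le_polynomial_decay[OF assms] by blast
  have "exp (- z\<^sup>2 / 2) \<le> (exp 1 * C) * (1 + z) powr (- s)" if z: "0 \<le> z" for z
  proof -
    have "- z\<^sup>2 / 2 \<le> 1 + - z"
      using zero_le_power2[of "z - 1"] by (simp add: power2_eq_square algebra_simps)
    then have "exp (- z\<^sup>2 / 2) \<le> exp (1 + - z)" by simp
    also have "\<dots> = exp 1 * exp (- z)" by (rule exp_add)
    also have "\<dots> \<le> exp 1 * (C * (1 + z) powr (- s))" using C(2)[OF z] by (intro mult_left_mono) auto
    finally show ?thesis by simp
  qed
  then show ?thesis using C(1) by (intro that[of "exp 1 * C"]) auto
qed

text \<open>
  This is where \<open>m \<ge> - d\<close> is needed: the factor \<open>r powr \<kappa>\<close> is at most \<open>1\<close>.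
\<close>

lemma reduced_kernel_le_gaussian:
  fixes x y :: "real ^ 'n"
  assumes u: "0 < u" and m: "- real CARD('n) \<le> m"
  shows "reduced_kernel m u x y \<le> (pi * (1 - exp (- 4 * u))) powr (- real CARD('n) / 2) *
     exp (- (norm (x - exp (- 2 * u) *\<^sub>R y))\<^sup>2 / (1 - exp (- 4 * u)))"
proof -
  have "exp (- 2 * u) powr ((m + real CARD('n)) / 2) \<le> 1"
    using u m by (simp add: powr_def mult_nonneg_nonneg)
  then show ?thesis unfolding reduced_kernel_def mult.assoc
    by (intro mult_left_le_one_le) auto
qed

text \<open>
  The Gaussian factor is centred at the point where \<open>r y = x\<close>. For \<open>\<bar>y\<bar> \<le> 3 R\<close> with \<open>R = max \<bar>x\<bar> 1\<close>, and
  for \<open>1 - r \<le> 1 / R\<^sup>2\<close>, moving the centre to \<open>x\<close> costs a bounded factor, and a Gaussian of width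
  \<open>sqrt (1 - r\<^sup>2)\<close> around \<open>x\<close> is dominated by the maximal function. For smaller \<open>r\<close> the kernel is at
  most \<open>R ^ d\<close> and the whole region lies in the ball of radius \<open>5 R\<close> around \<open>x\<close>.
\<close>

lemma reduced_kernel_local_bound:
  fixes F :: "real ^ 'n \<Rightarrow> real"
  assumes m: "- real CARD('n) \<le> m"
  shows "\<exists>C\<ge>0. \<forall>F u x. F \<in> borel_measurable borel \<longrightarrow> (\<forall>y. 0 \<le> F y) \<longrightarrow> 0 < u \<longrightarrow>
    (\<integral>\<^sup>+ y\<in>{y::real ^ 'n. norm y \<le> 3 * max (norm x) 1}. ennreal (reduced_kernel m u x y) * ennreal (F y) \<partial>lborel)
    \<le> ennreal (C * (1 + norm x) ^ (2 * CARD('n))) * loc_max (\<lambda>y. ennreal (F y)) x"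
proof -
  let ?d = "CARD('n)" let ?w = "unit_ball_vol (real ?d)"
  obtain C0 where C0: "0 < C0"
    "\<And>z. 0 \<le> z \<Longrightarrow> exp (- z\<^sup>2 / 2) \<le> C0 * (1 + z) powr (- real (?d + 1))"
    using gaussian_le_polynomial_decay[of "real (?d + 1)"] by auto
  define C1 where "C1 = exp 9 * C0 * (2 ^ (?d + 2) * ?w)"
  define C2 where "C2 = ?w * 5 ^ ?d"
  have C12: "0 \<le> C1" "0 \<le> C2" using C0 by (auto simp: C1_def C2_def)
  have main: "(\<integral>\<^sup>+ y\<in>{y. norm y \<le> 3 * max (norm x) 1}. ennreal (reduced_kernel m u x y) * ennreal (F y) \<partial>lborel)
    \<le> ennreal ((C1 + C2) * (1 + norm x) ^ (2 * CARD('n))) * loc_max (\<lambda>y. ennreal (F y)) x"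
    if [measurable]: "F \<in> borel_measurable borel" and nn: "\<And>y. 0 \<le> F y" and u: "0 < u"
    for F :: "real ^ 'n \<Rightarrow> real" and u x
  proof -
    define R where "R = max (norm x) 1"
    have R: "1 \<le> R" "norm x \<le> R" "R \<le> 1 + norm x" by (auto simp: R_def)
    define G where "G y = ennreal (F y) * indicator {y. norm y \<le> 3 * R} y" for y
    have [measurable]: "G \<in> borel_measurable borel" unfolding G_def by measurable
    have GM: "hl_max G x = loc_max (\<lambda>y. ennreal (F y)) x" unfolding loc_max_def G_def R_def ..
    define r where "r = exp (- 2 * u)"
    have r: "0 < r" "r < 1" using u by (auto simp: r_def)
    have r2: "exp (- 4 * u) = r\<^sup>2" unfolding r_def by (simp add: exp_double[symmetric])
    have r2l: "r\<^sup>2 < 1" using r by (simp add: power_less_one_iff)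
    have RR: "1 \<le> (1 + norm x) ^ (2 * ?d)" by (intro one_le_power) simp
    have k: "reduced_kernel m u x y \<le> (pi * (1 - r\<^sup>2)) powr (- real ?d / 2) *
        exp (- (norm (x - r *\<^sub>R y))\<^sup>2 / (1 - r\<^sup>2))" for y
      using reduced_kernel_le_gaussian[OF u m, of x y] unfolding r2 r_def .
    have lhs: "(\<integral>\<^sup>+ y\<in>{y. norm y \<le> 3 * max (norm x) 1}. ennreal (reduced_kernel m u x y) * ennreal (F y) \<partial>lborel)
      = (\<integral>\<^sup>+ y. ennreal (reduced_kernel m u x y) * G y \<partial>lborel)"
      by (simp add: G_def R_def mult.assoc)
    show ?thesis
    proof (cases "1 - r \<le> 1 / R\<^sup>2")
      case True
      define \<rho> where "\<rho> = sqrt (1 - r\<^sup>2)"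
      have \<rho>: "0 < \<rho>" "\<rho>\<^sup>2 = 1 - r\<^sup>2" using r2l by (auto simp: \<rho>_def)
      have le: "reduced_kernel m u x y
          \<le> exp 9 * C0 * (1 / \<rho> ^ ?d) * (1 / (1 + dist x y / \<rho>) ^ (?d + 1))"
        if y: "norm y \<le> 3 * R" for y
      proof -
        have "dist x y \<le> norm (x - r *\<^sub>R y) + (1 - r) * norm y"
        proof -
          have "x - y = (x - r *\<^sub>R y) + (- (1 - r)) *\<^sub>R y" by (simp add: algebra_simps)
          then show ?thesis unfolding dist_norm using r
            by (metis abs_minus_cancel abs_of_nonneg diff_ge_0_iff_ge less_imp_le norm_scaleR norm_triangle_ineq)
        qed
        then have "(dist x y)\<^sup>2 \<le> (norm (x - r *\<^sub>R y) + (1 - r) * norm y)\<^sup>2"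
          by (intro power_mono) auto
        also have "\<dots> \<le> 2 * (norm (x - r *\<^sub>R y))\<^sup>2 + 2 * ((1 - r) * norm y)\<^sup>2"
          using zero_le_power2[of "norm (x - r *\<^sub>R y) - (1 - r) * norm y"]
          by (simp add: power2_eq_square algebra_simps)
        finally have 1: "(dist x y)\<^sup>2 / 2 \<le> (norm (x - r *\<^sub>R y))\<^sup>2 + ((1 - r) * norm y)\<^sup>2" by simp
        have "((1 - r) * norm y)\<^sup>2 \<le> ((1 - r) * (3 * R))\<^sup>2"
          using y r by (intro power_mono mult_left_mono) auto
        also have "\<dots> = 9 * ((1 - r) * ((1 - r) * R\<^sup>2))" by (simp add: power2_eq_square)
        \<comment> \<open>The shift of the centre is harmless because \<open>(1 - r) * R\<^sup>2 \<le> 1\<close>.\<close>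
        also have "\<dots> \<le> 9 * ((1 - r) * 1)"
          using True r R by (intro mult_left_mono) (auto simp: field_simps)
        also have "\<dots> \<le> 9 * (1 - r\<^sup>2)" using r by (simp add: power2_eq_square)
        finally have "(dist x y)\<^sup>2 / 2 - 9 * (1 - r\<^sup>2) \<le> (norm (x - r *\<^sub>R y))\<^sup>2" using 1 by simp
        then have "((dist x y)\<^sup>2 / 2 - 9 * (1 - r\<^sup>2)) / (1 - r\<^sup>2) \<le> (norm (x - r *\<^sub>R y))\<^sup>2 / (1 - r\<^sup>2)"
          using r2l by (intro divide_right_mono) auto
        moreover have "(D\<^sup>2 / 2 - 9 * \<rho>\<^sup>2) / \<rho>\<^sup>2 = (D / \<rho>)\<^sup>2 / 2 - 9" for D
          using \<rho>(1) by (simp add: field_simps)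
        note this[of "dist x y", unfolded \<rho>(2)]
        ultimately have "- (norm (x - r *\<^sub>R y))\<^sup>2 / (1 - r\<^sup>2) \<le> 9 + - (dist x y / \<rho>)\<^sup>2 / 2" by simp
        then have "exp (- (norm (x - r *\<^sub>R y))\<^sup>2 / (1 - r\<^sup>2)) \<le> exp 9 * exp (- (dist x y / \<rho>)\<^sup>2 / 2)"
          unfolding exp_add[symmetric] by (subst exp_le_cancel_iff)
        also have "\<dots> \<le> exp 9 * (C0 * (1 + dist x y / \<rho>) powr (- real (?d + 1)))"
          using \<rho> by (intro mult_left_mono C0) auto
        also have "(1 + dist x y / \<rho>) powr (- real (?d + 1)) = 1 / (1 + dist x y / \<rho>) ^ (?d + 1)"
          using \<rho> by (subst powr_minus_divide, subst powr_realpow) (auto intro: add_pos_nonneg)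
        finally have e: "exp (- (norm (x - r *\<^sub>R y))\<^sup>2 / (1 - r\<^sup>2))
            \<le> exp 9 * (C0 * (1 / (1 + dist x y / \<rho>) ^ (?d + 1)))" .
        have "(pi * (1 - r\<^sup>2)) powr (- real ?d / 2) \<le> (\<rho>\<^sup>2) powr (- real ?d / 2)"
          unfolding \<rho>(2)[symmetric] using \<rho>(1) pi_gt3 by (intro powr_mono2') auto
        also have "\<rho>\<^sup>2 = \<rho> powr 2" using \<rho>(1) by simp
        also have "(\<rho> powr 2) powr (- real ?d / 2) = \<rho> powr (- real ?d)"
          unfolding powr_powr by simp
        also have "\<dots> = 1 / \<rho> ^ ?d"
          using \<rho>(1) by (simp add: powr_minus_divide powr_realpow)
        finally have "(pi * (1 - r\<^sup>2)) powr (- real ?d / 2) * exp (- (norm (x - r *\<^sub>R y))\<^sup>2 / (1 - r\<^sup>2))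
          \<le> (1 / \<rho> ^ ?d) * (exp 9 * (C0 * (1 / (1 + dist x y / \<rho>) ^ (?d + 1))))"
          using e \<rho>(1) by (intro mult_mono) auto
        then show ?thesis using k[of y] by (simp add: mult_ac)
      qed
      have "(\<integral>\<^sup>+ y. ennreal (reduced_kernel m u x y) * G y \<partial>lborel)
        \<le> (\<integral>\<^sup>+ y. ennreal (exp 9 * C0 * (1 / \<rho> ^ ?d)) * (ennreal (1 / (1 + dist x y / \<rho>) ^ (?d + 1)) * G y) \<partial>lborel)"
      proof (rule nn_integral_mono)
        fix y
        show "ennreal (reduced_kernel m u x y) * G y
          \<le> ennreal (exp 9 * C0 * (1 / \<rho> ^ ?d)) * (ennreal (1 / (1 + dist x y / \<rho>) ^ (?d + 1)) * G y)"
        proof (cases "norm y \<le> 3 * R")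
          case True
          have "ennreal (reduced_kernel m u x y)
            \<le> ennreal (exp 9 * C0 * (1 / \<rho> ^ ?d)) * ennreal (1 / (1 + dist x y / \<rho>) ^ (?d + 1))"
            using le[OF True] C0(1) \<rho>(1) by (subst ennreal_mult[symmetric]) (auto intro!: ennreal_leI)
          then show ?thesis by (simp only: mult.assoc[symmetric] mult_right_mono zero_le)
        qed (simp add: G_def)
      qed
      also have "\<dots> = ennreal (exp 9 * C0 * (1 / \<rho> ^ ?d)) * (\<integral>\<^sup>+ y. ennreal (1 / (1 + dist x y / \<rho>) ^ (?d + 1)) * G y \<partial>lborel)"
        by (rule nn_integral_cmult) simp
      also have "\<dots> \<le> ennreal (exp 9 * C0 * (1 / \<rho> ^ ?d)) * (ennreal (2 ^ (?d + 2) * ?w * \<rho> ^ ?d) * hl_max G x)"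
        using nn_integral_bump_le_hl_max[of G \<rho> x] \<rho>(1) by (intro mult_left_mono) auto
      also have "\<dots> = ennreal C1 * hl_max G x"
      proof -
        have "exp 9 * C0 * (1 / \<rho> ^ ?d) * (2 ^ (?d + 2) * ?w * \<rho> ^ ?d) = C1"
          using \<rho>(1) by (simp add: C1_def)
        then show ?thesis using C0(1) \<rho>(1)
          by (subst mult.assoc[symmetric], subst ennreal_mult[symmetric]) auto
      qed
      also have "\<dots> \<le> ennreal ((C1 + C2) * (1 + norm x) ^ (2 * ?d)) * hl_max G x"
      proof (intro mult_right_mono ennreal_leI)
        have "C1 * 1 \<le> (C1 + C2) * (1 + norm x) ^ (2 * ?d)" using C12 RR by (intro mult_mono) auto
        then show "C1 \<le> (C1 + C2) * (1 + norm x) ^ (2 * ?d)" by simp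
      qed simp
      finally show ?thesis unfolding lhs GM .
    next
      case False
      have "1 / R\<^sup>2 \<le> 1 - r" using False by simp
      also have "\<dots> \<le> 1 - r\<^sup>2" using r by (simp add: power2_eq_square)
      also have "\<dots> \<le> pi * (1 - r\<^sup>2)" using r2l pi_gt3 by simp
      finally have p: "1 / R\<^sup>2 \<le> pi * (1 - r\<^sup>2)" .
      have "(pi * (1 - r\<^sup>2)) powr (- real ?d / 2) \<le> (1 / R\<^sup>2) powr (- real ?d / 2)"
        using p R by (intro powr_mono2') auto
      also have "1 / R\<^sup>2 = R powr (-2)"
        using R by (simp add: powr_minus_divide)
      also have "(R powr (-2)) powr (- real ?d / 2) = R ^ ?d"
        using R by (simp add: powr_powr powr_realpow)
      finally have "reduced_kernel m u x y \<le> R ^ ?d * 1" for y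
        using k[of y] r2l R by (elim order_trans) (intro mult_mono, auto)
      then have kR: "reduced_kernel m u x y \<le> R ^ ?d" for y by simp
      have "(\<integral>\<^sup>+ y. ennreal (reduced_kernel m u x y) * G y \<partial>lborel)
        \<le> (\<integral>\<^sup>+ y. ennreal (R ^ ?d) * (G y * indicator (ball x (5 * R)) y) \<partial>lborel)"
      proof (rule nn_integral_mono)
        fix y
        show "ennreal (reduced_kernel m u x y) * G y \<le> ennreal (R ^ ?d) * (G y * indicator (ball x (5 * R)) y)"
        proof (cases "norm y \<le> 3 * R")
          case True
          then have "dist x y < 5 * R" using R norm_triangle_ineq4[of x y] by (simp add: dist_norm)
          then show ?thesis using kR[of y] by (simp add: mult_right_mono ennreal_leI)
        qed (simp add: G_def)
      qed
      also have "\<dots> = ennreal (R ^ ?d) * (\<integral>\<^sup>+ y\<in>ball x (5 * R). G y \<partial>lborel)"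
        by (rule nn_integral_cmult) simp
      also have "\<dots> \<le> ennreal (R ^ ?d) * (emeasure lborel (ball x (5 * R)) * hl_max G x)"
        using R by (intro mult_left_mono nn_integral_ball_le_hl_max) auto
      also have "\<dots> = ennreal (C2 * R ^ (2 * ?d)) * hl_max G x"
      proof -
        have "R ^ ?d * (?w * (5 * R) ^ ?d) = C2 * R ^ (2 * ?d)"
          by (simp add: C2_def power_mult_distrib mult_2 power_add)
        then show ?thesis using R
          by (subst emeasure_ball, simp) (simp add: mult.assoc[symmetric] ennreal_mult[symmetric])
      qed
      also have "\<dots> \<le> ennreal ((C1 + C2) * (1 + norm x) ^ (2 * ?d)) * hl_max G x"
        using C12 R by (intro mult_right_mono ennreal_leI mult_mono power_mono) auto
      finally show ?thesis unfolding lhs GM .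
    qed
  qed
  show ?thesis
    by (rule exI[of _ "C1 + C2"], rule conjI, use C12 in simp, intro allI impI, rule main) blast+
qed

section \<open>The decay function and the large time integral\<close>

text \<open>
  The polynomial and logarithmic part of \<^const>\<open>phi\<close> as a function of the radius, with
  \<open>\<kappa> = (m + d) / 2\<close>.
\<close>

definition decay :: "real \<Rightarrow> real \<Rightarrow> real \<Rightarrow> real" where
  "decay \<kappa> \<nu> \<rho> =
     (if \<kappa> > 0 then 1 / ((1 + \<rho>) powr \<kappa> * ln (exp 1 + \<rho>) powr (1 + \<nu>))
      else 1 / ln (exp 1 + \<rho>) powr \<nu>)"

lemma phi_eq_decay:
  "phi m \<nu> (y :: real ^ 'n) = exp (- (norm y)\<^sup>2 / 2) * decay ((m + real CARD('n)) / 2) \<nu> (norm y)"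
  by (auto simp: phi_def decay_def add.commute)

lemma ln_exp1_add_ge_1: "0 \<le> \<rho> \<Longrightarrow> 1 \<le> ln (exp 1 + \<rho>)" for \<rho> :: real
  by (subst ln_ge_iff) (auto intro: add_pos_nonneg)

lemma ln_exp1_add_le:
  fixes \<rho> :: real
  assumes "0 \<le> \<rho>"
  shows "ln (exp 1 + \<rho>) \<le> 1 + \<rho>"
proof -
  have "exp 1 + \<rho> \<le> exp 1 * exp \<rho>"
  proof -
    have "\<rho> \<le> exp \<rho> - 1" using exp_ge_add_one_self[of \<rho>] by linarith
    also have "1 * (exp \<rho> - 1) \<le> exp 1 * (exp \<rho> - 1)" using assms by (intro mult_right_mono) auto
    finally show ?thesis by (simp add: algebra_simps)
  qed
  then have "ln (exp 1 + \<rho>) \<le> ln (exp (1 + \<rho>))"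
    using assms by (subst ln_le_cancel_iff) (auto simp: exp_add intro: add_pos_nonneg)
  then show ?thesis by simp
qed

lemma decay_pos: "0 \<le> \<rho> \<Longrightarrow> 0 < decay \<kappa> \<nu> \<rho>"
  using ln_exp1_add_ge_1[of \<rho>] by (auto simp: decay_def)

lemma borel_measurable_decay [measurable]: "decay \<kappa> \<nu> \<in> borel_measurable borel"
  unfolding decay_def by measurable

lemma decay_ge:
  assumes \<kappa>: "0 \<le> \<kappa>" and \<nu>: "0 < \<nu>" and \<rho>: "0 \<le> \<rho>"
  shows "(1 + \<rho>) powr (- (\<kappa> + 1 + \<nu>)) \<le> decay \<kappa> \<nu> \<rho>"
proof -
  let ?l = "ln (exp 1 + \<rho>)"
  have l: "1 \<le> ?l" "?l \<le> 1 + \<rho>" using ln_exp1_add_ge_1 ln_exp1_add_le \<rho> by auto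
  show ?thesis
  proof (cases "\<kappa> > 0")
    case True
    have "?l powr (1 + \<nu>) \<le> (1 + \<rho>) powr (1 + \<nu>)" using l \<nu> by (intro powr_mono2) auto
    then have "(1 + \<rho>) powr \<kappa> * ?l powr (1 + \<nu>) \<le> (1 + \<rho>) powr \<kappa> * (1 + \<rho>) powr (1 + \<nu>)"
      by (intro mult_left_mono) auto
    also have "\<dots> = (1 + \<rho>) powr (\<kappa> + 1 + \<nu>)" by (simp add: powr_add[symmetric] add.assoc)
    finally have "1 / (1 + \<rho>) powr (\<kappa> + 1 + \<nu>) \<le> 1 / ((1 + \<rho>) powr \<kappa> * ?l powr (1 + \<nu>))"
      using l \<rho> by (intro divide_left_mono) auto
    then show ?thesis using True by (simp only: decay_def powr_minus_divide if_True)
  next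
    case False
    have "?l powr \<nu> \<le> (1 + \<rho>) powr \<nu>" using l \<nu> by (intro powr_mono2) auto
    also have "\<dots> \<le> (1 + \<rho>) powr (\<kappa> + 1 + \<nu>)" using \<kappa> \<rho> by (intro powr_mono) auto
    finally have "1 / (1 + \<rho>) powr (\<kappa> + 1 + \<nu>) \<le> 1 / ?l powr \<nu>"
      using l \<rho> by (intro divide_left_mono) auto
    then show ?thesis using False by (simp only: decay_def powr_minus_divide if_False)
  qed
qed

lemma nn_integral_powr_tail:
  fixes c \<nu> :: real
  assumes "0 < c" "0 < \<nu>"
  shows "(\<integral>\<^sup>+ u. ennreal (u powr (- 1 - \<nu>)) * indicator {c..} u \<partial>lborel) = ennreal (c powr (- \<nu>) / \<nu>)"
proof -
  have "((\<lambda>u. u powr (- 1 - \<nu>)) has_integral - (c powr (- 1 - \<nu> + 1)) / (- 1 - \<nu> + 1)) {c..}"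
    by (rule has_integral_powr_to_inf) (use assms in auto)
  also have "- (c powr (- 1 - \<nu> + 1)) / (- 1 - \<nu> + 1) = c powr (- \<nu>) / \<nu>"
    using assms by simp
  finally show ?thesis
    by (intro nn_integral_has_integral_lebesgue') auto
qed

text \<open>
  Comparison with \<open>(1 + \<bar>v\<bar>) powr (- 2)\<close>, which is integrable on the line.
\<close>

lemma nn_integral_exp_abs_finite:
  assumes "0 < \<kappa>"
  shows "(\<integral>\<^sup>+ v. ennreal (exp (- (\<kappa> * \<bar>v\<bar>))) \<partial>lborel) < top"
proof -
  obtain C where C: "0 < C" "\<And>z. 0 \<le> z \<Longrightarrow> exp (- z) \<le> C * (1 + z) powr (- 2 :: real)"
    using exp_minus_le_polynomial_decay[of 2] by auto
  define q where "q = min 1 \<kappa>"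
  have q: "0 < q" "q \<le> 1" "q \<le> \<kappa>" using assms by (auto simp: q_def)
  have "exp (- (\<kappa> * \<bar>v\<bar>)) \<le> C / q\<^sup>2 * (1 / (1 + norm v) ^ (DIM(real) + 1))" for v :: real
  proof -
    have "exp (- (\<kappa> * \<bar>v\<bar>)) \<le> exp (- (q * \<bar>v\<bar>))" using q by (simp add: mult_right_mono)
    also have "\<dots> \<le> C * (1 + q * \<bar>v\<bar>) powr (- 2)" using q by (intro C) auto
    also have "(1 + q * \<bar>v\<bar>) powr (- 2) \<le> (q * (1 + \<bar>v\<bar>)) powr (- 2)"
      using q by (intro powr_mono2') (auto simp: algebra_simps intro: add_pos_nonneg)
    also have "(q * (1 + \<bar>v\<bar>)) powr (- 2) = 1 / (q\<^sup>2 * (1 + \<bar>v\<bar>)\<^sup>2)"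
      using q by (simp add: powr_minus_divide power_mult_distrib)
    finally show ?thesis using C(1) by (simp add: power2_eq_square)
  qed
  then have "(\<integral>\<^sup>+ v. ennreal (exp (- (\<kappa> * \<bar>v\<bar>))) \<partial>lborel)
     \<le> (\<integral>\<^sup>+ v. ennreal (C / q\<^sup>2) * ennreal (1 / (1 + norm (v::real)) ^ (DIM(real) + 1)) \<partial>lborel)"
    using C(1) by (intro nn_integral_mono) (auto simp: ennreal_mult[symmetric] intro!: ennreal_leI)
  also have "\<dots> = ennreal (C / q\<^sup>2) * (\<integral>\<^sup>+ v. ennreal (1 / (1 + norm (v::real)) ^ (DIM(real) + 1)) \<partial>lborel)"
    by (rule nn_integral_cmult) simp
  also have "\<dots> < top"
    using nn_integral_inverse_power_finite[where 'a=real] by (simp add: ennreal_mult_less_top)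
  finally show ?thesis .
qed

text \<open>
  In the variable \<open>z = exp (- 2 * u) * (1 + \<rho>)\<close> the integrand is \<open>(1 + \<rho>) powr (- \<kappa>)\<close> times a function
  bounded by \<open>min z (1 / z) powr \<kappa>\<close>, that is by \<open>exp (- \<kappa> * \<bar>ln z\<bar>)\<close>. As \<open>ln z\<close> is affine in
  \<open>u\<close>, the integral of the latter does not depend on \<open>\<rho>\<close>.
\<close>

lemma nn_integral_dilated_bump_le:
  assumes \<kappa>: "0 < \<kappa>"
  obtains C where "0 \<le> C" "\<And>\<rho>. 0 \<le> \<rho> \<Longrightarrow>
    (\<integral>\<^sup>+ u. ennreal (exp (- 2 * u) powr \<kappa> * (1 + exp (- 2 * u) * \<rho>) powr (- (2 * \<kappa>))) * indicator {0..} u \<partial>lborel)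
    \<le> ennreal (C * (1 + \<rho>) powr (- \<kappa>))"
proof -
  define C where "C = enn2real (\<integral>\<^sup>+ v. ennreal (exp (- (\<kappa> * \<bar>v\<bar>))) \<partial>lborel)"
  have C: "(\<integral>\<^sup>+ v. ennreal (exp (- (\<kappa> * \<bar>v\<bar>))) \<partial>lborel) = ennreal C" "0 \<le> C"
    using nn_integral_exp_abs_finite[OF \<kappa>] by (auto simp: C_def)
  show ?thesis
  proof (rule that[OF C(2)])
    fix \<rho> :: real assume \<rho>: "0 \<le> \<rho>"
    have le: "exp (- 2 * u) powr \<kappa> * (1 + exp (- 2 * u) * \<rho>) powr (- (2 * \<kappa>))
      \<le> (1 + \<rho>) powr (- \<kappa>) * exp (- (\<kappa> * \<bar>ln (1 + \<rho>) + (-2) * u\<bar>))" if u: "0 \<le> u" for u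
    proof -
      define r where "r = exp (- 2 * u)"
      define z where "z = r * (1 + \<rho>)"
      have r: "0 < r" "r \<le> 1" using u by (auto simp: r_def)
      have z: "0 < z" using r \<rho> by (auto simp: z_def intro!: mult_pos_pos add_pos_nonneg)
      have lz: "ln z = ln (1 + \<rho>) + (-2) * u"
        using r \<rho> unfolding z_def by (subst ln_mult) (auto simp: r_def)
      have zk: "z powr \<kappa> = r powr \<kappa> * (1 + \<rho>) powr \<kappa>"
        using r \<rho> by (simp add: z_def powr_mult)
      have *: "1 \<le> 1 + r * \<rho>" "z \<le> 1 + r * \<rho>" using r \<rho> by (auto simp: z_def algebra_simps)
      have "z powr \<kappa> * (1 + r * \<rho>) powr (- (2 * \<kappa>)) \<le> exp (- (\<kappa> * \<bar>ln z\<bar>))"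
      proof (cases "z \<le> 1")
        case True
        have "(1 + r * \<rho>) powr (- (2 * \<kappa>)) \<le> 1 powr (- (2 * \<kappa>))"
          using * \<kappa> by (intro powr_mono2') auto
        then have "z powr \<kappa> * (1 + r * \<rho>) powr (- (2 * \<kappa>)) \<le> z powr \<kappa> * 1"
          by (intro mult_left_mono) auto
        also have "\<dots> = exp (- (\<kappa> * \<bar>ln z\<bar>))" using True z by (simp add: powr_def)
        finally show ?thesis .
      next
        case False
        have "(1 + r * \<rho>) powr (- (2 * \<kappa>)) \<le> z powr (- (2 * \<kappa>))"
          using * \<kappa> z by (intro powr_mono2') auto
        then have "z powr \<kappa> * (1 + r * \<rho>) powr (- (2 * \<kappa>)) \<le> z powr \<kappa> * z powr (- (2 * \<kappa>))"
          by (intro mult_left_mono) auto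
        also have "\<dots> = z powr (- \<kappa>)" using z by (simp add: powr_add[symmetric])
        also have "\<dots> = exp (- (\<kappa> * \<bar>ln z\<bar>))" using False z by (simp add: powr_def)
        finally show ?thesis .
      qed
      then have "(1 + \<rho>) powr (- \<kappa>) * (z powr \<kappa> * (1 + r * \<rho>) powr (- (2 * \<kappa>))) \<le> (1 + \<rho>) powr (- \<kappa>) * exp (- (\<kappa> * \<bar>ln z\<bar>))"
        by (intro mult_left_mono) auto
      moreover have "(1 + \<rho>) powr (- \<kappa>) * (z powr \<kappa> * (1 + r * \<rho>) powr (- (2 * \<kappa>)))
         = r powr \<kappa> * (1 + r * \<rho>) powr (- (2 * \<kappa>))"
        using \<rho> by (simp add: zk powr_minus)
      ultimately show ?thesis unfolding lz r_def[symmetric] by linarith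
    qed
    have "(\<integral>\<^sup>+ u. ennreal (exp (- 2 * u) powr \<kappa> * (1 + exp (- 2 * u) * \<rho>) powr (- (2 * \<kappa>))) * indicator {0..} u \<partial>lborel)
       \<le> (\<integral>\<^sup>+ u. ennreal ((1 + \<rho>) powr (- \<kappa>)) * ennreal (exp (- (\<kappa> * \<bar>ln (1 + \<rho>) + (-2) * u\<bar>))) \<partial>lborel)"
      using le by (intro nn_integral_mono)
        (auto simp: indicator_def ennreal_mult'[symmetric] intro!: ennreal_leI)
    also have "\<dots> = ennreal ((1 + \<rho>) powr (- \<kappa>)) * (\<integral>\<^sup>+ u. ennreal (exp (- (\<kappa> * \<bar>ln (1 + \<rho>) + (-2) * u\<bar>))) \<partial>lborel)"
      by (rule nn_integral_cmult) simp
    also have "\<dots> \<le> ennreal ((1 + \<rho>) powr (- \<kappa>)) * ennreal C"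
    proof (intro mult_left_mono)
      have "ennreal C = ennreal \<bar>-2\<bar> * (\<integral>\<^sup>+ u. ennreal (exp (- (\<kappa> * \<bar>ln (1 + \<rho>) + (-2) * u\<bar>))) \<partial>lborel)"
        unfolding C(1)[symmetric] by (rule nn_integral_real_affine) auto
      moreover have "1 \<le> ennreal \<bar>-2\<bar>" by simp
      ultimately have "1 * (\<integral>\<^sup>+ u. ennreal (exp (- (\<kappa> * \<bar>ln (1 + \<rho>) + (-2) * u\<bar>))) \<partial>lborel) \<le> ennreal C"
        by (simp only: mult_right_mono zero_le)
      then show "(\<integral>\<^sup>+ u. ennreal (exp (- (\<kappa> * \<bar>ln (1 + \<rho>) + (-2) * u\<bar>))) \<partial>lborel) \<le> ennreal C" by simp
    qed simp
    also have "\<dots> = ennreal (C * (1 + \<rho>) powr (- \<kappa>))"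
      using C(2) by (simp add: ennreal_mult[symmetric] mult.commute)
    finally show "(\<integral>\<^sup>+ u. ennreal (exp (- 2 * u) powr \<kappa> * (1 + exp (- 2 * u) * \<rho>) powr (- (2 * \<kappa>))) * indicator {0..} u \<partial>lborel)
      \<le> ennreal (C * (1 + \<rho>) powr (- \<kappa>))" .
  qed
qed

text \<open>
  The range is cut at \<open>u = ln (e + \<rho>) / 8\<close>. Before this time \<open>1 + exp (- 2 * u) * \<rho>\<close> is at
  least \<open>(e + \<rho>) powr (1 / 2) / e\<close>, and the exponent \<open>2 * \<kappa> + 2 * \<nu> + 2\<close> is chosen so that half of it
  yields the required decay. After this time \<open>u powr (- 1 - \<nu>)\<close> is at most a multiple of
  \<open>ln (e + \<rho>) powr (- 1 - \<nu>)\<close>; for \<open>\<kappa> > 0\<close> the remaining integral converges and gives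
  \<open>(1 + \<rho>) powr (- \<kappa>)\<close>, whereas for \<open>\<kappa> = 0\<close> only \<open>u powr (- 1 - \<nu>)\<close> is left to integrate, which
  costs one power of the logarithm.
\<close>

lemma large_time_integral_le_decay:
  assumes \<kappa>: "0 \<le> \<kappa>" and \<nu>: "0 < \<nu>"
  obtains C where "0 \<le> C" "\<And>\<rho>. 0 \<le> \<rho> \<Longrightarrow>
    (\<integral>\<^sup>+ u. ennreal (u powr (- 1 - \<nu>) * (exp (- 2 * u) powr \<kappa> * (1 + exp (- 2 * u) * \<rho>) powr (- (2 * \<kappa> + 2 * \<nu> + 2))))
        * indicator {1/8..} u \<partial>lborel)
    \<le> ennreal (C * decay \<kappa> \<nu> \<rho>)"
proof -
  define B where "B = 2 * \<kappa> + 2 * \<nu> + 2"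
  define C1 where "C1 = exp B * ((1/8) powr (- \<nu>) / \<nu>)"
  have C1: "0 \<le> C1" using \<nu> by (simp add: C1_def)
  define g where "g \<rho> u = exp (- 2 * u) powr \<kappa> * (1 + exp (- 2 * u) * \<rho>) powr (- B)" for \<rho> u :: real
  have g0: "0 \<le> g \<rho> u" for \<rho> u by (simp add: g_def)
  have [measurable]: "g \<rho> \<in> borel_measurable borel" for \<rho> unfolding g_def by measurable
  let ?f = "\<lambda>\<rho> u. u powr (- 1 - \<nu>) * g \<rho> u"
  have small: "(\<integral>\<^sup>+ u. ennreal (?f \<rho> u) * indicator {1/8..<ln (exp 1 + \<rho>) / 8} u \<partial>lborel)
      \<le> ennreal (C1 * decay \<kappa> \<nu> \<rho>)" if \<rho>: "0 \<le> \<rho>" for \<rho>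
  proof -
    let ?l = "ln (exp 1 + \<rho>)"
    have l: "1 \<le> ?l" using ln_exp1_add_ge_1 \<rho> by auto
    have l0: "0 < ?l" using l by linarith
    have E: "1 \<le> exp 1 + \<rho>" using \<rho> by (simp add: add_increasing2)
    have gb: "g \<rho> u \<le> exp B * decay \<kappa> \<nu> \<rho>" if u: "1/8 \<le> u" "u < ?l / 8" for u
    proof -
      have "(exp 1 + \<rho>) powr (- (1/4)) = exp (- (?l / 4))" using E by (simp add: powr_def)
      also have "\<dots> \<le> exp (- 2 * u)" using u by simp
      finally have 1: "(exp 1 + \<rho>) powr (- (1/4)) \<le> exp (- 2 * u)" .
      have 2: "(exp 1 + \<rho>) powr (- (1/4)) \<le> 1" using powr_mono[of "- (1/4)" 0 "exp 1 + \<rho>"] E by simp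
      have "(exp 1 + \<rho>) powr (- (1/4)) * (exp 1 + \<rho>) \<le> (exp 1 + \<rho>) powr (- (1/4)) * (exp 1 * (1 + \<rho>))"
      proof (intro mult_left_mono)
        have "1 * \<rho> \<le> exp 1 * \<rho>" using \<rho> by (intro mult_right_mono) auto
        then show "exp 1 + \<rho> \<le> exp 1 * (1 + \<rho>)" by (simp add: algebra_simps)
      qed simp
      also have "\<dots> = exp 1 * ((exp 1 + \<rho>) powr (- (1/4)) + (exp 1 + \<rho>) powr (- (1/4)) * \<rho>)"
        by (simp add: algebra_simps)
      also have "\<dots> \<le> exp 1 * (1 + exp (- 2 * u) * \<rho>)"
        using 1 2 \<rho> by (intro mult_left_mono add_mono mult_right_mono) auto
      finally have "(exp 1 + \<rho>) powr (3/4) \<le> exp 1 * (1 + exp (- 2 * u) * \<rho>)"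
        using E powr_add[of "exp 1 + \<rho>" "- (1/4)" 1] by simp
      moreover have "(exp 1 + \<rho>) powr (1/2) \<le> (exp 1 + \<rho>) powr (3/4)" using E by (intro powr_mono) auto
      ultimately have "(exp 1 + \<rho>) powr (1/2) / exp 1 \<le> 1 + exp (- 2 * u) * \<rho>"
        by (simp add: field_simps)
      then have "(1 + exp (- 2 * u) * \<rho>) powr (- B) \<le> ((exp 1 + \<rho>) powr (1/2) / exp 1) powr (- B)"
        using E \<kappa> \<nu> by (intro powr_mono2') (auto simp: B_def)
      also have "\<dots> = exp B * (exp 1 + \<rho>) powr (- (B / 2))"
        using E by (simp add: powr_divide powr_powr powr_minus_divide) (simp add: powr_def)
      also have "\<dots> = exp B * ((exp 1 + \<rho>) powr (- \<kappa>) * (exp 1 + \<rho>) powr (- (1 + \<nu>)))"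
      proof -
        have "- (B / 2) = - \<kappa> + - (1 + \<nu>)" by (simp add: B_def field_simps)
        then show ?thesis by (simp only: powr_add)
      qed
      also have "\<dots> \<le> exp B * decay \<kappa> \<nu> \<rho>"
      proof (intro mult_left_mono)
        have a: "(exp 1 + \<rho>) powr (- \<kappa>) \<le> (1 + \<rho>) powr (- \<kappa>)"
          using \<rho> \<kappa> by (intro powr_mono2') auto
        have lle: "?l \<le> exp 1 + \<rho>" using ln_exp1_add_le[OF \<rho>] exp_ge_add_one_self[of "1::real"] by linarith
        then have b: "(exp 1 + \<rho>) powr (- (1 + \<nu>)) \<le> ?l powr (- (1 + \<nu>))"
          using l0 \<nu> by (intro powr_mono2') auto
        show "(exp 1 + \<rho>) powr (- \<kappa>) * (exp 1 + \<rho>) powr (- (1 + \<nu>)) \<le> decay \<kappa> \<nu> \<rho>"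
        proof (cases "\<kappa> > 0")
          case True
          have "(exp 1 + \<rho>) powr (- \<kappa>) * (exp 1 + \<rho>) powr (- (1 + \<nu>)) \<le> (1 + \<rho>) powr (- \<kappa>) * ?l powr (- (1 + \<nu>))"
            using a b by (intro mult_mono) auto
          also have "\<dots> = decay \<kappa> \<nu> \<rho>"
            unfolding decay_def powr_minus_divide using True by simp
          finally show ?thesis .
        next
          case False
          then have "\<kappa> = 0" using \<kappa> by simp
          then have "(exp 1 + \<rho>) powr (- \<kappa>) * (exp 1 + \<rho>) powr (- (1 + \<nu>)) \<le> ?l powr (- (1 + \<nu>))"
            using b E by simp
          also have "\<dots> \<le> ?l powr (- \<nu>)" using l by (intro powr_mono) auto
          also have "\<dots> = decay \<kappa> \<nu> \<rho>"
            unfolding decay_def powr_minus_divide using False by simp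
          finally show ?thesis .
        qed
      qed simp
      finally have "(1 + exp (- 2 * u) * \<rho>) powr (- B) \<le> exp B * decay \<kappa> \<nu> \<rho>" .
      moreover have "exp (- 2 * u) powr \<kappa> \<le> 1" using u \<kappa> by (simp add: powr_def)
      ultimately have "g \<rho> u \<le> 1 * (exp B * decay \<kappa> \<nu> \<rho>)"
        unfolding g_def by (intro mult_mono) auto
      then show ?thesis by simp
    qed
    have "(\<integral>\<^sup>+ u. ennreal (?f \<rho> u) * indicator {1/8..<?l / 8} u \<partial>lborel)
      \<le> (\<integral>\<^sup>+ u. ennreal (exp B * decay \<kappa> \<nu> \<rho>) * (ennreal (u powr (- 1 - \<nu>)) * indicator {1/8..} u) \<partial>lborel)"
    proof (intro nn_integral_mono)
      fix u
      show "ennreal (?f \<rho> u) * indicator {1/8..<?l / 8} u \<le> ennreal (exp B * decay \<kappa> \<nu> \<rho>) * (ennreal (u powr (- 1 - \<nu>)) * indicator {1/8..} u)"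
      proof (cases "u \<in> {1/8..<?l / 8}")
        case True
        then have "u powr (- 1 - \<nu>) * g \<rho> u \<le> u powr (- 1 - \<nu>) * (exp B * decay \<kappa> \<nu> \<rho>)"
          using gb by (intro mult_left_mono) auto
        then show ?thesis using True decay_pos[OF \<rho>, of \<kappa> \<nu>]
          by (simp add: ennreal_mult'[symmetric] mult.commute ennreal_leI)
      qed simp
    qed
    also have "\<dots> = ennreal (exp B * decay \<kappa> \<nu> \<rho>) * ennreal ((1/8) powr (- \<nu>) / \<nu>)"
      by (subst nn_integral_cmult, simp, subst nn_integral_powr_tail) (use \<nu> in auto)
    also have "\<dots> = ennreal (C1 * decay \<kappa> \<nu> \<rho>)"
      using \<nu> decay_pos[OF \<rho>, of \<kappa> \<nu>] by (simp add: C1_def ennreal_mult[symmetric] mult_ac)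
    finally show ?thesis .
  qed
  have large: "\<exists>C2\<ge>0. \<forall>\<rho>\<ge>0. (\<integral>\<^sup>+ u. ennreal (?f \<rho> u) * indicator {ln (exp 1 + \<rho>) / 8..} u \<partial>lborel)
      \<le> ennreal (C2 * decay \<kappa> \<nu> \<rho>)"
  proof (cases "\<kappa> > 0")
    case True
    obtain C where C: "0 \<le> C" "\<And>\<rho>. 0 \<le> \<rho> \<Longrightarrow>
      (\<integral>\<^sup>+ u. ennreal (exp (- 2 * u) powr \<kappa> * (1 + exp (- 2 * u) * \<rho>) powr (- (2 * \<kappa>))) * indicator {0..} u \<partial>lborel)
      \<le> ennreal (C * (1 + \<rho>) powr (- \<kappa>))"
      using nn_integral_dilated_bump_le[OF True] by blast
    let ?C2 = "(1/8) powr (- 1 - \<nu>) * C"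
    have "(\<integral>\<^sup>+ u. ennreal (?f \<rho> u) * indicator {ln (exp 1 + \<rho>) / 8..} u \<partial>lborel)
      \<le> ennreal (?C2 * decay \<kappa> \<nu> \<rho>)" if \<rho>: "0 \<le> \<rho>" for \<rho>
    proof -
      let ?l = "ln (exp 1 + \<rho>)"
      have l: "1 \<le> ?l" using ln_exp1_add_ge_1 \<rho> by auto
      let ?h = "\<lambda>u. exp (- 2 * u) powr \<kappa> * (1 + exp (- 2 * u) * \<rho>) powr (- (2 * \<kappa>))"
      have "(\<integral>\<^sup>+ u. ennreal (?f \<rho> u) * indicator {?l / 8..} u \<partial>lborel)
         \<le> (\<integral>\<^sup>+ u. ennreal ((?l / 8) powr (- 1 - \<nu>)) * (ennreal (?h u) * indicator {0..} u) \<partial>lborel)"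
      proof (intro nn_integral_mono)
        fix u
        show "ennreal (?f \<rho> u) * indicator {?l / 8..} u \<le> ennreal ((?l / 8) powr (- 1 - \<nu>)) * (ennreal (?h u) * indicator {0..} u)"
        proof (cases "?l / 8 \<le> u")
          case True
          then have u: "0 < u" using l by simp
          have "u powr (- 1 - \<nu>) \<le> (?l / 8) powr (- 1 - \<nu>)" using True l \<nu> by (intro powr_mono2') auto
          moreover have "g \<rho> u \<le> ?h u" unfolding g_def
            using \<rho> \<nu> by (intro mult_left_mono powr_mono) (auto simp: B_def)
          ultimately have "?f \<rho> u \<le> (?l / 8) powr (- 1 - \<nu>) * ?h u" using g0 by (intro mult_mono) auto
          then show ?thesis using u by (simp add: indicator_def ennreal_mult'[symmetric] ennreal_leI)
        qed simp
      qed
      also have "\<dots> = ennreal ((?l / 8) powr (- 1 - \<nu>)) * (\<integral>\<^sup>+ u. ennreal (?h u) * indicator {0..} u \<partial>lborel)"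
        by (rule nn_integral_cmult) simp
      also have "\<dots> \<le> ennreal ((?l / 8) powr (- 1 - \<nu>)) * ennreal (C * (1 + \<rho>) powr (- \<kappa>))"
        by (intro mult_left_mono C \<rho>) simp
      also have "\<dots> = ennreal (?C2 * decay \<kappa> \<nu> \<rho>)"
      proof -
        have e: "(?l / 8) powr (- 1 - \<nu>) = (1/8) powr (- 1 - \<nu>) * ?l powr (- (1 + \<nu>))"
          using l powr_mult[of "1/8" ?l "- 1 - \<nu>"] by (simp add: mult.commute)
        have "decay \<kappa> \<nu> \<rho> = (1 + \<rho>) powr (- \<kappa>) * ?l powr (- (1 + \<nu>))"
          unfolding decay_def powr_minus_divide using True by simp
        with e have "(?l / 8) powr (- 1 - \<nu>) * (C * (1 + \<rho>) powr (- \<kappa>)) = ?C2 * decay \<kappa> \<nu> \<rho>"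
          by (simp only: mult_ac)
        then show ?thesis using C(1) by (subst ennreal_mult[symmetric]) (simp, simp, simp only:)
      qed
      finally show ?thesis .
    qed
    moreover have "0 \<le> ?C2" using C by simp
    ultimately show ?thesis by (intro exI[of _ ?C2] conjI allI impI)
  next
    case False
    then have \<kappa>0: "\<kappa> = 0" using \<kappa> by simp
    let ?C2 = "(1/8) powr (- \<nu>) / \<nu>"
    have "(\<integral>\<^sup>+ u. ennreal (?f \<rho> u) * indicator {ln (exp 1 + \<rho>) / 8..} u \<partial>lborel)
      \<le> ennreal (?C2 * decay \<kappa> \<nu> \<rho>)" if \<rho>: "0 \<le> \<rho>" for \<rho>
    proof -
      let ?l = "ln (exp 1 + \<rho>)"
      have l: "1 \<le> ?l" using ln_exp1_add_ge_1 \<rho> by auto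
      have g1: "g \<rho> u \<le> 1" for u
      proof -
        have "(1 + exp (- 2 * u) * \<rho>) powr (- B) \<le> 1 powr (- B)"
          using \<rho> \<nu> \<kappa> by (intro powr_mono2') (auto simp: B_def)
        then show ?thesis by (simp add: g_def \<kappa>0)
      qed
      have "(\<integral>\<^sup>+ u. ennreal (?f \<rho> u) * indicator {?l / 8..} u \<partial>lborel)
         \<le> (\<integral>\<^sup>+ u. ennreal (u powr (- 1 - \<nu>)) * indicator {?l / 8..} u \<partial>lborel)"
        using g1 g0 by (intro nn_integral_mono mult_right_mono ennreal_leI) (auto simp: mult_left_le)
      also have "\<dots> = ennreal ((?l / 8) powr (- \<nu>) / \<nu>)"
        by (rule nn_integral_powr_tail) (use l \<nu> in auto)
      also have "\<dots> = ennreal (?C2 * decay \<kappa> \<nu> \<rho>)"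
      proof -
        have e: "(?l / 8) powr (- \<nu>) = (1/8) powr (- \<nu>) * ?l powr (- \<nu>)"
          using powr_mult[of "1/8" ?l "- \<nu>"] by (simp only: mult_1 times_divide_eq_left)
        have "decay \<kappa> \<nu> \<rho> = ?l powr (- \<nu>)"
          unfolding decay_def powr_minus_divide using False by simp
        with e have "(?l / 8) powr (- \<nu>) / \<nu> = ?C2 * decay \<kappa> \<nu> \<rho>"
          by (simp only: times_divide_eq_left)
        then show ?thesis by (simp only:)
      qed
      finally show ?thesis .
    qed
    moreover have "0 \<le> ?C2" using \<nu> by simp
    ultimately show ?thesis by (intro exI[of _ ?C2] conjI allI impI)
  qed
  then obtain C2 where C2: "0 \<le> C2" "\<And>\<rho>. 0 \<le> \<rho> \<Longrightarrow> (\<integral>\<^sup>+ u. ennreal (?f \<rho> u) * indicator {ln (exp 1 + \<rho>) / 8..} u \<partial>lborel)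
      \<le> ennreal (C2 * decay \<kappa> \<nu> \<rho>)"
    by blast
  show ?thesis
  proof (rule that[of "C1 + C2"])
    fix \<rho> :: real assume \<rho>: "0 \<le> \<rho>"
    let ?l = "ln (exp 1 + \<rho>)"
    have "(\<integral>\<^sup>+ u. ennreal (?f \<rho> u) * indicator {1/8..} u \<partial>lborel)
      \<le> (\<integral>\<^sup>+ u. ennreal (?f \<rho> u) * indicator {1/8..<?l / 8} u + ennreal (?f \<rho> u) * indicator {?l / 8..} u \<partial>lborel)"
      by (intro nn_integral_mono) (auto simp: indicator_def)
    also have "\<dots> = (\<integral>\<^sup>+ u. ennreal (?f \<rho> u) * indicator {1/8..<?l / 8} u \<partial>lborel) + (\<integral>\<^sup>+ u. ennreal (?f \<rho> u) * indicator {?l / 8..} u \<partial>lborel)"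
      by (rule nn_integral_add) simp_all
    also have "\<dots> \<le> ennreal (C1 * decay \<kappa> \<nu> \<rho>) + ennreal (C2 * decay \<kappa> \<nu> \<rho>)"
      by (rule add_mono[OF small[OF \<rho>] C2(2)[OF \<rho>]])
    also have "\<dots> = ennreal ((C1 + C2) * decay \<kappa> \<nu> \<rho>)"
      unfolding distrib_right using C1 C2(1) decay_pos[OF \<rho>, of \<kappa> \<nu>]
      by (intro ennreal_plus[symmetric] mult_nonneg_nonneg) auto
    finally show "(\<integral>\<^sup>+ u. ennreal (u powr (- 1 - \<nu>) * (exp (- 2 * u) powr \<kappa> * (1 + exp (- 2 * u) * \<rho>) powr (- (2 * \<kappa> + 2 * \<nu> + 2))))
        * indicator {1/8..} u \<partial>lborel) \<le> ennreal ((C1 + C2) * decay \<kappa> \<nu> \<rho>)"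
      by (simp only: g_def B_def)
  qed (use C1 C2 in simp)
qed

section \<open>The kernel far from the diagonal\<close>

lemma borel_measurable_reduced_kernel [measurable (raw)]:
  fixes g h :: "'a \<Rightarrow> real ^ 'n"
  assumes [measurable]: "f \<in> borel_measurable M" "g \<in> borel_measurable M" "h \<in> borel_measurable M"
  shows "(\<lambda>w. reduced_kernel m (f w) (g w) (h w)) \<in> borel_measurable M"
  unfolding reduced_kernel_def by measurable

text \<open>
  Peetre's inequality \<open>1 + r * \<bar>y\<bar> \<le> (1 + \<bar>x\<bar>) * (1 + \<bar>x - r y\<bar>)\<close> trades the Gaussian for a product of
  a function of \<open>x\<close> and a function of \<open>y\<close>.
\<close>

lemma gaussian_le_peetre_weight:
  fixes s :: real
  assumes s: "0 \<le> s"
  obtains C where "0 < C" "\<And>(x::'a::real_normed_vector) y r. 0 \<le> r \<Longrightarrow>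
    exp (- (norm (x - r *\<^sub>R y))\<^sup>2) \<le> C * ((1 + norm x) powr s * (1 + r * norm y) powr (- s))"
proof -
  obtain C where C: "0 < C" "\<And>z. 0 \<le> z \<Longrightarrow> exp (- z\<^sup>2 / 2) \<le> C * (1 + z) powr (- s)"
    using gaussian_le_polynomial_decay[OF s] by blast
  show ?thesis
  proof (rule that[OF C(1)])
    fix x y :: 'a and r :: real assume r: "0 \<le> r"
    define z where "z = norm (x - r *\<^sub>R y)"
    have z: "0 \<le> z" by (simp add: z_def)
    have "r * norm y \<le> norm x + z"
      using norm_triangle_ineq4[of x "x - r *\<^sub>R y"] r by (simp add: z_def)
    then have "1 + r * norm y \<le> (1 + norm x) * (1 + z)"
      using mult_nonneg_nonneg[OF norm_ge_zero[of x] z] by (simp add: algebra_simps)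
    then have le: "(1 + r * norm y) / (1 + norm x) \<le> 1 + z"
      by (simp add: divide_le_eq add_pos_nonneg mult.commute)
    have pos: "0 < 1 + r * norm y" "0 < 1 + norm x" using r by (auto intro: add_pos_nonneg)
    have "exp (- z\<^sup>2) \<le> exp (- z\<^sup>2 / 2)" by simp
    also have "\<dots> \<le> C * (1 + z) powr (- s)" by (rule C(2)[OF z])
    also have "(1 + z) powr (- s) \<le> ((1 + r * norm y) / (1 + norm x)) powr (- s)"
      using le pos s by (intro powr_mono2') auto
    also have "((1 + r * norm y) / (1 + norm x)) powr (- s) = (1 + norm x) powr s * (1 + r * norm y) powr (- s)"
      using pos by (simp add: powr_divide powr_minus field_simps)
    finally show "exp (- (norm (x - r *\<^sub>R y))\<^sup>2) \<le> C * ((1 + norm x) powr s * (1 + r * norm y) powr (- s))"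
      using C(1) by (simp add: z_def)
  qed
qed

lemma exp_minus_le_inverse_add_one:
  fixes z :: real
  assumes "0 \<le> z"
  shows "exp (- z) \<le> 1 / (1 + z)"
proof -
  have "1 + z \<le> exp z" by (rule exp_ge_add_one_self)
  then have "inverse (exp z) \<le> inverse (1 + z)" using assms by (intro le_imp_inverse_le) auto
  then show ?thesis by (simp add: exp_minus inverse_eq_divide)
qed

text \<open>
  For \<open>u \<le> 1 / 8\<close> the number \<open>r\<close> is close to \<open>1\<close>, so \<open>\<bar>x - r y\<bar> \<ge> \<bar>y\<bar> / 3\<close> and the Gaussian is at most
  \<open>exp (- \<bar>y\<bar>\<^sup>2 / (36 * u))\<close>. This beats every power of \<open>u\<close> and of \<open>1 / \<bar>y\<bar>\<close>.
\<close>

lemma reduced_kernel_small_time_far: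
  assumes m: "- real CARD('n) \<le> m" and \<nu>: "0 < \<nu>"
  obtains C where "0 \<le> C" "\<And>u (x :: real ^ 'n) y. 0 < u \<Longrightarrow> u \<le> 1/8 \<Longrightarrow> 3 * max (norm x) 1 < norm y \<Longrightarrow>
    u powr (- 1 - \<nu>) * reduced_kernel m u x y \<le> C * decay ((m + real CARD('n)) / 2) \<nu> (norm y)"
proof -
  let ?d = "real CARD('n)"
  define \<kappa> where "\<kappa> = (m + ?d) / 2"
  have \<kappa>: "0 \<le> \<kappa>" using m by (simp add: \<kappa>_def)
  define T where "T = \<kappa> + 1 + \<nu>"
  \<comment> \<open>\<open>T\<close> is the decay in \<open>\<bar>y\<bar>\<close> to be reached, and \<open>1 + \<nu> + d / 2\<close> the negative power of \<open>u\<close>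
    to be compensated.\<close>
  define S where "S = (1 + \<nu> + ?d / 2) + T"
  have TS: "0 \<le> T" "0 \<le> S" "T \<le> 2 * S" using \<kappa> \<nu> by (auto simp: T_def S_def)
  obtain C0 where C0: "0 < C0" "\<And>z. 0 \<le> z \<Longrightarrow> exp (- z) \<le> C0 * (1 + z) powr (- S)"
    using exp_minus_le_polynomial_decay[OF TS(2)] by blast
  show ?thesis
  proof (rule that[of "C0 * 36 powr S * 2 powr T"])
    show "0 \<le> C0 * 36 powr S * 2 powr T" using C0 by simp
    fix u :: real and x y :: "real ^ 'n"
    assume u: "0 < u" "u \<le> 1/8" and y: "3 * max (norm x) 1 < norm y"
    define Y where "Y = norm y"
    define r where "r = exp (- 2 * u)"
    define E where "E = 1 - exp (- 4 * u)"
    have Y: "1 \<le> Y" "norm x \<le> Y / 3" using y by (auto simp: Y_def)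
    have r: "3/4 \<le> r" using exp_ge_add_one_self[of "- 2 * u"] u by (simp add: r_def)
    have E4: "E \<le> 4 * u" using exp_ge_add_one_self[of "- 4 * u"] by (simp add: E_def)
    have "1 / (1 + 4 * u) \<le> 1 - u"
    proof -
      have "1 \<le> (1 - u) * (1 + 4 * u)" using mult_mono[of "4 * u" 3 u u] u by (simp add: algebra_simps)
      then show ?thesis using u by (subst pos_divide_le_eq) auto
    qed
    then have uE: "u \<le> E" using exp_minus_le_inverse_add_one[of "4 * u"] u by (simp add: E_def)
    have E0: "0 < E" using uE u by simp
    have "r * Y - norm x \<le> norm (x - r *\<^sub>R y)"
      using norm_triangle_ineq2[of "r *\<^sub>R y" x] r by (simp add: Y_def norm_minus_commute)
    moreover have "3/4 * Y \<le> r * Y" using r Y by (intro mult_right_mono) auto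
    ultimately have "Y / 3 \<le> norm (x - r *\<^sub>R y)" using Y by linarith
    then have "(Y / 3)\<^sup>2 \<le> (norm (x - r *\<^sub>R y))\<^sup>2" using Y by (intro power_mono) auto
    then have "(Y / 3)\<^sup>2 / (4 * u) \<le> (norm (x - r *\<^sub>R y))\<^sup>2 / E"
      using E4 E0 by (intro frac_le) auto
    moreover define z where "z = Y\<^sup>2 / (36 * u)"
    have z: "0 < z" using Y u by (auto simp: z_def)
    moreover have "(Y / 3)\<^sup>2 / (4 * u) = z" by (simp add: z_def power_divide)
    ultimately have "exp (- (norm (x - r *\<^sub>R y))\<^sup>2 / E) \<le> exp (- z)" by simp
    also have "\<dots> \<le> C0 * (1 + z) powr (- S)" using z by (intro C0) auto
    also have "(1 + z) powr (- S) \<le> z powr (- S)" using z TS by (intro powr_mono2') auto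
    also have "z powr (- S) = 36 powr S * u powr S * Y powr (- (2 * S))"
    proof -
      have "z = Y powr 2 / (36 * u)" using Y by (simp add: z_def)
      then have "z powr (- S) = (Y powr 2) powr (- S) / (36 * u) powr (- S)" using u by (simp add: powr_divide)
      also have "(36 * u) powr (- S) = inverse (36 powr S * u powr S)"
        using u by (simp add: powr_minus powr_mult)
      finally show ?thesis by (simp only: powr_powr divide_inverse inverse_inverse_eq) simp
    qed
    finally have e: "exp (- (norm (x - r *\<^sub>R y))\<^sup>2 / E) \<le> C0 * (36 powr S * u powr S * Y powr (- (2 * S)))"
      using C0 by simp
    have "u \<le> pi * E"
    proof -
      have "1 * E \<le> pi * E" using E0 pi_gt3 by (intro mult_right_mono) auto
      then show ?thesis using uE by simp
    qed
    then have p: "(pi * E) powr (- ?d / 2) \<le> u powr (- ?d / 2)" using u by (intro powr_mono2') auto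
    have "reduced_kernel m u x y \<le> (pi * E) powr (- ?d / 2) * exp (- (norm (x - r *\<^sub>R y))\<^sup>2 / E)"
      using reduced_kernel_le_gaussian[OF u(1) m, of x y] by (simp only: E_def r_def)
    also have "\<dots> \<le> u powr (- ?d / 2) * (C0 * (36 powr S * u powr S * Y powr (- (2 * S))))"
      using p e by (intro mult_mono) auto
    finally have "u powr (- 1 - \<nu>) * reduced_kernel m u x y
       \<le> u powr (- 1 - \<nu>) * (u powr (- ?d / 2) * (C0 * (36 powr S * u powr S * Y powr (- (2 * S)))))"
      by (intro mult_left_mono) auto
    also have "\<dots> = C0 * 36 powr S * (u powr (- 1 - \<nu>) * u powr (- ?d / 2) * u powr S) * Y powr (- (2 * S))"
      by (simp only: mult_ac)
    also have "u powr (- 1 - \<nu>) * u powr (- ?d / 2) * u powr S = u powr T"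
      by (simp add: powr_add[symmetric] S_def)
    also have "C0 * 36 powr S * u powr T * Y powr (- (2 * S)) \<le> C0 * 36 powr S * 1 * Y powr (- T)"
    proof -
      have "u powr T \<le> 1" using u TS powr_mono2[of T u 1] by simp
      moreover have "Y powr (- (2 * S)) \<le> Y powr (- T)" using Y TS by (intro powr_mono) auto
      ultimately show ?thesis using C0 by (intro mult_mono) auto
    qed
    also have "Y powr (- T) \<le> ((1 + Y) / 2) powr (- T)" using Y TS by (intro powr_mono2') auto
    also have "((1 + Y) / 2) powr (- T) = 2 powr T * (1 + Y) powr (- T)"
      using Y by (simp add: powr_divide powr_minus field_simps)
    also have "(1 + Y) powr (- T) \<le> decay \<kappa> \<nu> Y"
      unfolding T_def using Y \<kappa> \<nu> by (intro decay_ge) auto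
    finally show "u powr (- 1 - \<nu>) * reduced_kernel m u x y
       \<le> C0 * 36 powr S * 2 powr T * decay ((m + real CARD('n)) / 2) \<nu> (norm y)"
      using C0 by (simp add: Y_def \<kappa>_def mult.assoc)
  qed
qed

text \<open>
  The constant may depend on \<open>u\<close> and \<open>x\<close>: this bound only serves to show that the integral defining
  \<^const>\<open>heat\<close> converges.
\<close>

lemma reduced_kernel_fixed_time:
  fixes x :: "real ^ 'n"
  assumes m: "- real CARD('n) \<le> m" and \<nu>: "0 < \<nu>" and u: "0 < u"
  obtains C where "0 \<le> C" "\<And>y. reduced_kernel m u x y \<le> C * decay ((m + real CARD('n)) / 2) \<nu> (norm y)"
proof -
  let ?d = "real CARD('n)"
  define \<kappa> where "\<kappa> = (m + ?d) / 2"
  have \<kappa>: "0 \<le> \<kappa>" using m by (simp add: \<kappa>_def)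
  define T where "T = \<kappa> + 1 + \<nu>"
  have T: "0 \<le> T" using \<kappa> \<nu> by (simp add: T_def)
  obtain C0 where C0: "0 < C0" "\<And>(x::real ^ 'n) y r. 0 \<le> r \<Longrightarrow>
    exp (- (norm (x - r *\<^sub>R y))\<^sup>2) \<le> C0 * ((1 + norm x) powr T * (1 + r * norm y) powr (- T))"
    using gaussian_le_peetre_weight[OF T, where 'a="real ^ 'n"] by blast
  define r where "r = exp (- 2 * u)"
  define E where "E = 1 - exp (- 4 * u)"
  have r: "0 < r" "r < 1" using u by (auto simp: r_def)
  have E: "0 < E" "E \<le> 1" using u by (auto simp: E_def)
  let ?C = "(pi * E) powr (- ?d / 2) * C0 * (1 + norm x) powr T * r powr (- T)"
  show ?thesis
  proof (rule that[of ?C])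
    show "0 \<le> ?C" using C0 by simp
    fix y
    have "- (norm (x - r *\<^sub>R y))\<^sup>2 / E \<le> - (norm (x - r *\<^sub>R y))\<^sup>2"
      using E by (simp add: le_divide_eq mult_left_le)
    then have "exp (- (norm (x - r *\<^sub>R y))\<^sup>2 / E) \<le> exp (- (norm (x - r *\<^sub>R y))\<^sup>2)" by simp
    also have "\<dots> \<le> C0 * ((1 + norm x) powr T * (1 + r * norm y) powr (- T))" using r by (intro C0) auto
    also have "(1 + r * norm y) powr (- T) \<le> (r * (1 + norm y)) powr (- T)"
      using r T by (intro powr_mono2') (auto simp: algebra_simps intro!: mult_pos_pos add_pos_nonneg)
    also have "(r * (1 + norm y)) powr (- T) = r powr (- T) * (1 + norm y) powr (- T)"
      using r by (intro powr_mult)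
    also have "(1 + norm y) powr (- T) \<le> decay \<kappa> \<nu> (norm y)"
      unfolding T_def using \<kappa> \<nu> by (intro decay_ge) auto
    finally have e: "exp (- (norm (x - r *\<^sub>R y))\<^sup>2 / E) \<le> C0 * ((1 + norm x) powr T * (r powr (- T) * decay \<kappa> \<nu> (norm y)))"
      using C0 by (simp add: mult_left_mono)
    have "reduced_kernel m u x y \<le> (pi * E) powr (- ?d / 2) * exp (- (norm (x - r *\<^sub>R y))\<^sup>2 / E)"
      using reduced_kernel_le_gaussian[OF u m, of x y] by (simp only: E_def r_def)
    also have "\<dots> \<le> (pi * E) powr (- ?d / 2) * (C0 * ((1 + norm x) powr T * (r powr (- T) * decay \<kappa> \<nu> (norm y))))"
      by (intro mult_left_mono e) auto
    finally show "reduced_kernel m u x y \<le> ?C * decay ((m + real CARD('n)) / 2) \<nu> (norm y)"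
      by (simp only: \<kappa>_def mult.assoc)
  qed
qed

text \<open>
  For \<open>u \<ge> 1 / 8\<close> the quantity \<open>\<pi> * (1 - r\<^sup>2)\<close> is at least \<open>1\<close>, so the normalising factor can be dropped,
  and Peetre's inequality reduces the claim to the scalar integral.
\<close>

lemma reduced_kernel_large_time:
  assumes m: "- real CARD('n) \<le> m" and \<nu>: "0 < \<nu>"
  obtains C where "0 \<le> C" "\<And>x y :: real ^ 'n.
    (\<integral>\<^sup>+ u. ennreal (u powr (- 1 - \<nu>) * reduced_kernel m u x y) * indicator {1/8..} u \<partial>lborel)
    \<le> ennreal (C * (1 + norm x) powr (m + real CARD('n) + 2 * \<nu> + 2) * decay ((m + real CARD('n)) / 2) \<nu> (norm y))"
proof -
  let ?d = "real CARD('n)"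
  define \<kappa> where "\<kappa> = (m + ?d) / 2"
  have \<kappa>: "0 \<le> \<kappa>" using m by (simp add: \<kappa>_def)
  define B where "B = 2 * \<kappa> + 2 * \<nu> + 2"
  have B: "0 \<le> B" "B = m + ?d + 2 * \<nu> + 2" using \<kappa> \<nu> by (auto simp: B_def \<kappa>_def)
  obtain C0 where C0: "0 < C0" "\<And>(x::real ^ 'n) y r. 0 \<le> r \<Longrightarrow>
    exp (- (norm (x - r *\<^sub>R y))\<^sup>2) \<le> C0 * ((1 + norm x) powr B * (1 + r * norm y) powr (- B))"
    using gaussian_le_peetre_weight[OF B(1), where 'a="real ^ 'n"] by blast
  obtain C1 where C1: "0 \<le> C1" "\<And>\<rho>. 0 \<le> \<rho> \<Longrightarrow>
    (\<integral>\<^sup>+ u. ennreal (u powr (- 1 - \<nu>) * (exp (- 2 * u) powr \<kappa> * (1 + exp (- 2 * u) * \<rho>) powr (- B)))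
        * indicator {1/8..} u \<partial>lborel) \<le> ennreal (C1 * decay \<kappa> \<nu> \<rho>)"
    using large_time_integral_le_decay[OF \<kappa> \<nu>] unfolding B_def by blast
  show ?thesis
  proof (rule that[of "C0 * C1"])
    show "0 \<le> C0 * C1" using C0 C1 by simp
    fix x y :: "real ^ 'n"
    let ?X = "C0 * (1 + norm x) powr B"
    let ?g = "\<lambda>u. u powr (- 1 - \<nu>) * (exp (- 2 * u) powr \<kappa> * (1 + exp (- 2 * u) * norm y) powr (- B))"
    have k: "u powr (- 1 - \<nu>) * reduced_kernel m u x y \<le> ?X * ?g u" if u: "1/8 \<le> u" for u
    proof -
      define r where "r = exp (- 2 * u)"
      define E where "E = 1 - exp (- 4 * u)"
      have r: "0 < r" by (simp add: r_def)
      have "1 / (1 + 4 * u) \<le> 2/3" using u by (simp add: divide_le_eq)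
      then have E: "1/3 \<le> E" "E \<le> 1" using exp_minus_le_inverse_add_one[of "4 * u"] u by (auto simp: E_def)
      have "1 \<le> pi * E" using mult_mono[of 3 pi "1/3" E] pi_gt3 E by simp
      then have p: "(pi * E) powr (- ?d / 2) \<le> 1" using powr_mono2'[of "- ?d / 2" 1 "pi * E"] by simp
      have "- (norm (x - r *\<^sub>R y))\<^sup>2 / E \<le> - (norm (x - r *\<^sub>R y))\<^sup>2"
        using E by (simp add: le_divide_eq mult_left_le)
      then have "exp (- (norm (x - r *\<^sub>R y))\<^sup>2 / E) \<le> exp (- (norm (x - r *\<^sub>R y))\<^sup>2)" by simp
      also have "\<dots> \<le> C0 * ((1 + norm x) powr B * (1 + r * norm y) powr (- B))" using r by (intro C0) auto
      finally have "(pi * E) powr (- ?d / 2) * exp (- (norm (x - r *\<^sub>R y))\<^sup>2 / E)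
        \<le> 1 * (C0 * ((1 + norm x) powr B * (1 + r * norm y) powr (- B)))"
        using p by (intro mult_mono) auto
      then have "r powr \<kappa> * ((pi * E) powr (- ?d / 2) * exp (- (norm (x - r *\<^sub>R y))\<^sup>2 / E))
        \<le> r powr \<kappa> * (C0 * ((1 + norm x) powr B * (1 + r * norm y) powr (- B)))"
        by (intro mult_left_mono) auto
      moreover have "reduced_kernel m u x y = r powr \<kappa> * ((pi * E) powr (- ?d / 2) * exp (- (norm (x - r *\<^sub>R y))\<^sup>2 / E))"
        by (simp only: reduced_kernel_def r_def E_def \<kappa>_def mult.assoc)
      ultimately have "u powr (- 1 - \<nu>) * reduced_kernel m u x y
         \<le> u powr (- 1 - \<nu>) * (r powr \<kappa> * (C0 * ((1 + norm x) powr B * (1 + r * norm y) powr (- B))))"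
        by (intro mult_left_mono) auto
      then show ?thesis by (simp only: r_def mult_ac)
    qed
    have "(\<integral>\<^sup>+ u. ennreal (u powr (- 1 - \<nu>) * reduced_kernel m u x y) * indicator {1/8..} u \<partial>lborel)
      \<le> (\<integral>\<^sup>+ u. ennreal ?X * (ennreal (?g u) * indicator {1/8..} u) \<partial>lborel)"
    proof (intro nn_integral_mono)
      fix u
      show "ennreal (u powr (- 1 - \<nu>) * reduced_kernel m u x y) * indicator {1/8..} u \<le> ennreal ?X * (ennreal (?g u) * indicator {1/8..} u)"
      proof (cases "1/8 \<le> u")
        case True
        have "ennreal (u powr (- 1 - \<nu>) * reduced_kernel m u x y) \<le> ennreal (?X * ?g u)"
          by (rule ennreal_leI[OF k[OF True]])
        also have "\<dots> = ennreal ?X * ennreal (?g u)"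
          using C0(1) by (intro ennreal_mult) auto
        finally show ?thesis using True by simp
      qed simp
    qed
    also have "\<dots> = ennreal ?X * (\<integral>\<^sup>+ u. ennreal (?g u) * indicator {1/8..} u \<partial>lborel)"
      by (rule nn_integral_cmult) simp
    also have "\<dots> \<le> ennreal ?X * ennreal (C1 * decay \<kappa> \<nu> (norm y))"
      by (intro mult_left_mono C1) auto
    also have "\<dots> = ennreal (?X * (C1 * decay \<kappa> \<nu> (norm y)))"
      using C0(1) C1(1) decay_pos[of "norm y" \<kappa> \<nu>] by (intro ennreal_mult[symmetric]) auto
    also have "?X * (C1 * decay \<kappa> \<nu> (norm y)) = C0 * C1 * (1 + norm x) powr B * decay \<kappa> \<nu> (norm y)"
      by (simp only: mult_ac)
    finally show "(\<integral>\<^sup>+ u. ennreal (u powr (- 1 - \<nu>) * reduced_kernel m u x y) * indicator {1/8..} u \<partial>lborel)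
      \<le> ennreal (C0 * C1 * (1 + norm x) powr (m + real CARD('n) + 2 * \<nu> + 2) * decay ((m + real CARD('n)) / 2) \<nu> (norm y))"
      unfolding B(2) \<kappa>_def .
  qed
qed

text \<open>
  The mass is a multiple of \<open>Gamma \<nu>\<close>, but a bound uniform in \<open>t\<close> suffices: for \<open>u \<le> t\<^sup>2\<close> the exponential
  is at most a multiple of \<open>(u / t\<^sup>2) powr (1 + \<nu>)\<close>, and for \<open>u \<ge> t\<^sup>2\<close> it is at most \<open>1\<close>.
\<close>

lemma subordination_mass_bounded:
  fixes \<nu> :: real
  assumes \<nu>: "0 < \<nu>"
  obtains C where "0 \<le> C" "\<And>t. 0 < t \<Longrightarrow>
    (\<integral>\<^sup>+ u. ennreal (t powr (2 * \<nu>) * exp (- t\<^sup>2 / (4 * u)) * u powr (- 1 - \<nu>)) * indicator {0<..} u \<partial>lborel) \<le> ennreal C"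
proof -
  obtain C0 where C0: "0 < C0" "\<And>z. 0 \<le> z \<Longrightarrow> exp (- z) \<le> C0 * (1 + z) powr (- (1 + \<nu>))"
    using exp_minus_le_polynomial_decay[of "1 + \<nu>"] \<nu> by auto
  let ?C = "C0 * 4 powr (1 + \<nu>)"
  show ?thesis
  proof (rule that[of "?C + 1 / \<nu>"])
    show "0 \<le> ?C + 1 / \<nu>" using C0 \<nu> by simp
    fix t :: real assume t: "0 < t"
    let ?f = "\<lambda>u. t powr (2 * \<nu>) * exp (- t\<^sup>2 / (4 * u)) * u powr (- 1 - \<nu>)"
    have f1: "?f u \<le> ?C * t powr (- 2)" if u: "0 < u" for u
    proof -
      define z where "z = t\<^sup>2 / (4 * u)"
      have z: "0 < z" using t u by (simp add: z_def)
      have "exp (- t\<^sup>2 / (4 * u)) = exp (- z)" by (simp add: z_def)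
      also have "\<dots> \<le> C0 * (1 + z) powr (- (1 + \<nu>))" using z by (intro C0) auto
      also have "(1 + z) powr (- (1 + \<nu>)) \<le> z powr (- (1 + \<nu>))" using z \<nu> by (intro powr_mono2') auto
      also have "z powr (- (1 + \<nu>)) = 4 powr (1 + \<nu>) * u powr (1 + \<nu>) * t powr (- 2 * (1 + \<nu>))"
      proof -
        have "z = t powr 2 / (4 * u)" using t by (simp add: z_def)
        then have "z powr (- (1 + \<nu>)) = (t powr 2) powr (- (1 + \<nu>)) / (4 * u) powr (- (1 + \<nu>))"
          using u by (simp only: powr_divide)
        also have "(4 * u) powr (- (1 + \<nu>)) = inverse (4 powr (1 + \<nu>) * u powr (1 + \<nu>))"
          using powr_minus[of "4 * u" "1 + \<nu>"] powr_mult[of 4 u "1 + \<nu>"] by simp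
        finally show ?thesis by (simp only: powr_powr divide_inverse inverse_inverse_eq) simp
      qed
      finally have "exp (- t\<^sup>2 / (4 * u)) \<le> C0 * (4 powr (1 + \<nu>) * u powr (1 + \<nu>) * t powr (- 2 * (1 + \<nu>)))"
        using C0 by simp
      then have "?f u \<le> t powr (2 * \<nu>) * (C0 * (4 powr (1 + \<nu>) * u powr (1 + \<nu>) * t powr (- 2 * (1 + \<nu>)))) * u powr (- 1 - \<nu>)"
        by (intro mult_right_mono mult_left_mono) auto
      also have "\<dots> = ?C * (t powr (2 * \<nu>) * t powr (- 2 * (1 + \<nu>))) * (u powr (1 + \<nu>) * u powr (- 1 - \<nu>))"
        by (simp only: mult_ac)
      also have "\<dots> = ?C * t powr (- 2)" using u by (simp add: powr_add[symmetric])
      finally show ?thesis .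
    qed
    have f2: "?f u \<le> t powr (2 * \<nu>) * u powr (- 1 - \<nu>)" if u: "0 < u" for u
    proof -
      have "exp (- t\<^sup>2 / (4 * u)) \<le> 1" using u by simp
      then have "t powr (2 * \<nu>) * exp (- t\<^sup>2 / (4 * u)) \<le> t powr (2 * \<nu>) * 1" by (intro mult_left_mono) auto
      then show ?thesis by (intro mult_right_mono) auto
    qed
    have "(\<integral>\<^sup>+ u. ennreal (?f u) * indicator {0<..} u \<partial>lborel)
      \<le> (\<integral>\<^sup>+ u. ennreal (?C * t powr (- 2)) * indicator {0..t\<^sup>2} u + ennreal (t powr (2 * \<nu>)) * (ennreal (u powr (- 1 - \<nu>)) * indicator {t\<^sup>2..} u) \<partial>lborel)"
    proof (intro nn_integral_mono)
      fix u
      show "ennreal (?f u) * indicator {0<..} u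
        \<le> ennreal (?C * t powr (- 2)) * indicator {0..t\<^sup>2} u + ennreal (t powr (2 * \<nu>)) * (ennreal (u powr (- 1 - \<nu>)) * indicator {t\<^sup>2..} u)"
      proof -
        consider "u \<le> 0" | "0 < u" "u \<le> t\<^sup>2" | "t\<^sup>2 \<le> u" by linarith
        then show ?thesis
        proof cases
          case 2
          have "ennreal (?f u) \<le> ennreal (?C * t powr (- 2))" by (rule ennreal_leI[OF f1[OF 2(1)]])
          then show ?thesis using 2 by (simp add: add_increasing2)
        next
          case 3
          then have u: "0 < u" using t by (meson less_le_trans zero_less_power)
          have "ennreal (?f u) \<le> ennreal (t powr (2 * \<nu>) * u powr (- 1 - \<nu>))" by (rule ennreal_leI[OF f2[OF u]])
          also have "\<dots> = ennreal (t powr (2 * \<nu>)) * ennreal (u powr (- 1 - \<nu>))" by (rule ennreal_mult) auto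
          finally show ?thesis using 3 u by (simp add: add_increasing)
        qed simp
      qed
    qed
    also have "\<dots> = ennreal (?C * t powr (- 2)) * emeasure lborel {0..t\<^sup>2}
        + ennreal (t powr (2 * \<nu>)) * (\<integral>\<^sup>+ u. ennreal (u powr (- 1 - \<nu>)) * indicator {t\<^sup>2..} u \<partial>lborel)"
      by (subst nn_integral_add, simp, simp, subst nn_integral_cmult_indicator, simp, subst nn_integral_cmult, simp, rule refl)
    also have "\<dots> = ennreal (?C * t powr (- 2)) * ennreal (t\<^sup>2) + ennreal (t powr (2 * \<nu>)) * ennreal ((t\<^sup>2) powr (- \<nu>) / \<nu>)"
      using t \<nu> by (subst nn_integral_powr_tail) auto
    also have "\<dots> = ennreal (?C * t powr (- 2) * t\<^sup>2) + ennreal (t powr (2 * \<nu>) * ((t\<^sup>2) powr (- \<nu>) / \<nu>))"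
      using C0(1) \<nu> by (intro arg_cong2[where f="(+)"] ennreal_mult[symmetric]) auto
    also have "?C * t powr (- 2) * t\<^sup>2 = ?C"
    proof -
      have "t powr (- 2) * t powr 2 = 1" using t by (subst powr_add[symmetric]) simp
      then show ?thesis using t by simp
    qed
    also have "t powr (2 * \<nu>) * ((t\<^sup>2) powr (- \<nu>) / \<nu>) = 1 / \<nu>"
    proof -
      have "t\<^sup>2 = t powr 2" using t by simp
      then have "(t\<^sup>2) powr (- \<nu>) = t powr (- (2 * \<nu>))" by (simp only: powr_powr) simp
      then have "t powr (2 * \<nu>) * (t\<^sup>2) powr (- \<nu>) = 1" using t by (simp add: powr_add[symmetric])
      then show ?thesis by simp
    qed
    also have "ennreal ?C + ennreal (1 / \<nu>) = ennreal (?C + 1 / \<nu>)"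
      using C0(1) \<nu> by (intro ennreal_plus[symmetric]) auto
    finally show "(\<integral>\<^sup>+ u. ennreal (?f u) * indicator {0<..} u \<partial>lborel) \<le> ennreal (?C + 1 / \<nu>)" .
  qed
qed

section \<open>Subordination\<close>

text \<open>
  The density in \<open>u\<close> that averages the heat semigroup into \<^const>\<open>Poisson\<close>, without the constant
  \<open>4 powr \<nu> * Gamma \<nu>\<close>.
\<close>

definition subordination_weight :: "real \<Rightarrow> real \<Rightarrow> real \<Rightarrow> real" where
  "subordination_weight \<nu> t u = t powr (2 * \<nu>) * exp (- t\<^sup>2 / (4 * u)) * u powr (- 1 - \<nu>)"

lemma subordination_weight_nonneg: "0 \<le> subordination_weight \<nu> t u"
  by (simp add: subordination_weight_def)

lemma borel_measurable_subordination_weight [measurable (raw)]: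
  assumes [measurable]: "f \<in> borel_measurable M" "g \<in> borel_measurable M"
  shows "(\<lambda>w. subordination_weight \<nu> (f w) (g w)) \<in> borel_measurable M"
  unfolding subordination_weight_def by measurable

lemma subordination_weight_le:
  assumes "0 < t" "t < a" "0 < \<nu>" "0 < u"
  shows "subordination_weight \<nu> t u \<le> a powr (2 * \<nu>) * u powr (- 1 - \<nu>)"
proof -
  have "t powr (2 * \<nu>) * exp (- t\<^sup>2 / (4 * u)) \<le> a powr (2 * \<nu>) * 1"
    using assms by (intro mult_mono powr_mono2) auto
  then show ?thesis unfolding subordination_weight_def by (simp add: mult_right_mono)
qed

text \<open>
  Far from \<open>x\<close> the kernel itself vanishes fast enough as \<open>u\<close> tends to \<open>0\<close>, so the subordination weight may be
  replaced by its upper bound \<open>a powr (2 * \<nu>) * u powr (- 1 - \<nu>)\<close>.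
\<close>

lemma subordinated_far_kernel_bound:
  assumes m: "- real CARD('n) \<le> m" and \<nu>: "0 < \<nu>"
  obtains C where "0 \<le> C" "\<And>t (x :: real ^ 'n) y. 0 < t \<Longrightarrow> t < a \<Longrightarrow> 3 * max (norm x) 1 < norm y \<Longrightarrow>
    (\<integral>\<^sup>+ u. ennreal (subordination_weight \<nu> t u * reduced_kernel m u x y) * indicator {0<..} u \<partial>lborel)
    \<le> ennreal (C * (1 + norm x) powr (m + real CARD('n) + 2 * \<nu> + 2) * decay ((m + real CARD('n)) / 2) \<nu> (norm y))"
proof -
  let ?\<kappa> = "(m + real CARD('n)) / 2" let ?B = "m + real CARD('n) + 2 * \<nu> + 2"
  obtain C2 where C2: "0 \<le> C2" "\<And>u (x :: real ^ 'n) y. 0 < u \<Longrightarrow> u \<le> 1/8 \<Longrightarrow> 3 * max (norm x) 1 < norm y \<Longrightarrow>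
    u powr (- 1 - \<nu>) * reduced_kernel m u x y \<le> C2 * decay ?\<kappa> \<nu> (norm y)"
    using reduced_kernel_small_time_far[OF m \<nu>] by blast
  obtain C3 where C3: "0 \<le> C3" "\<And>x y :: real ^ 'n.
    (\<integral>\<^sup>+ u. ennreal (u powr (- 1 - \<nu>) * reduced_kernel m u x y) * indicator {1/8..} u \<partial>lborel)
    \<le> ennreal (C3 * (1 + norm x) powr ?B * decay ?\<kappa> \<nu> (norm y))"
    using reduced_kernel_large_time[OF m \<nu>] by blast
  let ?A = "a powr (2 * \<nu>)"
  show ?thesis
  proof (rule that[of "?A * (C2 + C3)"])
    show "0 \<le> ?A * (C2 + C3)" using C2 C3 by simp
    fix t and x y :: "real ^ 'n"
    assume t: "0 < t" "t < a" and y: "3 * max (norm x) 1 < norm y"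
    let ?D = "decay ?\<kappa> \<nu> (norm y)" let ?k = "\<lambda>u. u powr (- 1 - \<nu>) * reduced_kernel m u x y"
    have D: "0 < ?D" by (simp add: decay_pos)
    have le: "subordination_weight \<nu> t u * reduced_kernel m u x y \<le> ?A * ?k u" if "0 < u" for u
      using mult_right_mono[OF subordination_weight_le[OF t \<nu> that] reduced_kernel_nonneg[of m u x y]]
      by (simp add: mult.assoc)
    have "(\<integral>\<^sup>+ u. ennreal (subordination_weight \<nu> t u * reduced_kernel m u x y) * indicator {0<..} u \<partial>lborel)
      \<le> (\<integral>\<^sup>+ u. ennreal (?A * (C2 * ?D)) * indicator {0..1/8} u + ennreal ?A * (ennreal (?k u) * indicator {1/8..} u) \<partial>lborel)"
    proof (intro nn_integral_mono)
      fix u :: real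
      consider "u \<le> 0" | "0 < u" "u \<le> 1/8" | "1/8 \<le> u" by linarith
      then show "ennreal (subordination_weight \<nu> t u * reduced_kernel m u x y) * indicator {0<..} u
        \<le> ennreal (?A * (C2 * ?D)) * indicator {0..1/8} u + ennreal ?A * (ennreal (?k u) * indicator {1/8..} u)"
      proof cases
        case 2
        have "?A * ?k u \<le> ?A * (C2 * ?D)" by (intro mult_left_mono C2 2 y) auto
        with le[OF 2(1)] have "ennreal (subordination_weight \<nu> t u * reduced_kernel m u x y) \<le> ennreal (?A * (C2 * ?D))"
          by (intro ennreal_leI) linarith
        then show ?thesis using 2 by (simp add: add_increasing2)
      next
        case 3
        then have u: "0 < u" by simp
        have "ennreal (subordination_weight \<nu> t u * reduced_kernel m u x y) \<le> ennreal (?A * ?k u)"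
          by (rule ennreal_leI[OF le[OF u]])
        also have "\<dots> = ennreal ?A * ennreal (?k u)"
          by (rule ennreal_mult) (simp_all add: reduced_kernel_nonneg)
        finally show ?thesis using 3 u by (simp add: add_increasing)
      qed simp
    qed
    also have "\<dots> = ennreal (?A * (C2 * ?D)) * emeasure lborel {0..1/8::real}
        + ennreal ?A * (\<integral>\<^sup>+ u. ennreal (?k u) * indicator {1/8..} u \<partial>lborel)"
      by (subst nn_integral_add, simp, simp, subst nn_integral_cmult_indicator, simp, subst nn_integral_cmult, simp, rule refl)
    also have "\<dots> \<le> ennreal (?A * (C2 * ?D)) * 1 + ennreal ?A * ennreal (C3 * (1 + norm x) powr ?B * ?D)"
      by (intro add_mono mult_left_mono C3) auto
    also have "\<dots> = ennreal (?A * (C2 * ?D) + ?A * (C3 * (1 + norm x) powr ?B * ?D))"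
      using C2(1) C3(1) D by (subst ennreal_mult[symmetric], simp, simp, subst ennreal_plus) auto
    also have "\<dots> \<le> ennreal (?A * (C2 + C3) * (1 + norm x) powr ?B * ?D)"
    proof (rule ennreal_leI)
      have "1 \<le> (1 + norm x) powr ?B" using m \<nu> by (intro ge_one_powr_ge_zero) auto
      then have "?A * (C2 * ?D) * 1 \<le> ?A * (C2 * ?D) * (1 + norm x) powr ?B"
        using C2(1) D by (intro mult_left_mono) auto
      then show "?A * (C2 * ?D) + ?A * (C3 * (1 + norm x) powr ?B * ?D) \<le> ?A * (C2 + C3) * (1 + norm x) powr ?B * ?D"
        by (simp add: algebra_simps)
    qed
    finally show "(\<integral>\<^sup>+ u. ennreal (subordination_weight \<nu> t u * reduced_kernel m u x y) * indicator {0<..} u \<partial>lborel)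
      \<le> ennreal (?A * (C2 + C3) * (1 + norm x) powr ?B * ?D)" .
  qed
qed

text \<open>
  The integral over \<open>y\<close> is split at \<open>\<bar>y\<bar> = 3 * max \<bar>x\<bar> 1\<close>. The near part is bounded for each \<open>u\<close> and
  then averaged over \<open>u\<close>; in the far part the integrals are exchanged and the kernel is integrated over
  \<open>u\<close> first.
\<close>

theorem subordinated_kernel_bound:
  assumes m: "- real CARD('n) \<le> m" and \<nu>: "0 < \<nu>"
  obtains C where "0 \<le> C" "\<And>(F :: real ^ 'n \<Rightarrow> real) t x. F \<in> borel_measurable borel \<Longrightarrow> (\<And>y. 0 \<le> F y) \<Longrightarrow> 0 < t \<Longrightarrow> t < a \<Longrightarrow>
    (\<integral>\<^sup>+ u\<in>{0<..}. ennreal (subordination_weight \<nu> t u) *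
        (\<integral>\<^sup>+ y. ennreal (reduced_kernel m u x y) * ennreal (F y) \<partial>lborel) \<partial>lborel)
    \<le> ennreal (C * (1 + norm x) powr (m + 3 * real CARD('n) + 2 * \<nu> + 2)) *
      (loc_max (\<lambda>y. ennreal (F y)) x + (\<integral>\<^sup>+ y. ennreal (F y * decay ((m + real CARD('n)) / 2) \<nu> (norm y)) \<partial>lborel))"
proof -
  let ?d = "CARD('n)"
  let ?\<kappa> = "(m + real ?d) / 2" let ?B = "m + real ?d + 2 * \<nu> + 2" let ?A = "m + 3 * real ?d + 2 * \<nu> + 2"
  obtain C1 where C1: "0 \<le> C1" "\<forall>(F :: real ^ 'n \<Rightarrow> real) u x. F \<in> borel_measurable borel \<longrightarrow> (\<forall>y. 0 \<le> F y) \<longrightarrow> 0 < u \<longrightarrow>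
    (\<integral>\<^sup>+ y\<in>{y::real ^ 'n. norm y \<le> 3 * max (norm x) 1}. ennreal (reduced_kernel m u x y) * ennreal (F y) \<partial>lborel)
    \<le> ennreal (C1 * (1 + norm x) ^ (2 * ?d)) * loc_max (\<lambda>y. ennreal (F y)) x"
    using reduced_kernel_local_bound[OF m] by blast
  obtain C2 where C2: "0 \<le> C2" "\<And>t. 0 < t \<Longrightarrow>
    (\<integral>\<^sup>+ u. ennreal (t powr (2 * \<nu>) * exp (- t\<^sup>2 / (4 * u)) * u powr (- 1 - \<nu>)) * indicator {0<..} u \<partial>lborel) \<le> ennreal C2"
    using subordination_mass_bounded[OF \<nu>] by blast
  obtain C3 where C3: "0 \<le> C3" "\<And>t (x :: real ^ 'n) y. 0 < t \<Longrightarrow> t < a \<Longrightarrow> 3 * max (norm x) 1 < norm y \<Longrightarrow>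
    (\<integral>\<^sup>+ u. ennreal (subordination_weight \<nu> t u * reduced_kernel m u x y) * indicator {0<..} u \<partial>lborel)
    \<le> ennreal (C3 * (1 + norm x) powr ?B * decay ?\<kappa> \<nu> (norm y))"
    using subordinated_far_kernel_bound[OF m \<nu>, of a] by blast
  show ?thesis
  proof (rule that[of "C1 * C2 + C3"])
    show "0 \<le> C1 * C2 + C3" using C1(1) C2(1) C3(1) by simp
    fix F :: "real ^ 'n \<Rightarrow> real" and t :: real and x :: "real ^ 'n"
    assume F[measurable]: "F \<in> borel_measurable borel" and nn: "\<And>y. 0 \<le> F y" and t: "0 < t" "t < a"
    let ?N = "{y::real ^ 'n. norm y \<le> 3 * max (norm x) 1}"
    let ?M = "loc_max (\<lambda>y. ennreal (F y)) x"
    let ?D = "\<integral>\<^sup>+ y. ennreal (F y * decay ?\<kappa> \<nu> (norm y)) \<partial>lborel"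
    let ?P = "\<lambda>u. ennreal (subordination_weight \<nu> t u)"
    let ?K = "\<lambda>u y. ennreal (reduced_kernel m u x y) * ennreal (F y)"
    have "(\<integral>\<^sup>+ u\<in>{0<..}. ?P u * (\<integral>\<^sup>+ y. ?K u y \<partial>lborel) \<partial>lborel)
      = (\<integral>\<^sup>+ u. ?P u * indicator {0<..} u * (\<integral>\<^sup>+ y\<in>?N. ?K u y \<partial>lborel)
           + (\<integral>\<^sup>+ y. ?P u * indicator {0<..} u * (?K u y * indicator (- ?N) y) \<partial>lborel) \<partial>lborel)"
    proof (rule nn_integral_cong)
      fix u
      have "(\<integral>\<^sup>+ y. ?K u y \<partial>lborel) = (\<integral>\<^sup>+ y. ?K u y * indicator ?N y + ?K u y * indicator (- ?N) y \<partial>lborel)"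
        by (intro nn_integral_cong) (simp add: indicator_def)
      also have "\<dots> = (\<integral>\<^sup>+ y\<in>?N. ?K u y \<partial>lborel) + (\<integral>\<^sup>+ y. ?K u y * indicator (- ?N) y \<partial>lborel)"
        by (rule nn_integral_add) measurable
      finally have split: "(\<integral>\<^sup>+ y. ?K u y \<partial>lborel)
          = (\<integral>\<^sup>+ y\<in>?N. ?K u y \<partial>lborel) + (\<integral>\<^sup>+ y. ?K u y * indicator (- ?N) y \<partial>lborel)" .
      have far: "(\<integral>\<^sup>+ y. ?P u * indicator {0<..} u * (?K u y * indicator (- ?N) y) \<partial>lborel)
          = ?P u * indicator {0<..} u * (\<integral>\<^sup>+ y. ?K u y * indicator (- ?N) y \<partial>lborel)"
        by (rule nn_integral_cmult) measurable
      show "?P u * (\<integral>\<^sup>+ y. ?K u y \<partial>lborel) * indicator {0<..} u = ?P u * indicator {0<..} u * (\<integral>\<^sup>+ y\<in>?N. ?K u y \<partial>lborel)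
           + (\<integral>\<^sup>+ y. ?P u * indicator {0<..} u * (?K u y * indicator (- ?N) y) \<partial>lborel)"
        unfolding far split by (cases "0 < u") (simp_all add: distrib_left)
    qed
    also have "\<dots> = (\<integral>\<^sup>+ u. ?P u * indicator {0<..} u * (\<integral>\<^sup>+ y\<in>?N. ?K u y \<partial>lborel) \<partial>lborel)
       + (\<integral>\<^sup>+ u. \<integral>\<^sup>+ y. ?P u * indicator {0<..} u * (?K u y * indicator (- ?N) y) \<partial>lborel \<partial>lborel)"
      by (rule nn_integral_add) measurable
    finally have split: "(\<integral>\<^sup>+ u\<in>{0<..}. ?P u * (\<integral>\<^sup>+ y. ?K u y \<partial>lborel) \<partial>lborel)
      = (\<integral>\<^sup>+ u. ?P u * indicator {0<..} u * (\<integral>\<^sup>+ y\<in>?N. ?K u y \<partial>lborel) \<partial>lborel)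
       + (\<integral>\<^sup>+ u. \<integral>\<^sup>+ y. ?P u * indicator {0<..} u * (?K u y * indicator (- ?N) y) \<partial>lborel \<partial>lborel)" .
    have "(\<integral>\<^sup>+ u. ?P u * indicator {0<..} u * (\<integral>\<^sup>+ y\<in>?N. ?K u y \<partial>lborel) \<partial>lborel)
       \<le> (\<integral>\<^sup>+ u. ?P u * indicator {0<..} u * (ennreal (C1 * (1 + norm x) ^ (2 * ?d)) * ?M) \<partial>lborel)"
    proof (intro nn_integral_mono)
      fix u
      show "?P u * indicator {0<..} u * (\<integral>\<^sup>+ y\<in>?N. ?K u y \<partial>lborel) \<le> ?P u * indicator {0<..} u * (ennreal (C1 * (1 + norm x) ^ (2 * ?d)) * ?M)"
      proof (cases "0 < u")
        case True
        then have "(\<integral>\<^sup>+ y\<in>?N. ?K u y \<partial>lborel) \<le> ennreal (C1 * (1 + norm x) ^ (2 * ?d)) * ?M"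
          using C1(2) F nn by blast
        then show ?thesis by (intro mult_left_mono) auto
      qed simp
    qed
    also have "\<dots> = (\<integral>\<^sup>+ u. ?P u * indicator {0<..} u \<partial>lborel) * (ennreal (C1 * (1 + norm x) ^ (2 * ?d)) * ?M)"
      by (rule nn_integral_multc) measurable
    also have "\<dots> \<le> ennreal C2 * (ennreal (C1 * (1 + norm x) ^ (2 * ?d)) * ?M)"
    proof (rule mult_right_mono)
      show "(\<integral>\<^sup>+ u. ?P u * indicator {0<..} u \<partial>lborel) \<le> ennreal C2"
        unfolding subordination_weight_def by (rule C2(2)[OF t(1)])
    qed simp
    also have "\<dots> = ennreal (C1 * C2 * (1 + norm x) ^ (2 * ?d)) * ?M"
      using C1(1) C2(1)
      by (subst mult.assoc[symmetric], subst ennreal_mult[symmetric]) (simp, simp, simp only: mult_ac)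
    finally have near: "(\<integral>\<^sup>+ u. ?P u * indicator {0<..} u * (\<integral>\<^sup>+ y\<in>?N. ?K u y \<partial>lborel) \<partial>lborel)
      \<le> ennreal (C1 * C2 * (1 + norm x) ^ (2 * ?d)) * ?M" .
    have "(\<integral>\<^sup>+ u. \<integral>\<^sup>+ y. ?P u * indicator {0<..} u * (?K u y * indicator (- ?N) y) \<partial>lborel \<partial>lborel)
       = (\<integral>\<^sup>+ y. \<integral>\<^sup>+ u. ?P u * indicator {0<..} u * (?K u y * indicator (- ?N) y) \<partial>lborel \<partial>lborel)"
      by (rule lborel_pair.Fubini'[symmetric]) measurable
    also have "\<dots> \<le> (\<integral>\<^sup>+ y. ennreal (C3 * (1 + norm x) powr ?B) * ennreal (F y * decay ?\<kappa> \<nu> (norm y)) \<partial>lborel)"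
    proof (intro nn_integral_mono)
      fix y
      show "(\<integral>\<^sup>+ u. ?P u * indicator {0<..} u * (?K u y * indicator (- ?N) y) \<partial>lborel)
         \<le> ennreal (C3 * (1 + norm x) powr ?B) * ennreal (F y * decay ?\<kappa> \<nu> (norm y))"
      proof (cases "y \<in> ?N")
        case False
        have "(\<integral>\<^sup>+ u. ?P u * indicator {0<..} u * (?K u y * indicator (- ?N) y) \<partial>lborel)
          = (\<integral>\<^sup>+ u. ennreal (F y) * (ennreal (subordination_weight \<nu> t u * reduced_kernel m u x y) * indicator {0<..} u) \<partial>lborel)"
          using False by (intro nn_integral_cong)
            (simp add: ennreal_mult subordination_weight_nonneg reduced_kernel_nonneg mult_ac)
        also have "\<dots> = ennreal (F y) * (\<integral>\<^sup>+ u. ennreal (subordination_weight \<nu> t u * reduced_kernel m u x y) * indicator {0<..} u \<partial>lborel)"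
          by (rule nn_integral_cmult) measurable
        also have "\<dots> \<le> ennreal (F y) * ennreal (C3 * (1 + norm x) powr ?B * decay ?\<kappa> \<nu> (norm y))"
          using False by (intro mult_left_mono C3 t) auto
        also have "\<dots> = ennreal (C3 * (1 + norm x) powr ?B) * ennreal (F y * decay ?\<kappa> \<nu> (norm y))"
          using C3(1) nn[of y] decay_pos[of "norm y" ?\<kappa> \<nu>] by (simp add: ennreal_mult[symmetric] mult_ac)
        finally show ?thesis .
      qed simp
    qed
    also have "\<dots> = ennreal (C3 * (1 + norm x) powr ?B) * ?D"
      by (rule nn_integral_cmult) measurable
    finally have far: "(\<integral>\<^sup>+ u. \<integral>\<^sup>+ y. ?P u * indicator {0<..} u * (?K u y * indicator (- ?N) y) \<partial>lborel \<partial>lborel)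
      \<le> ennreal (C3 * (1 + norm x) powr ?B) * ?D" .
    have "(\<integral>\<^sup>+ u\<in>{0<..}. ?P u * (\<integral>\<^sup>+ y. ?K u y \<partial>lborel) \<partial>lborel)
      \<le> ennreal (C1 * C2 * (1 + norm x) ^ (2 * ?d)) * ?M + ennreal (C3 * (1 + norm x) powr ?B) * ?D"
      unfolding split by (rule add_mono[OF near far])
    also have "\<dots> \<le> ennreal ((C1 * C2 + C3) * (1 + norm x) powr ?A) * ?M + ennreal ((C1 * C2 + C3) * (1 + norm x) powr ?A) * ?D"
    proof (intro add_mono mult_right_mono ennreal_leI mult_mono)
      have "(1 + norm x) ^ (2 * ?d) = (1 + norm x) powr real (2 * ?d)"
        by (rule powr_realpow[symmetric]) (auto intro: add_pos_nonneg)
      also have "\<dots> \<le> (1 + norm x) powr ?A" using m \<nu> by (intro powr_mono) auto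
      finally show "(1 + norm x) ^ (2 * ?d) \<le> (1 + norm x) powr ?A" .
      show "(1 + norm x) powr ?B \<le> (1 + norm x) powr ?A" by (intro powr_mono) auto
    qed (use C1(1) C2(1) C3(1) in auto)
    finally show "(\<integral>\<^sup>+ u\<in>{0<..}. ?P u * (\<integral>\<^sup>+ y. ?K u y \<partial>lborel) \<partial>lborel)
      \<le> ennreal ((C1 * C2 + C3) * (1 + norm x) powr ?A) * (?M + ?D)"
      by (simp only: distrib_left)
  qed
qed

section \<open>Pointwise bound and measurability of the Poisson maximal function\<close>

lemma borel_measurable_heat_kernel [measurable (raw)]:
  fixes g h :: "'a \<Rightarrow> real ^ 'n"
  assumes [measurable]: "f \<in> borel_measurable M" "g \<in> borel_measurable M" "h \<in> borel_measurable M"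
  shows "(\<lambda>w. heat_kernel m (f w) (g w) (h w)) \<in> borel_measurable M"
  unfolding heat_kernel_def tanh_real_altdef sinh_field_def by measurable

lemma heat_lborel:
  fixes f :: "real ^ 'n \<Rightarrow> real"
  assumes [measurable]: "f \<in> borel_measurable borel"
  shows "heat m u f x = (LINT y|lborel. heat_kernel m u x y * f y)"
  unfolding heat_def by (rule integral_completion) measurable

lemma borel_measurable_heat [measurable (raw)]:
  fixes f :: "real ^ 'n \<Rightarrow> real"
  assumes [measurable]: "f \<in> borel_measurable borel" "g \<in> borel_measurable M" "h \<in> borel_measurable M"
  shows "(\<lambda>w. heat m (g w) f (h w)) \<in> borel_measurable M"
  unfolding heat_lborel[OF assms(1)] by measurable

lemma Poisson_lborel:
  fixes f :: "real ^ 'n \<Rightarrow> real"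
  assumes [measurable]: "f \<in> borel_measurable borel"
  shows "Poisson m \<nu> t f x = t powr (2 * \<nu>) / (4 powr \<nu> * Gamma \<nu>) *
     (LINT u|lborel. indicator {0<..} u *\<^sub>R (exp (- t\<^sup>2 / (4 * u)) * heat m u f x / u powr (1 + \<nu>)))"
  unfolding Poisson_def set_lebesgue_integral_def by (subst integral_completion) measurable

lemma borel_measurable_Poisson:
  fixes f :: "real ^ 'n \<Rightarrow> real"
  assumes [measurable]: "f \<in> borel_measurable borel"
  shows "(\<lambda>x. Poisson m \<nu> t f x) \<in> borel_measurable borel"
  unfolding Poisson_lborel[OF assms] by measurable

text \<open>
  For functions that are not integrable this holds because their integral is \<open>0\<close> by convention.
\<close>

lemma ennreal_abs_integral_le:
  fixes f :: "'a \<Rightarrow> real"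
  shows "ennreal \<bar>integral\<^sup>L M f\<bar> \<le> (\<integral>\<^sup>+ y. ennreal \<bar>f y\<bar> \<partial>M)"
proof (cases "integrable M f")
  case True
  then show ?thesis using integral_norm_bound_ennreal[of M f] by simp
qed (simp add: not_integrable_integral_eq)

lemma nn_integral_heat_kernel:
  fixes f :: "real ^ 'n \<Rightarrow> real"
  assumes u: "0 < u" and [measurable]: "f \<in> borel_measurable borel"
  shows "(\<integral>\<^sup>+ y. ennreal \<bar>heat_kernel m u x y * f y\<bar> \<partial>lborel)
    = ennreal (exp ((norm x)\<^sup>2 / 2)) *
      (\<integral>\<^sup>+ y. ennreal (reduced_kernel m u x y) * ennreal (\<bar>f y\<bar> * exp (- (norm y)\<^sup>2 / 2)) \<partial>lborel)"
  by (subst nn_integral_cmult[symmetric], measurable, intro nn_integral_cong)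
     (simp add: heat_kernel_eq[OF u] abs_mult reduced_kernel_nonneg ennreal_mult[symmetric] mult_ac)

lemma Poisson_integrand_bound:
  fixes f :: "real ^ 'n \<Rightarrow> real"
  assumes [measurable]: "f \<in> borel_measurable borel"
  shows "ennreal (t powr (2 * \<nu>)) *
      (\<integral>\<^sup>+ u. ennreal \<bar>indicator {0<..} u *\<^sub>R (exp (- t\<^sup>2 / (4 * u)) * heat m u f x / u powr (1 + \<nu>))\<bar> \<partial>lborel)
    \<le> ennreal (exp ((norm x)\<^sup>2 / 2)) *
      (\<integral>\<^sup>+ u\<in>{0<..}. ennreal (subordination_weight \<nu> t u) *
        (\<integral>\<^sup>+ y. ennreal (reduced_kernel m u x y) * ennreal (\<bar>f y\<bar> * exp (- (norm y)\<^sup>2 / 2)) \<partial>lborel) \<partial>lborel)"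
proof -
  let ?I = "\<lambda>u. \<integral>\<^sup>+ y. ennreal (reduced_kernel m u x y) * ennreal (\<bar>f y\<bar> * exp (- (norm y)\<^sup>2 / 2)) \<partial>lborel"
  have "ennreal (t powr (2 * \<nu>)) *
      (\<integral>\<^sup>+ u. ennreal \<bar>indicator {0<..} u *\<^sub>R (exp (- t\<^sup>2 / (4 * u)) * heat m u f x / u powr (1 + \<nu>))\<bar> \<partial>lborel)
    = (\<integral>\<^sup>+ u. ennreal (t powr (2 * \<nu>)) * ennreal \<bar>indicator {0<..} u *\<^sub>R (exp (- t\<^sup>2 / (4 * u)) * heat m u f x / u powr (1 + \<nu>))\<bar> \<partial>lborel)"
    by (rule nn_integral_cmult[symmetric]) measurable
  also have "\<dots> \<le> (\<integral>\<^sup>+ u. ennreal (exp ((norm x)\<^sup>2 / 2)) * (ennreal (subordination_weight \<nu> t u) * ?I u * indicator {0<..} u) \<partial>lborel)"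
  proof (intro nn_integral_mono)
    fix u
    show "ennreal (t powr (2 * \<nu>)) * ennreal \<bar>indicator {0<..} u *\<^sub>R (exp (- t\<^sup>2 / (4 * u)) * heat m u f x / u powr (1 + \<nu>))\<bar>
      \<le> ennreal (exp ((norm x)\<^sup>2 / 2)) * (ennreal (subordination_weight \<nu> t u) * ?I u * indicator {0<..} u)"
    proof (cases "0 < u")
      case True
      have p: "1 / u powr (1 + \<nu>) = u powr (- 1 - \<nu>)"
        using powr_minus_divide[of u "1 + \<nu>"] by simp
      have "ennreal (t powr (2 * \<nu>)) * ennreal \<bar>indicator {0<..} u *\<^sub>R (exp (- t\<^sup>2 / (4 * u)) * heat m u f x / u powr (1 + \<nu>))\<bar>
         = ennreal (t powr (2 * \<nu>) * (exp (- t\<^sup>2 / (4 * u)) * \<bar>heat m u f x\<bar> * (1 / u powr (1 + \<nu>))))"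
        using True by (simp add: ennreal_mult[symmetric] abs_mult)
      also have "\<dots> = ennreal (subordination_weight \<nu> t u * \<bar>heat m u f x\<bar>)"
        unfolding p subordination_weight_def by (simp add: mult_ac)
      also have "\<dots> = ennreal (subordination_weight \<nu> t u) * ennreal \<bar>heat m u f x\<bar>"
        by (intro ennreal_mult subordination_weight_nonneg) simp
      also have "\<dots> \<le> ennreal (subordination_weight \<nu> t u) * (ennreal (exp ((norm x)\<^sup>2 / 2)) * ?I u)"
        unfolding nn_integral_heat_kernel[OF True assms, symmetric] heat_lborel[OF assms]
        by (intro mult_left_mono ennreal_abs_integral_le) simp
      finally show ?thesis using True by (simp add: mult_ac)
    qed simp
  qed
  also have "\<dots> = ennreal (exp ((norm x)\<^sup>2 / 2)) *
      (\<integral>\<^sup>+ u\<in>{0<..}. ennreal (subordination_weight \<nu> t u) * ?I u \<partial>lborel)"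
    by (rule nn_integral_cmult) measurable
  finally show ?thesis .
qed

text \<open>
  The bound for the positive kernels controls \<^const>\<open>Poisson\<close>, and where its right hand side is finite
  it also shows that the defining integrals converge.
\<close>

theorem Poisson_pointwise_bound:
  assumes m: "- real CARD('n) \<le> m" and \<nu>: "0 < \<nu>"
  obtains C where "0 \<le> C"
    "\<And>(f :: real ^ 'n \<Rightarrow> real) t x. f \<in> borel_measurable borel \<Longrightarrow> 0 < t \<Longrightarrow> t < a \<Longrightarrow>
      ennreal \<bar>Poisson m \<nu> t f x\<bar> \<le> ennreal (C * exp ((norm x)\<^sup>2 / 2) * (1 + norm x) powr (m + 3 * real CARD('n) + 2 * \<nu> + 2)) *
      (loc_max (\<lambda>y. ennreal (\<bar>f y\<bar> * exp (- (norm y)\<^sup>2 / 2))) x + (\<integral>\<^sup>+ y. ennreal (\<bar>f y\<bar> * phi m \<nu> y) \<partial>lborel))"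
    "\<And>(f :: real ^ 'n \<Rightarrow> real) t x. f \<in> borel_measurable borel \<Longrightarrow> 0 < t \<Longrightarrow> t < a \<Longrightarrow>
      loc_max (\<lambda>y. ennreal (\<bar>f y\<bar> * exp (- (norm y)\<^sup>2 / 2))) x < top \<Longrightarrow>
      (\<integral>\<^sup>+ y. ennreal (\<bar>f y\<bar> * phi m \<nu> y) \<partial>lborel) < top \<Longrightarrow> Poisson_exists m \<nu> t f x"
proof -
  let ?A = "m + 3 * real CARD('n) + 2 * \<nu> + 2" let ?\<kappa> = "(m + real CARD('n)) / 2"
  obtain C where C: "0 \<le> C" "\<And>(F :: real ^ 'n \<Rightarrow> real) t x. F \<in> borel_measurable borel \<Longrightarrow> (\<And>y. 0 \<le> F y) \<Longrightarrow> 0 < t \<Longrightarrow> t < a \<Longrightarrow>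
    (\<integral>\<^sup>+ u\<in>{0<..}. ennreal (subordination_weight \<nu> t u) *
        (\<integral>\<^sup>+ y. ennreal (reduced_kernel m u x y) * ennreal (F y) \<partial>lborel) \<partial>lborel)
    \<le> ennreal (C * (1 + norm x) powr ?A) *
      (loc_max (\<lambda>y. ennreal (F y)) x + (\<integral>\<^sup>+ y. ennreal (F y * decay ?\<kappa> \<nu> (norm y)) \<partial>lborel))"
    using subordinated_kernel_bound[OF m \<nu>, of a] by blast
  define G where "G = 4 powr \<nu> * Gamma \<nu>"
  have G: "0 < G" using \<nu> by (simp add: G_def Gamma_real_pos)
  have ph: "\<bar>f y\<bar> * exp (- (norm y)\<^sup>2 / 2) * decay ?\<kappa> \<nu> (norm y) = \<bar>f y\<bar> * phi m \<nu> y"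
    for f :: "real ^ 'n \<Rightarrow> real" and y
    by (simp add: phi_eq_decay)
  have bound: "ennreal (t powr (2 * \<nu>)) *
      (\<integral>\<^sup>+ u. ennreal \<bar>indicator {0<..} u *\<^sub>R (exp (- t\<^sup>2 / (4 * u)) * heat m u f x / u powr (1 + \<nu>))\<bar> \<partial>lborel)
      \<le> ennreal (C * exp ((norm x)\<^sup>2 / 2) * (1 + norm x) powr ?A) *
      (loc_max (\<lambda>y. ennreal (\<bar>f y\<bar> * exp (- (norm y)\<^sup>2 / 2))) x + (\<integral>\<^sup>+ y. ennreal (\<bar>f y\<bar> * phi m \<nu> y) \<partial>lborel))"
    if f[measurable]: "f \<in> borel_measurable borel" and t: "0 < t" "t < a" for f :: "real ^ 'n \<Rightarrow> real" and t x
  proof -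
    define Z where "Z = loc_max (\<lambda>y. ennreal (\<bar>f y\<bar> * exp (- (norm y)\<^sup>2 / 2))) x + (\<integral>\<^sup>+ y. ennreal (\<bar>f y\<bar> * phi m \<nu> y) \<partial>lborel)"
    have "(\<integral>\<^sup>+ u\<in>{0<..}. ennreal (subordination_weight \<nu> t u) *
        (\<integral>\<^sup>+ y. ennreal (reduced_kernel m u x y) * ennreal (\<bar>f y\<bar> * exp (- (norm y)\<^sup>2 / 2)) \<partial>lborel) \<partial>lborel)
       \<le> ennreal (C * (1 + norm x) powr ?A) * Z"
      using C(2)[of "\<lambda>y. \<bar>f y\<bar> * exp (- (norm y)\<^sup>2 / 2)" t x] t unfolding ph Z_def by simp
    then have "ennreal (exp ((norm x)\<^sup>2 / 2)) * (\<integral>\<^sup>+ u\<in>{0<..}. ennreal (subordination_weight \<nu> t u) *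
        (\<integral>\<^sup>+ y. ennreal (reduced_kernel m u x y) * ennreal (\<bar>f y\<bar> * exp (- (norm y)\<^sup>2 / 2)) \<partial>lborel) \<partial>lborel)
       \<le> ennreal (exp ((norm x)\<^sup>2 / 2)) * (ennreal (C * (1 + norm x) powr ?A) * Z)"
      by (intro mult_left_mono) auto
    also have "\<dots> = ennreal (C * exp ((norm x)\<^sup>2 / 2) * (1 + norm x) powr ?A) * Z"
      using C(1) by (subst mult.assoc[symmetric], subst ennreal_mult[symmetric]) (simp, simp, simp only: mult_ac)
    finally show ?thesis unfolding Z_def using Poisson_integrand_bound[OF f, of t \<nu> m x] by (rule order_trans[rotated])
  qed
  show ?thesis
  proof (rule that[of "C / G"])
    show "0 \<le> C / G" using C(1) G by simp
  next
    fix f :: "real ^ 'n \<Rightarrow> real" and t :: real and x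
    assume f[measurable]: "f \<in> borel_measurable borel" and t: "0 < t" "t < a"
    define Z where "Z = loc_max (\<lambda>y. ennreal (\<bar>f y\<bar> * exp (- (norm y)\<^sup>2 / 2))) x + (\<integral>\<^sup>+ y. ennreal (\<bar>f y\<bar> * phi m \<nu> y) \<partial>lborel)"
    let ?g = "\<lambda>u. indicator {0<..} u *\<^sub>R (exp (- t\<^sup>2 / (4 * u)) * heat m u f x / u powr (1 + \<nu>))"
    let ?K = "C * exp ((norm x)\<^sup>2 / 2) * (1 + norm x) powr ?A"
    have "ennreal \<bar>Poisson m \<nu> t f x\<bar> = ennreal (1 / G) * (ennreal (t powr (2 * \<nu>)) * ennreal \<bar>LINT u|lborel. ?g u\<bar>)"
      unfolding Poisson_lborel[OF f] G_def[symmetric] using G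
      by (simp add: ennreal_mult[symmetric] abs_mult del: scaleR_conv_of_real)
    also have "\<dots> \<le> ennreal (1 / G) * (ennreal (t powr (2 * \<nu>)) * (\<integral>\<^sup>+ u. ennreal \<bar>?g u\<bar> \<partial>lborel))"
      by (intro mult_left_mono ennreal_abs_integral_le) auto
    also have "\<dots> \<le> ennreal (1 / G) * (ennreal ?K * Z)"
      unfolding Z_def by (intro mult_left_mono bound f t) auto
    also have "\<dots> = ennreal (1 / G * ?K) * Z"
      using G C(1) by (subst mult.assoc[symmetric], subst ennreal_mult[symmetric]) auto
    finally show "ennreal \<bar>Poisson m \<nu> t f x\<bar> \<le> ennreal (C / G * exp ((norm x)\<^sup>2 / 2) * (1 + norm x) powr ?A) *
      (loc_max (\<lambda>y. ennreal (\<bar>f y\<bar> * exp (- (norm y)\<^sup>2 / 2))) x + (\<integral>\<^sup>+ y. ennreal (\<bar>f y\<bar> * phi m \<nu> y) \<partial>lborel))"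
      unfolding Z_def by (simp add: mult.assoc)
  next
    fix f :: "real ^ 'n \<Rightarrow> real" and t :: real and x
    assume f[measurable]: "f \<in> borel_measurable borel" and t: "0 < t" "t < a"
      and fin: "loc_max (\<lambda>y. ennreal (\<bar>f y\<bar> * exp (- (norm y)\<^sup>2 / 2))) x < top"
        "(\<integral>\<^sup>+ y. ennreal (\<bar>f y\<bar> * phi m \<nu> y) \<partial>lborel) < top"
    let ?g = "\<lambda>u. indicator {0<..} u *\<^sub>R (exp (- t\<^sup>2 / (4 * u)) * heat m u f x / u powr (1 + \<nu>))"
    have "integrable lebesgue (\<lambda>y. heat_kernel m u x y * f y)" if u: "0 < u" for u
    proof -
      obtain K where K: "0 \<le> K" "\<And>y. reduced_kernel m u x y \<le> K * decay ?\<kappa> \<nu> (norm y)"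
        using reduced_kernel_fixed_time[OF m \<nu> u, of x] by blast
      have "(\<integral>\<^sup>+ y. ennreal (reduced_kernel m u x y) * ennreal (\<bar>f y\<bar> * exp (- (norm y)\<^sup>2 / 2)) \<partial>lborel)
        \<le> (\<integral>\<^sup>+ y. ennreal K * ennreal (\<bar>f y\<bar> * phi m \<nu> y) \<partial>lborel)"
      proof (intro nn_integral_mono)
        fix y
        have "reduced_kernel m u x y * (\<bar>f y\<bar> * exp (- (norm y)\<^sup>2 / 2)) \<le> (K * decay ?\<kappa> \<nu> (norm y)) * (\<bar>f y\<bar> * exp (- (norm y)\<^sup>2 / 2))"
          by (intro mult_right_mono K) auto
        also have "\<dots> = K * (\<bar>f y\<bar> * phi m \<nu> y)" unfolding ph[symmetric] by (simp only: mult_ac)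
        finally have "ennreal (reduced_kernel m u x y * (\<bar>f y\<bar> * exp (- (norm y)\<^sup>2 / 2))) \<le> ennreal (K * (\<bar>f y\<bar> * phi m \<nu> y))"
          by (rule ennreal_leI)
        then show "ennreal (reduced_kernel m u x y) * ennreal (\<bar>f y\<bar> * exp (- (norm y)\<^sup>2 / 2)) \<le> ennreal K * ennreal (\<bar>f y\<bar> * phi m \<nu> y)"
          using K(1) reduced_kernel_nonneg[of m u x y] decay_pos[of "norm y" ?\<kappa> \<nu>]
          by (subst (1 2) ennreal_mult[symmetric]) (auto simp: phi_eq_decay less_imp_le)
      qed
      also have "\<dots> = ennreal K * (\<integral>\<^sup>+ y. ennreal (\<bar>f y\<bar> * phi m \<nu> y) \<partial>lborel)"
        by (rule nn_integral_cmult) (simp add: phi_eq_decay)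
      also have "\<dots> < top" using fin(2) by (simp add: ennreal_mult_less_top)
      finally have "(\<integral>\<^sup>+ y. ennreal \<bar>heat_kernel m u x y * f y\<bar> \<partial>lborel) < top"
        unfolding nn_integral_heat_kernel[OF u f] by (simp add: ennreal_mult_less_top)
      then have "integrable lborel (\<lambda>y. heat_kernel m u x y * f y)"
        by (intro integrableI_bounded) auto
      then show ?thesis by (subst integrable_completion) auto
    qed
    moreover have "set_integrable lebesgue {0<..} (\<lambda>u. exp (- t\<^sup>2 / (4 * u)) * heat m u f x / u powr (1 + \<nu>))"
    proof -
      define J where "J = (\<integral>\<^sup>+ u. ennreal \<bar>?g u\<bar> \<partial>lborel)"
      have "ennreal (t powr (2 * \<nu>)) * J < top"
        unfolding J_def
        by (rule le_less_trans[OF bound[OF f t]]) (use fin in \<open>simp add: ennreal_mult_less_top\<close>)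
      moreover have "ennreal (t powr (2 * \<nu>)) \<noteq> 0" using t by simp
      ultimately have "J < top" by (auto simp: ennreal_mult_less_top)
      then have "integrable lborel ?g"
        unfolding J_def by (intro integrableI_bounded) auto
      then show ?thesis unfolding set_integrable_def by (subst integrable_completion) auto
    qed
    ultimately show "Poisson_exists m \<nu> t f x" unfolding Poisson_exists_def by blast
  qed
qed

text \<open>
  As \<open>t\<close> grows the integrand decreases in absolute value, so the integrand at time \<open>t / 2\<close> dominates for
  all later times.
\<close>

lemma Poisson_tendsto:
  fixes f :: "real ^ 'n \<Rightarrow> real"
  assumes f[measurable]: "f \<in> borel_measurable borel"
    and ex: "\<And>s. 0 < s \<Longrightarrow> s < a \<Longrightarrow> Poisson_exists m \<nu> s f x"
    and \<nu>: "0 < \<nu>" and t: "0 < t" "t < a" and q: "q \<longlonglongrightarrow> t" "\<And>n. t / 2 \<le> q n"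
  shows "(\<lambda>n. Poisson m \<nu> (q n) f x) \<longlonglongrightarrow> Poisson m \<nu> t f x"
proof -
  let ?g = "\<lambda>s u. indicator {0<..} u *\<^sub>R (exp (- s\<^sup>2 / (4 * u)) * heat m u f x / u powr (1 + \<nu>))"
  have "set_integrable lebesgue {0<..} (\<lambda>u. exp (- (t/2)\<^sup>2 / (4 * u)) * heat m u f x / u powr (1 + \<nu>))"
    using ex[of "t/2"] t unfolding Poisson_exists_def by auto
  then have "integrable lborel (?g (t/2))"
    unfolding set_integrable_def by (subst (asm) integrable_completion) auto
  then have int: "integrable lborel (\<lambda>u. norm (?g (t/2) u))" by (rule integrable_norm)
  have "(\<lambda>n. LINT u|lborel. ?g (q n) u) \<longlonglongrightarrow> (LINT u|lborel. ?g t u)"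
  proof (rule integral_dominated_convergence[OF _ _ int])
    show "AE u in lborel. (\<lambda>n. ?g (q n) u) \<longlonglongrightarrow> ?g t u"
    proof (rule AE_I2)
      fix u :: real
      show "(\<lambda>n. ?g (q n) u) \<longlonglongrightarrow> ?g t u"
      proof (cases "0 < u")
        case True
        then show ?thesis by (auto intro!: tendsto_intros q(1))
      qed simp
    qed
    show "AE u in lborel. norm (?g (q n) u) \<le> norm (?g (t/2) u)" for n
    proof (rule AE_I2)
      fix u :: real
      show "norm (?g (q n) u) \<le> norm (?g (t/2) u)"
      proof (cases "0 < u")
        case True
        have "(t/2)\<^sup>2 \<le> (q n)\<^sup>2" using q(2)[of n] t by (intro power_mono) auto
        then have "- (q n)\<^sup>2 / (4 * u) \<le> - (t/2)\<^sup>2 / (4 * u)" using True by (intro divide_right_mono) auto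
        then have "exp (- (q n)\<^sup>2 / (4 * u)) \<le> exp (- (t/2)\<^sup>2 / (4 * u))" by simp
        then have "exp (- (q n)\<^sup>2 / (4 * u)) * (\<bar>heat m u f x\<bar> / \<bar>u powr (1 + \<nu>)\<bar>)
            \<le> exp (- (t/2)\<^sup>2 / (4 * u)) * (\<bar>heat m u f x\<bar> / \<bar>u powr (1 + \<nu>)\<bar>)"
          by (intro mult_right_mono) auto
        then show ?thesis using True by (simp add: abs_mult)
      qed simp
    qed
  qed measurable
  then show ?thesis unfolding Poisson_lborel[OF f]
    using t Gamma_real_pos[OF \<nu>] by (intro tendsto_mult tendsto_divide tendsto_powr q(1) tendsto_const) auto
qed

text \<open>
  Continuity in \<open>t\<close> allows a countable supremum, as measurability requires.
\<close>

lemma Poisson_max_eq_SUP_rational: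
  fixes f :: "real ^ 'n \<Rightarrow> real"
  assumes f[measurable]: "f \<in> borel_measurable borel"
    and ex: "\<And>s. 0 < s \<Longrightarrow> s < a \<Longrightarrow> Poisson_exists m \<nu> s f x" and \<nu>: "0 < \<nu>"
  shows "Poisson_max m \<nu> a f x = (SUP t\<in>{0<..<a} \<inter> \<rat>. ennreal \<bar>Poisson m \<nu> t f x\<bar>)" (is "_ = ?R")
proof (rule antisym)
  show "?R \<le> Poisson_max m \<nu> a f x"
    unfolding Poisson_max_def by (rule SUP_subset_mono) auto
  show "Poisson_max m \<nu> a f x \<le> ?R"
    unfolding Poisson_max_def
  proof (rule SUP_least)
    fix t assume "t \<in> {0<..<a}"
    then have t: "0 < t" "t < a" by auto
    have "\<exists>q\<in>\<rat>. t - (t / 2) / (real n + 1) < q \<and> q < t" for n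
      by (rule Rats_dense_in_real) (use t in auto)
    then obtain q where q: "\<And>n. q n \<in> \<rat>" "\<And>n. t - (t / 2) / (real n + 1) < q n" "\<And>n. q n < t"
      by metis
    have q2: "t / 2 \<le> q n" for n
    proof -
      have "(t / 2) / (real n + 1) \<le> (t / 2) / 1" using t by (intro divide_left_mono) auto
      then show ?thesis using q(2)[of n] by simp
    qed
    have lim: "q \<longlonglongrightarrow> t"
    proof (rule tendsto_sandwich)
      show "\<forall>\<^sub>F n in sequentially. t - (t / 2) / (real n + 1) \<le> q n" using q(2) by (simp add: less_imp_le)
      show "\<forall>\<^sub>F n in sequentially. q n \<le> t" using q(3) by (simp add: less_imp_le)
      show "(\<lambda>n. t - (t / 2) / (real n + 1)) \<longlonglongrightarrow> t" by real_asymp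
    qed simp
    have "(\<lambda>n. ennreal \<bar>Poisson m \<nu> (q n) f x\<bar>) \<longlonglongrightarrow> ennreal \<bar>Poisson m \<nu> t f x\<bar>"
      by (intro tendsto_ennrealI tendsto_rabs Poisson_tendsto[OF f ex \<nu> t lim q2])
    then show "ennreal \<bar>Poisson m \<nu> t f x\<bar> \<le> ?R"
    proof (rule LIMSEQ_le_const2, intro exI allI impI)
      fix n
      have "0 < q n" using q2[of n] t by simp
      moreover have "q n < a" using q(3)[of n] t by simp
      ultimately show "ennreal \<bar>Poisson m \<nu> (q n) f x\<bar> \<le> ?R"
        using q(1)[of n] by (intro SUP_upper) auto
    qed
  qed
qed

lemma borel_measurable_ennreal_AE:
  fixes f g :: "'a::euclidean_space \<Rightarrow> ennreal"
  assumes f[measurable]: "f \<in> borel_measurable lebesgue" and ae: "AE x in lebesgue. f x = g x"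
  shows "g \<in> borel_measurable lebesgue"
proof (rule measurableI)
  fix A :: "ennreal set" assume A[measurable]: "A \<in> sets borel"
  have "f -` A \<inter> space lebesgue \<in> sets lebesgue" by measurable
  moreover have "AE x in lebesgue. x \<in> f -` A \<inter> space lebesgue \<longleftrightarrow> x \<in> g -` A \<inter> space lebesgue"
    using ae by eventually_elim auto
  ultimately show "g -` A \<inter> space lebesgue \<in> sets lebesgue"
    using completion.in_sets_AE[of "f -` A \<inter> space lebesgue" "g -` A \<inter> space lebesgue" lborel] by auto
qed simp

lemma Poisson_max_measurable:
  fixes f :: "real ^ 'n \<Rightarrow> real"
  assumes f[measurable]: "f \<in> borel_measurable borel"
    and ex: "AE x in lebesgue. \<forall>t\<in>{0<..<a}. Poisson_exists m \<nu> t f x" and \<nu>: "0 < \<nu>"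
  shows "Poisson_max m \<nu> a f \<in> borel_measurable lebesgue"
proof -
  let ?R = "\<lambda>x. SUP t\<in>{0<..<a} \<inter> \<rat>. ennreal \<bar>Poisson m \<nu> t f x\<bar>"
  have "?R \<in> borel_measurable borel"
  proof (rule borel_measurable_SUP)
    show "countable ({0<..<a} \<inter> \<rat>)" using countable_rat by blast
    show "(\<lambda>x. ennreal \<bar>Poisson m \<nu> t f x\<bar>) \<in> borel_measurable borel" for t
      using borel_measurable_Poisson[OF f, of m \<nu> t] by measurable
  qed
  then have R: "?R \<in> borel_measurable lebesgue" by (intro measurable_completion) simp
  have ae: "AE x in lebesgue. ?R x = Poisson_max m \<nu> a f x"
    using ex by eventually_elim (rule Poisson_max_eq_SUP_rational[OF f _ \<nu>, symmetric], auto)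
  show ?thesis by (rule borel_measurable_ennreal_AE[OF R ae])
qed

section \<open>From pointwise bounds to weighted bounds\<close>

lemma ennpowr_cmult:
  assumes "0 \<le> c"
  shows "ennpowr (ennreal c * x) p = ennreal (c powr p) * ennpowr x p"
proof (cases x)
  case (real r)
  then show ?thesis using assms by (simp add: ennreal_mult[symmetric] ennpowr_ennreal powr_mult)
next
  case top
  then show ?thesis using assms by (cases "c = 0") (simp_all add: ennreal_mult_top ennpowr_def)
qed

lemma ennpowr_add_le:
  assumes "0 \<le> p"
  shows "ennpowr (x + y) p \<le> ennreal (2 powr p) * (ennpowr x p + ennpowr y p)"
proof -
  have "x + y \<le> ennreal 2 * max x y"
    by (metis add_mono ennreal_numeral max.cobounded1 max.cobounded2 mult_2 zero_le_numeral)
  then have "ennpowr (x + y) p \<le> ennpowr (ennreal 2 * max x y) p"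
    by (intro ennpowr_mono assms)
  also have "\<dots> = ennreal (2 powr p) * ennpowr (max x y) p" by (rule ennpowr_cmult) simp
  also have "ennpowr (max x y) p \<le> ennpowr x p + ennpowr y p"
    by (simp add: max_def add_increasing add_increasing2)
  finally show ?thesis by (simp add: mult_left_mono)
qed

lemma conjugate_exponent_eq:
  fixes p p' :: real
  assumes "1 < p" "1 / p + 1 / p' = 1"
  shows "1 < p'" and "p' / p = 1 / (p - 1)" and "p' * (p - 1) = p"
proof -
  have p'0: "p' \<noteq> 0" using assms by auto
  have e: "p' + p = p * p'" using assms p'0 by (simp add: field_simps)
  then have pp: "p' * (p - 1) = p" by (simp add: algebra_simps)
  then have "p' = p / (p - 1)" using assms(1) by (simp add: field_simps)
  then show "1 < p'" "p' / p = 1 / (p - 1)" using assms(1) by (simp_all add: less_divide_eq)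
  show "p' * (p - 1) = p" by (rule pp)
qed

text \<open>
  Hoelder's inequality up to a constant: scale \<open>f\<close> to norm \<open>1\<close> and apply Young's inequality under the
  integral.
\<close>

lemma ennpowr_nn_integral_mult_le:
  fixes f g :: "'a \<Rightarrow> real"
  assumes [measurable]: "f \<in> borel_measurable M" "g \<in> borel_measurable M"
    and nn: "\<And>x. 0 \<le> f x" "\<And>x. 0 \<le> g x" and p: "1 < p" and q: "1 / p + 1 / q = 1"
    and fin: "(\<integral>\<^sup>+ x. ennreal (g x powr q) \<partial>M) = ennreal J" "0 \<le> J"
  shows "ennpowr (\<integral>\<^sup>+ x. ennreal (f x * g x) \<partial>M) p
    \<le> ennreal ((1 + J) powr p) * (\<integral>\<^sup>+ x. ennreal (f x powr p) \<partial>M)"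
proof -
  have q1: "1 < q" by (rule conjugate_exponent_eq[OF p q])
  define I where "I = (\<integral>\<^sup>+ x. ennreal (f x powr p) \<partial>M)"
  consider "I = top" | "I = 0" | i where "I = ennreal i" "0 < i"
    by (cases I) (auto simp: le_less)
  then show ?thesis
  proof cases
    case 1
    then show ?thesis using fin(2) unfolding I_def by (simp add: ennreal_mult_top)
  next
    case 2
    then have "AE x in M. f x powr p = 0"
      unfolding I_def by (subst (asm) nn_integral_0_iff_AE) auto
    then have "AE x in M. ennreal (f x * g x) = 0" by eventually_elim auto
    then have "(\<integral>\<^sup>+ x. ennreal (f x * g x) \<partial>M) = 0" by (subst nn_integral_0_iff_AE) auto
    then show ?thesis by (simp add: ennpowr_def)
  next
    case 3
    define s where "s = i powr (1 / p)"
    have s: "0 < s" "s powr p = i" using 3 p by (auto simp: s_def powr_powr)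
    have "f x * g x \<le> s * ((f x powr p) / i + g x powr q)" for x
    proof -
      have "f x / s * g x \<le> (f x / s) powr p / p + g x powr q / q"
        by (rule Youngs_inequality[OF p q1 q]) (use nn s in auto)
      also have "\<dots> \<le> (f x / s) powr p / 1 + g x powr q / 1"
        using p q1 by (intro add_mono divide_left_mono) auto
      also have "(f x / s) powr p = f x powr p / i"
        using nn s by (simp add: powr_divide)
      finally have "s * (f x / s * g x) \<le> s * (f x powr p / i + g x powr q)"
        using s by (intro mult_left_mono) auto
      then show ?thesis using s by simp
    qed
    then have "(\<integral>\<^sup>+ x. ennreal (f x * g x) \<partial>M)
      \<le> (\<integral>\<^sup>+ x. ennreal s * (ennreal (1 / i) * ennreal (f x powr p) + ennreal (g x powr q)) \<partial>M)"
    proof (intro nn_integral_mono)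
      fix x
      have "ennreal (f x * g x) \<le> ennreal (s * ((f x powr p) / i + g x powr q))"
        using \<open>\<And>x. f x * g x \<le> s * ((f x powr p) / i + g x powr q)\<close> by (rule ennreal_leI)
      also have "\<dots> = ennreal s * (ennreal (1 / i) * ennreal (f x powr p) + ennreal (g x powr q))"
        using s 3 by (simp add: ennreal_mult[symmetric] flip: ennreal_plus)
      finally show "ennreal (f x * g x) \<le> ennreal s * (ennreal (1 / i) * ennreal (f x powr p) + ennreal (g x powr q))" .
    qed
    also have "\<dots> = ennreal s * (ennreal (1 / i) * I + ennreal J)"
    proof -
      have "(\<integral>\<^sup>+ x. ennreal s * (ennreal (1 / i) * ennreal (f x powr p) + ennreal (g x powr q)) \<partial>M)
          = ennreal s * (\<integral>\<^sup>+ x. ennreal (1 / i) * ennreal (f x powr p) + ennreal (g x powr q) \<partial>M)"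
        by (rule nn_integral_cmult) measurable
      moreover have "(\<integral>\<^sup>+ x. ennreal (1 / i) * ennreal (f x powr p) + ennreal (g x powr q) \<partial>M)
          = (\<integral>\<^sup>+ x. ennreal (1 / i) * ennreal (f x powr p) \<partial>M) + ennreal J"
        unfolding fin(1)[symmetric] by (rule nn_integral_add) measurable
      moreover have "(\<integral>\<^sup>+ x. ennreal (1 / i) * ennreal (f x powr p) \<partial>M) = ennreal (1 / i) * I"
        unfolding I_def by (rule nn_integral_cmult) measurable
      ultimately show ?thesis by simp
    qed
    also have "\<dots> = ennreal (s * (1 + J))"
      unfolding 3(1) using 3(2) s fin(2)
      by (simp add: ennreal_mult[symmetric] flip: ennreal_plus ennreal_1)
    finally have "ennpowr (\<integral>\<^sup>+ x. ennreal (f x * g x) \<partial>M) p \<le> ennpowr (ennreal (s * (1 + J))) p"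
      using p by (intro ennpowr_mono) auto
    also have "\<dots> = ennreal ((1 + J) powr p) * I"
      using s fin(2) 3 by (simp add: ennpowr_ennreal powr_mult ennreal_mult[symmetric] mult.commute)
    finally show ?thesis unfolding I_def .
  qed
qed

text \<open>
  The power of \<open>1 + norm x\<close> is shared out: \<open>A * p\<close> of the exponent \<open>N\<close> compensates the loss in the
  pointwise bound. The rest is enough both for the two-weight inequality, which takes care of
  the maximal function, and for the weight to be integrable, which takes care of the constant \<open>D\<close>; here
  the lower bound of the maximal function of \<open>W\<close> makes the weight at most a multiple of
  \<open>1 / (1 + norm x) ^ (d + 1)\<close>.
\<close>

theorem weighted_bound_of_pointwise_bound:
  fixes W :: "'a::euclidean_space \<Rightarrow> real"
  assumes W[measurable]: "W \<in> borel_measurable borel" and nnW: "\<And>y. 0 \<le> W y"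
    and pos: "AE y in lborel. 0 < W y"
    and p: "1 < p" and \<gamma>: "p - 1 < \<gamma>" and C: "0 \<le> C"
    and N: "real DIM('a) * \<gamma> + A * p + real DIM('a) + 1 \<le> N"
  shows "\<exists>K\<ge>0. \<forall>P F D. F \<in> borel_measurable borel \<longrightarrow> (\<forall>y. 0 \<le> F y) \<longrightarrow>
      (\<forall>x. P x \<le> ennreal (C * exp ((norm x)\<^sup>2 / 2) * (1 + norm x) powr A) * (loc_max (\<lambda>y. ennreal (F y)) x + D)) \<longrightarrow>
      (\<integral>\<^sup>+ x. ennpowr (P x) p * ennreal (enn2real (loc_max (\<lambda>y. ennreal (W y)) x) powr (- \<gamma>) *
          exp (- p * (norm x)\<^sup>2 / 2) * (1 + norm x) powr (- N)) \<partial>lborel)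
      \<le> ennreal K * ((\<integral>\<^sup>+ y. ennreal (F y powr p * W y powr (1 - p)) \<partial>lborel) + ennpowr D p)"
proof -
  let ?d = "real DIM('a)"
  define M where "M = loc_max (\<lambda>y. ennreal (W y))"
  have M[measurable]: "M \<in> borel_measurable borel" unfolding M_def by measurable
  define s where "s = N - A * p"
  have \<gamma>0: "0 \<le> \<gamma>" using p \<gamma> by simp
  have s: "?d * \<gamma> \<le> s" "?d * \<gamma> + ?d + 1 \<le> s" using N by (auto simp: s_def)
  define \<omega> where "\<omega> x = enn2real (M x) powr (- \<gamma>) * (1 + norm x) powr (- s)" for x
  have \<omega>0: "0 \<le> \<omega> x" for x by (simp add: \<omega>_def)
  have [measurable]: "\<omega> \<in> borel_measurable borel" unfolding \<omega>_def by measurable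
  obtain K1 where K1: "0 \<le> K1" "\<And>F. F \<in> borel_measurable borel \<Longrightarrow> (\<forall>y. 0 \<le> F y) \<Longrightarrow>
    (\<integral>\<^sup>+ x. ennpowr (loc_max (\<lambda>y. ennreal (F y)) x) p * ennreal (\<omega> x) \<partial>lborel)
    \<le> ennreal K1 * (\<integral>\<^sup>+ y. ennreal (F y powr p * W y powr (1 - p)) \<partial>lborel)"
    using loc_max_two_weight[OF W nnW pos p \<gamma> s(1)] unfolding \<omega>_def M_def by blast
  have "AE y in lborel. 0 < ennreal (W y)" using pos by simp
  then obtain c where c: "0 < c" "\<And>x. ennreal (c / (1 + norm x) ^ DIM('a)) \<le> M x"
    using loc_max_lower_bound[of "\<lambda>y. ennreal (W y)"] unfolding M_def by auto
  have \<omega>le: "\<omega> x \<le> c powr (- \<gamma>) * (1 / (1 + norm x) ^ (DIM('a) + 1))" for x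
  proof (cases "M x")
    case (real r)
    define R where "R = 1 + norm x"
    have R: "1 \<le> R" by (simp add: R_def)
    have "c / R ^ DIM('a) \<le> r" using c(2)[of x] real by (simp add: R_def)
    also have "c / R ^ DIM('a) = c * R powr (- ?d)"
      using R by (simp add: powr_minus_divide powr_realpow)
    finally have "r powr (- \<gamma>) \<le> (c * R powr (- ?d)) powr (- \<gamma>)"
      using c(1) R \<gamma>0 by (intro powr_mono2') auto
    also have "\<dots> = c powr (- \<gamma>) * R powr (?d * \<gamma>)"
      by (simp add: powr_mult powr_powr)
    finally have "r powr (- \<gamma>) * R powr (- s) \<le> c powr (- \<gamma>) * R powr (?d * \<gamma>) * R powr (- s)"
      by (intro mult_right_mono) auto
    also have "\<dots> = c powr (- \<gamma>) * R powr (?d * \<gamma> - s)"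
      by (simp add: powr_add[symmetric] mult.assoc)
    also have "\<dots> \<le> c powr (- \<gamma>) * R powr (- real (DIM('a) + 1))"
      using R s(2) by (intro mult_left_mono powr_mono) auto
    also have "R powr (- real (DIM('a) + 1)) = 1 / R ^ (DIM('a) + 1)"
      using R by (subst powr_minus_divide, subst powr_realpow) auto
    finally show ?thesis using real by (simp add: \<omega>_def R_def)
  qed (simp add: \<omega>_def)
  define \<Omega> where "\<Omega> = enn2real (\<integral>\<^sup>+ x. ennreal (\<omega> x) \<partial>lborel)"
  have "(\<integral>\<^sup>+ x. ennreal (\<omega> x) \<partial>lborel) \<le> (\<integral>\<^sup>+ x. ennreal (c powr (- \<gamma>)) * ennreal (1 / (1 + norm (x::'a)) ^ (DIM('a) + 1)) \<partial>lborel)"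
  proof (intro nn_integral_mono)
    fix x
    have "ennreal (\<omega> x) \<le> ennreal (c powr (- \<gamma>) * (1 / (1 + norm x) ^ (DIM('a) + 1)))"
      by (rule ennreal_leI[OF \<omega>le])
    also have "\<dots> = ennreal (c powr (- \<gamma>)) * ennreal (1 / (1 + norm x) ^ (DIM('a) + 1))"
      by (rule ennreal_mult) simp_all
    finally show "ennreal (\<omega> x) \<le> ennreal (c powr (- \<gamma>)) * ennreal (1 / (1 + norm x) ^ (DIM('a) + 1))" .
  qed
  also have "\<dots> = ennreal (c powr (- \<gamma>)) * (\<integral>\<^sup>+ x. ennreal (1 / (1 + norm (x::'a)) ^ (DIM('a) + 1)) \<partial>lborel)"
    by (rule nn_integral_cmult) measurable
  also have "\<dots> < top" using nn_integral_inverse_power_finite[where 'a='a] by (simp only: ennreal_mult_less_top) simp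
  finally have \<Omega>: "(\<integral>\<^sup>+ x. ennreal (\<omega> x) \<partial>lborel) = ennreal \<Omega>" "0 \<le> \<Omega>" by (auto simp: \<Omega>_def)
  define B where "B = C powr p * 2 powr p"
  have B: "0 \<le> B" by (simp add: B_def)
  show ?thesis
  proof (intro exI[of _ "B * (K1 + \<Omega>)"] conjI allI impI)
    show "0 \<le> B * (K1 + \<Omega>)" using B K1(1) \<Omega>(2) by simp
    fix P F and D :: ennreal
    assume F[measurable]: "F \<in> borel_measurable borel" and nnF: "\<forall>y. 0 \<le> F y"
      and P: "\<forall>x::'a. P x \<le> ennreal (C * exp ((norm x)\<^sup>2 / 2) * (1 + norm x) powr A) * (loc_max (\<lambda>y. ennreal (F y)) x + D)"
    define T where "T = loc_max (\<lambda>y. ennreal (F y))"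
    have T[measurable]: "T \<in> borel_measurable borel" unfolding T_def by measurable
    let ?J = "\<integral>\<^sup>+ y. ennreal (F y powr p * W y powr (1 - p)) \<partial>lborel"
    have "(\<integral>\<^sup>+ x. ennpowr (P x) p * ennreal (enn2real (M x) powr (- \<gamma>) *
          exp (- p * (norm x)\<^sup>2 / 2) * (1 + norm x) powr (- N)) \<partial>lborel)
      \<le> (\<integral>\<^sup>+ x. ennreal B * (ennpowr (T x) p * ennreal (\<omega> x) + ennpowr D p * ennreal (\<omega> x)) \<partial>lborel)"
    proof (intro nn_integral_mono)
      fix x :: 'a
      let ?E = "C * exp ((norm x)\<^sup>2 / 2) * (1 + norm x) powr A"
      let ?v = "enn2real (M x) powr (- \<gamma>) * exp (- p * (norm x)\<^sup>2 / 2) * (1 + norm x) powr (- N)"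
      have "ennpowr (P x) p \<le> ennpowr (ennreal ?E * (T x + D)) p"
        unfolding T_def using p by (intro ennpowr_mono P[rule_format]) auto
      also have "\<dots> = ennreal (?E powr p) * ennpowr (T x + D) p"
        by (rule ennpowr_cmult) (use C in auto)
      also have "\<dots> \<le> ennreal (?E powr p) * (ennreal (2 powr p) * (ennpowr (T x) p + ennpowr D p))"
        using p by (intro mult_left_mono ennpowr_add_le) auto
      finally have "ennpowr (P x) p * ennreal ?v \<le> ennreal (?E powr p) * (ennreal (2 powr p) * (ennpowr (T x) p + ennpowr D p)) * ennreal ?v"
        by (rule mult_right_mono) simp
      also have "\<dots> = (ennreal (?E powr p) * ennreal (2 powr p) * ennreal ?v) * (ennpowr (T x) p + ennpowr D p)"
        by (simp only: mult_ac)
      also have "ennreal (?E powr p) * ennreal (2 powr p) * ennreal ?v = ennreal B * ennreal (\<omega> x)"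
      proof -
        have "?E powr p = C powr p * exp (p * (norm x)\<^sup>2 / 2) * (1 + norm x) powr (A * p)"
          by (simp add: powr_mult powr_powr exp_powr_real mult_ac)
        then have "?E powr p * 2 powr p * ?v = B * (enn2real (M x) powr (- \<gamma>) *
            (exp (p * (norm x)\<^sup>2 / 2) * exp (- p * (norm x)\<^sup>2 / 2)) * ((1 + norm x) powr (A * p) * (1 + norm x) powr (- N)))"
          by (simp only: B_def mult_ac)
        also have "\<dots> = B * \<omega> x"
          by (simp add: exp_add[symmetric] powr_add[symmetric] \<omega>_def s_def)
        finally show ?thesis using B \<omega>0[of x] C by (simp add: ennreal_mult[symmetric])
      qed
      finally show "ennpowr (P x) p * ennreal ?v \<le> ennreal B * (ennpowr (T x) p * ennreal (\<omega> x) + ennpowr D p * ennreal (\<omega> x))"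
        by (simp only: distrib_left distrib_right mult_ac)
    qed
    also have "\<dots> = ennreal B * ((\<integral>\<^sup>+ x. ennpowr (T x) p * ennreal (\<omega> x) \<partial>lborel) + ennpowr D p * ennreal \<Omega>)"
    proof -
      have "(\<integral>\<^sup>+ x. ennreal B * (ennpowr (T x) p * ennreal (\<omega> x) + ennpowr D p * ennreal (\<omega> x)) \<partial>lborel)
          = ennreal B * (\<integral>\<^sup>+ x. ennpowr (T x) p * ennreal (\<omega> x) + ennpowr D p * ennreal (\<omega> x) \<partial>lborel)"
        by (rule nn_integral_cmult) measurable
      moreover have "(\<integral>\<^sup>+ x. ennpowr (T x) p * ennreal (\<omega> x) + ennpowr D p * ennreal (\<omega> x) \<partial>lborel)
          = (\<integral>\<^sup>+ x. ennpowr (T x) p * ennreal (\<omega> x) \<partial>lborel) + (\<integral>\<^sup>+ x. ennpowr D p * ennreal (\<omega> x) \<partial>lborel)"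
        by (rule nn_integral_add) measurable
      moreover have "(\<integral>\<^sup>+ x. ennpowr D p * ennreal (\<omega> x) \<partial>lborel) = ennpowr D p * ennreal \<Omega>"
        unfolding \<Omega>(1)[symmetric] by (rule nn_integral_cmult) measurable
      ultimately show ?thesis by simp
    qed
    also have "\<dots> \<le> ennreal B * (ennreal K1 * ?J + ennpowr D p * ennreal \<Omega>)"
      unfolding T_def using F nnF by (intro mult_left_mono add_right_mono K1) auto
    also have "\<dots> \<le> ennreal B * (ennreal (K1 + \<Omega>) * ?J + ennpowr D p * ennreal (K1 + \<Omega>))"
      using K1(1) \<Omega>(2) by (intro mult_left_mono add_mono mult_right_mono ennreal_leI) auto
    also have "\<dots> = ennreal (B * (K1 + \<Omega>)) * (?J + ennpowr D p)"
    proof -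
      have e: "ennreal (B * (K1 + \<Omega>)) = ennreal B * ennreal (K1 + \<Omega>)"
        using B K1(1) \<Omega>(2) by (intro ennreal_mult) auto
      show ?thesis unfolding e by (simp only: distrib_left mult_ac)
    qed
    finally show "(\<integral>\<^sup>+ x. ennpowr (P x) p * ennreal (enn2real (loc_max (\<lambda>y. ennreal (W y)) x) powr (- \<gamma>) *
          exp (- p * (norm x)\<^sup>2 / 2) * (1 + norm x) powr (- N)) \<partial>lborel)
      \<le> ennreal (B * (K1 + \<Omega>)) * (?J + ennpowr D p)"
      unfolding M_def .
  qed
qed

text \<open>
  Tonelli's theorem needs Borel measurable functions, so \<open>f\<close> is replaced by a Borel function that is
  equal to it almost everywhere.
\<close>

lemma heat_cong_AE:
  fixes f g :: "real ^ 'n \<Rightarrow> real"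
  assumes [measurable]: "f \<in> borel_measurable lebesgue" "g \<in> borel_measurable lebesgue"
    and ae: "AE x in lebesgue. f x = g x"
  shows "heat m u f = heat m u g"
    and "integrable lebesgue (\<lambda>y. heat_kernel m u x y * f y) \<longleftrightarrow> integrable lebesgue (\<lambda>y. heat_kernel m u x y * g y)"
proof -
  have [measurable]: "heat_kernel m u x \<in> borel_measurable lebesgue" for x :: "real ^ 'n"
  proof -
    have "heat_kernel m u x \<in> borel_measurable borel" by measurable
    then show ?thesis by (intro measurable_completion) simp
  qed
  have ae': "AE y in lebesgue. heat_kernel m u x y * f y = heat_kernel m u x y * g y" for x
    using ae by eventually_elim simp
  show "heat m u f = heat m u g"
    unfolding heat_def by (intro ext integral_cong_AE ae') measurable
  show "integrable lebesgue (\<lambda>y. heat_kernel m u x y * f y) \<longleftrightarrow> integrable lebesgue (\<lambda>y. heat_kernel m u x y * g y)"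
    by (intro integrable_cong_AE ae') measurable
qed

lemma Poisson_cong_AE:
  fixes f g :: "real ^ 'n \<Rightarrow> real"
  assumes "f \<in> borel_measurable lebesgue" "g \<in> borel_measurable lebesgue" "AE x in lebesgue. f x = g x"
  shows "Poisson_exists m \<nu> t f x \<longleftrightarrow> Poisson_exists m \<nu> t g x"
    and "Poisson_max m \<nu> a f = Poisson_max m \<nu> a g"
  unfolding Poisson_exists_def Poisson_max_def Poisson_def heat_cong_AE[OF assms] by auto

section \<open>The two-weight theorem\<close>

text \<open>
  On bounded sets \<^const>\<open>decay\<close> is bounded away from \<open>0\<close>.
\<close>

lemma nn_integral_norm_le_finite:
  fixes h :: "real ^ 'n \<Rightarrow> real"
  assumes [measurable]: "h \<in> borel_measurable borel" and nn: "\<And>y. 0 \<le> h y"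
    and \<kappa>: "0 \<le> \<kappa>" and \<nu>: "0 < \<nu>" and e: "0 \<le> e"
    and fin: "(\<integral>\<^sup>+ y. ennreal (h y * decay \<kappa> \<nu> (norm y) powr e) \<partial>lborel) < top"
  shows "(\<integral>\<^sup>+ y\<in>{y. norm y \<le> R}. ennreal (h y) \<partial>lborel) < top"
proof -
  let ?c = "(1 + max R 0) powr ((\<kappa> + 1 + \<nu>) * e)"
  have "(\<integral>\<^sup>+ y\<in>{y. norm y \<le> R}. ennreal (h y) \<partial>lborel)
     \<le> (\<integral>\<^sup>+ y. ennreal ?c * ennreal (h y * decay \<kappa> \<nu> (norm y) powr e) \<partial>lborel)"
  proof (intro nn_integral_mono)
    fix y :: "real ^ 'n"
    show "ennreal (h y) * indicator {y. norm y \<le> R} y \<le> ennreal ?c * ennreal (h y * decay \<kappa> \<nu> (norm y) powr e)"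
    proof (cases "norm y \<le> R")
      case True
      have "(1 + max R 0) powr (- (\<kappa> + 1 + \<nu>)) \<le> (1 + norm y) powr (- (\<kappa> + 1 + \<nu>))"
        using True \<kappa> \<nu> by (intro powr_mono2') (auto intro: add_pos_nonneg)
      also have "\<dots> \<le> decay \<kappa> \<nu> (norm y)" by (rule decay_ge[OF \<kappa> \<nu>]) simp
      finally have "((1 + max R 0) powr (- (\<kappa> + 1 + \<nu>))) powr e \<le> decay \<kappa> \<nu> (norm y) powr e"
        using e by (intro powr_mono2) auto
      then have "?c * ((1 + max R 0) powr (- (\<kappa> + 1 + \<nu>))) powr e \<le> ?c * decay \<kappa> \<nu> (norm y) powr e"
        by (intro mult_left_mono) auto
      moreover have "?c * ((1 + max R 0) powr (- (\<kappa> + 1 + \<nu>))) powr e = 1"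
      proof -
        have "0 < 1 + max R 0" by (auto intro: add_pos_nonneg)
        moreover have "(\<kappa> + 1 + \<nu>) * e + - (\<kappa> + 1 + \<nu>) * e = 0" by (simp add: algebra_simps)
        ultimately show ?thesis unfolding powr_powr powr_add[symmetric] by simp
      qed
      ultimately have "h y * 1 \<le> h y * (?c * decay \<kappa> \<nu> (norm y) powr e)"
        using nn by (intro mult_left_mono) auto
      then have "ennreal (h y) \<le> ennreal (?c * (h y * decay \<kappa> \<nu> (norm y) powr e))"
        by (intro ennreal_leI) (simp add: mult_ac)
      also have "\<dots> = ennreal ?c * ennreal (h y * decay \<kappa> \<nu> (norm y) powr e)"
        by (rule ennreal_mult) (use nn in auto)
      finally show ?thesis using True by simp
    qed simp
  qed
  also have "\<dots> = ennreal ?c * (\<integral>\<^sup>+ y. ennreal (h y * decay \<kappa> \<nu> (norm y) powr e) \<partial>lborel)"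
    by (rule nn_integral_cmult) measurable
  also have "\<dots> < top" using fin by (simp only: ennreal_mult_less_top) simp
  finally show ?thesis .
qed

lemma phi_nonneg: "0 \<le> phi m \<nu> (y :: real ^ 'n)"
  by (simp add: phi_eq_decay decay_pos less_imp_le)

lemma borel_measurable_phi [measurable]: "(phi m \<nu> :: real ^ 'n \<Rightarrow> real) \<in> borel_measurable borel"
  unfolding phi_eq_decay[abs_def] by measurable

text \<open>
  The quantitative form, with an explicit threshold for \<open>N\<close>. Its first term compensates the power
  \<open>\<alpha> * (p - 1)\<close> of the lower bound \<open>(1 + norm x) powr (- d)\<close> of the maximal function of \<open>W\<close>, its second
  term the \<open>p\<close>-th power of the loss in the pointwise bound, and \<open>d + 1\<close> makes the weight integrable.
\<close>

lemma Poisson_max_bounded_dual_weight: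
  fixes w :: "real ^ 'n \<Rightarrow> real"
  assumes m: "- real CARD('n) \<le> m" and \<nu>: "0 < \<nu>"
    and p: "1 < p" and pp': "1 / p + 1 / p' = 1" and \<alpha>: "1 < \<alpha>"
    and w: "weight w"
    and fin: "Lp_norm p' (\<lambda>x. 1) (\<lambda>x. ennreal \<bar>w x powr (- 1 / p) * phi m \<nu> x\<bar>) < top"
    and N: "real CARD('n) * (\<alpha> * (p - 1)) + (m + 3 * real CARD('n) + 2 * \<nu> + 2) * p + real CARD('n) + 1 \<le> N"
  shows "weight (dual_weight p p' \<alpha> N w) \<and> (\<forall>a>0. Poisson_max_bounded m \<nu> a p w (dual_weight p p' \<alpha> N w))"
proof -
  let ?\<kappa> = "(m + real CARD('n)) / 2" let ?A = "m + 3 * real CARD('n) + 2 * \<nu> + 2"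
  define \<gamma> where "\<gamma> = \<alpha> * (p - 1)"
  have \<gamma>: "p - 1 < \<gamma>" using p \<alpha> by (simp add: \<gamma>_def)
  note cj = conjugate_exponent_eq[OF p pp']
  have \<kappa>: "0 \<le> ?\<kappa>" using m by simp
  have wl: "w \<in> borel_measurable lebesgue" using w by (simp add: weight_def)
  \<comment> \<open>Borel versions of \<open>w\<close>, and below of \<open>f\<close>, give access to Tonelli's theorem; every
    quantity in the claim only depends on the functions up to null sets.\<close>
  obtain w0 where w0[measurable]: "w0 \<in> borel_measurable borel" and ww0: "AE x in lborel. w x = w0 x"
    using completion_ex_borel_measurable_real[OF wl] by auto
  have w0pos: "AE x in lborel. 0 < w0 x"
    using w ww0 unfolding weight_def AE_completion_iff by auto
  define W where "W y = w0 y powr (- p' / p) * exp (- p' * (norm y)\<^sup>2 / 2)" for y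
  have W[measurable]: "W \<in> borel_measurable borel" unfolding W_def by measurable
  have nnW: "0 \<le> W y" for y by (simp add: W_def)
  have posW: "AE y in lborel. 0 < W y" using w0pos by eventually_elim (simp add: W_def)
  define M where "M = loc_max (\<lambda>y. ennreal (W y))"
  have M[measurable]: "M \<in> borel_measurable borel" unfolding M_def by measurable
  define v where "v x = enn2real (M x) powr (- \<gamma>) * exp (- p * (norm x)\<^sup>2 / 2) * (1 + norm x) powr (- N)" for x :: "real ^ 'n"
  have [measurable]: "v \<in> borel_measurable borel" unfolding v_def by measurable
  have dw: "dual_weight p p' \<alpha> N w = v"
  proof
    fix x
    have "local_max (\<lambda>y. w y powr (- p' / p) * exp (- p' * (norm y)\<^sup>2 / 2)) x = M x"
      unfolding local_max_eq_loc_max M_def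
      by (rule loc_max_cong_AE, use ww0 in eventually_elim) (simp add: W_def)
    moreover have "- \<alpha> / (p' / p) = - \<gamma>" using cj(2) p by (simp add: \<gamma>_def)
    ultimately show "dual_weight p p' \<alpha> N w x = v x"
      unfolding dual_weight_def v_def by simp
  qed
  define g where "g y = w0 y powr (- 1 / p) * phi m \<nu> y" for y
  have [measurable]: "g \<in> borel_measurable borel" unfolding g_def by measurable
  have nng: "0 \<le> g y" for y by (simp add: g_def phi_nonneg)
  define J where "J = enn2real (\<integral>\<^sup>+ y. ennreal (g y powr p') \<partial>lborel)"
  have "(\<integral>\<^sup>+ y. ennreal (g y powr p') \<partial>lborel) < top"
  proof -
    have "(\<integral>\<^sup>+ x. ennpowr (ennreal \<bar>w x powr (- 1 / p) * phi m \<nu> x\<bar>) p' * ennreal 1 \<partial>lebesgue) < top"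
      using fin unfolding Lp_norm_def by (simp only: ennpowr_less_top_iff)
    also have "(\<integral>\<^sup>+ x. ennpowr (ennreal \<bar>w x powr (- 1 / p) * phi m \<nu> x\<bar>) p' * ennreal 1 \<partial>lebesgue)
      = (\<integral>\<^sup>+ y. ennreal (g y powr p') \<partial>lborel)"
      unfolding nn_integral_completion
      by (rule nn_integral_cong_AE, use ww0 in eventually_elim) (simp add: ennpowr_ennreal g_def abs_mult phi_nonneg)
    finally show ?thesis .
  qed
  then have J: "(\<integral>\<^sup>+ y. ennreal (g y powr p') \<partial>lborel) = ennreal J" "0 \<le> J" by (auto simp: J_def)
  \<comment> \<open>Through this identity the hypothesis on \<open>w\<close> becomes integrability of \<open>W\<close> with a polynomial weight.\<close>
  have gW: "g y powr p' = W y * decay ?\<kappa> \<nu> (norm y) powr p'" for y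
  proof -
    have "g y powr p' = (w0 y powr (- 1 / p)) powr p' * exp (- (norm y)\<^sup>2 / 2) powr p' * decay ?\<kappa> \<nu> (norm y) powr p'"
      by (simp add: g_def phi_eq_decay powr_mult decay_pos less_imp_le)
    also have "(w0 y powr (- 1 / p)) powr p' = w0 y powr (- p' / p)" by (simp add: powr_powr)
    also have "exp (- (norm y)\<^sup>2 / 2) powr p' = exp (- p' * (norm y)\<^sup>2 / 2)" by (simp add: exp_powr_real mult.commute)
    finally show ?thesis by (simp add: W_def)
  qed
  \<comment> \<open>Finiteness almost everywhere of the maximal function keeps the target weight from
    vanishing: its value would be \<open>0\<close> where the maximal function is infinite.\<close>
  have Mfin: "AE x in lborel. M x < top"
    unfolding M_def
  proof (rule AE_loc_max_finite)
    show "(\<integral>\<^sup>+ y\<in>{y. norm y \<le> R}. ennreal (W y) \<partial>lborel) < top" for R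
      by (rule nn_integral_norm_le_finite[OF W nnW \<kappa> \<nu>, of p']) (use cj(1) J(1) in \<open>simp_all flip: gW\<close>)
  qed measurable
  have "AE y in lborel. 0 < ennreal (W y)" using posW by simp
  then obtain c where c: "0 < c" "\<And>x. ennreal (c / (1 + norm x) ^ DIM(real ^ 'n)) \<le> M x"
    using loc_max_lower_bound[of "\<lambda>y. ennreal (W y)"] unfolding M_def by auto
  have Mpos: "0 < M x" for x
  proof -
    have "0 < c / (1 + norm x) ^ DIM(real ^ 'n)" using c(1) by (intro divide_pos_pos zero_less_power) (auto intro: add_pos_nonneg)
    then show ?thesis using c(2)[of x] by (metis ennreal_less_zero_iff less_le_trans)
  qed
  have "AE x in lborel. 0 < v x"
    using Mfin
  proof eventually_elim
    case (elim x)
    then have "0 < enn2real (M x)" using Mpos[of x] by (simp add: enn2real_positive_iff)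
    moreover have "0 < 1 + norm x" by (auto intro: add_pos_nonneg)
    ultimately show ?case by (simp add: v_def)
  qed
  then have "weight v"
    unfolding weight_def by (intro conjI AE_completion measurable_completion) simp_all
  moreover have "Poisson_max_bounded m \<nu> a p w v" if a: "0 < a" for a
  proof -
    obtain C where C: "0 \<le> C"
      "\<And>(f :: real ^ 'n \<Rightarrow> real) t x. f \<in> borel_measurable borel \<Longrightarrow> 0 < t \<Longrightarrow> t < a \<Longrightarrow>
        ennreal \<bar>Poisson m \<nu> t f x\<bar> \<le> ennreal (C * exp ((norm x)\<^sup>2 / 2) * (1 + norm x) powr ?A) *
        (loc_max (\<lambda>y. ennreal (\<bar>f y\<bar> * exp (- (norm y)\<^sup>2 / 2))) x + (\<integral>\<^sup>+ y. ennreal (\<bar>f y\<bar> * phi m \<nu> y) \<partial>lborel))"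
      "\<And>(f :: real ^ 'n \<Rightarrow> real) t x. f \<in> borel_measurable borel \<Longrightarrow> 0 < t \<Longrightarrow> t < a \<Longrightarrow>
        loc_max (\<lambda>y. ennreal (\<bar>f y\<bar> * exp (- (norm y)\<^sup>2 / 2))) x < top \<Longrightarrow>
        (\<integral>\<^sup>+ y. ennreal (\<bar>f y\<bar> * phi m \<nu> y) \<partial>lborel) < top \<Longrightarrow> Poisson_exists m \<nu> t f x"
      by (rule Poisson_pointwise_bound[OF m \<nu>, of a]) (rule that, assumption+)
    have N': "real DIM(real ^ 'n) * \<gamma> + ?A * p + real DIM(real ^ 'n) + 1 \<le> N"
      using N by (simp add: \<gamma>_def)
    obtain K where K0: "0 \<le> K" and K: "\<forall>P F D. F \<in> borel_measurable borel \<longrightarrow> (\<forall>y. 0 \<le> F y) \<longrightarrow>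
      (\<forall>x. P x \<le> ennreal (C * exp ((norm x)\<^sup>2 / 2) * (1 + norm x) powr ?A) * (loc_max (\<lambda>y. ennreal (F y)) x + D)) \<longrightarrow>
      (\<integral>\<^sup>+ x. ennpowr (P x) p * ennreal (v x) \<partial>lborel)
      \<le> ennreal K * ((\<integral>\<^sup>+ y. ennreal (F y powr p * W y powr (1 - p)) \<partial>lborel) + ennpowr D p)"
      using weighted_bound_of_pointwise_bound[OF W nnW posW p \<gamma> C(1) N', folded M_def, folded v_def]
      by (elim exE conjE)
    define Q where "Q = K * (1 + (1 + J) powr p)"
    have Q: "0 \<le> Q" using K0 by (simp add: Q_def)
    have main: "(AE x in lebesgue. \<forall>t\<in>{0<..<a}. Poisson_exists m \<nu> t f x) \<and>
        Poisson_max m \<nu> a f \<in> borel_measurable lebesgue \<and>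
        Lp_norm p v (Poisson_max m \<nu> a f) \<le> ennreal (Q powr (1 / p)) * Lp_norm p w (\<lambda>x. ennreal \<bar>f x\<bar>)"
      if f: "f \<in> Lp p w" for f
    proof -
      have fl: "f \<in> borel_measurable lebesgue" using f by (simp add: Lp_def)
      obtain f0 where f0[measurable]: "f0 \<in> borel_measurable borel" and ff0: "AE x in lborel. f x = f0 x"
        using completion_ex_borel_measurable_real[OF fl] by auto
      have f0l: "f0 \<in> borel_measurable lebesgue" by (intro measurable_completion) simp
      note cong = Poisson_cong_AE[OF fl f0l AE_completion[OF ff0]]
      define I where "I = (\<integral>\<^sup>+ y. ennreal (\<bar>f0 y\<bar> powr p * w0 y) \<partial>lborel)"
      define D where "D = (\<integral>\<^sup>+ y. ennreal (\<bar>f0 y\<bar> * phi m \<nu> y) \<partial>lborel)"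
      define F where "F y = \<bar>f0 y\<bar> * exp (- (norm y)\<^sup>2 / 2)" for y
      have F[measurable]: "F \<in> borel_measurable borel" unfolding F_def by measurable
      have nnF: "0 \<le> F y" for y by (simp add: F_def)
      have norm_f: "Lp_norm p w (\<lambda>x. ennreal \<bar>f x\<bar>) = ennpowr I (1 / p)"
        unfolding Lp_norm_def I_def nn_integral_completion
        by (rule arg_cong[where f="\<lambda>z. ennpowr z (1 / p)"], rule nn_integral_cong_AE, use ff0 ww0 w0pos in eventually_elim)
           (simp add: ennpowr_ennreal ennreal_mult)
      have Ifin: "I < top"
        using f norm_f unfolding Lp_def by simp
      \<comment> \<open>Hoelder for \<open>\<bar>f\<bar> \<phi> = (\<bar>f\<bar> w powr (1 / p)) * (w powr (- 1 / p) \<phi>)\<close>.\<close>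
      have DI: "ennpowr D p \<le> ennreal ((1 + J) powr p) * I"
      proof -
        have "D = (\<integral>\<^sup>+ y. ennreal ((\<bar>f0 y\<bar> * w0 y powr (1 / p)) * g y) \<partial>lborel)"
          unfolding D_def
        proof (rule nn_integral_cong_AE, use w0pos in eventually_elim)
          fix y assume y: "0 < w0 y"
          then have "w0 y powr (1 / p) * w0 y powr (- 1 / p) = 1" by (simp add: powr_add[symmetric])
          then have "(\<bar>f0 y\<bar> * w0 y powr (1 / p)) * g y = \<bar>f0 y\<bar> * phi m \<nu> y"
            by (metis (no_types, opaque_lifting) g_def mult.assoc mult.right_neutral mult.commute)
          then show "ennreal (\<bar>f0 y\<bar> * phi m \<nu> y) = ennreal ((\<bar>f0 y\<bar> * w0 y powr (1 / p)) * g y)" by (simp only:)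
        qed
        then have "ennpowr D p \<le> ennreal ((1 + J) powr p) * (\<integral>\<^sup>+ y. ennreal ((\<bar>f0 y\<bar> * w0 y powr (1 / p)) powr p) \<partial>lborel)"
          using ennpowr_nn_integral_mult_le[of "\<lambda>y. \<bar>f0 y\<bar> * w0 y powr (1 / p)" lborel g p p' J] nng p pp' J by simp
        also have "(\<integral>\<^sup>+ y. ennreal ((\<bar>f0 y\<bar> * w0 y powr (1 / p)) powr p) \<partial>lborel) = I"
          unfolding I_def
          by (rule nn_integral_cong_AE, use w0pos in eventually_elim) (use p in \<open>simp add: powr_mult powr_powr\<close>)
        finally show ?thesis .
      qed
      then have "ennpowr D p < top"
        by (rule le_less_trans) (use Ifin in \<open>simp add: ennreal_mult_less_top\<close>)
      then have Dfin: "D < top" by simp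
      \<comment> \<open>\<open>W\<close> is made so that the two exponentials cancel and \<open>w\<close> to the power
        \<open>(- p' / p) * (1 - p) = 1\<close> remains.\<close>
      have FI: "(\<integral>\<^sup>+ y. ennreal (F y powr p * W y powr (1 - p)) \<partial>lborel) = I"
        unfolding I_def
      proof (rule nn_integral_cong_AE, use w0pos in eventually_elim)
        fix y assume y: "0 < w0 y"
        have e1: "(- p' / p) * (1 - p) = 1" using cj(3) p by (simp add: field_simps)
        have e2: "- p' * (norm y)\<^sup>2 / 2 * (1 - p) = p * (norm y)\<^sup>2 / 2"
          using cj(3) by (metis (no_types, opaque_lifting) minus_diff_eq minus_mult_minus mult.assoc mult.commute times_divide_eq_left)
        have "W y powr (1 - p) = w0 y * exp (p * (norm y)\<^sup>2 / 2)"
          unfolding W_def using y by (simp only: powr_mult powr_powr e1 exp_powr_real e2) simp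
        moreover have "F y powr p = \<bar>f0 y\<bar> powr p * exp (- (p * (norm y)\<^sup>2 / 2))"
          by (simp add: F_def powr_mult exp_powr_real mult.commute)
        ultimately have "F y powr p * W y powr (1 - p)
            = \<bar>f0 y\<bar> powr p * w0 y * (exp (- (p * (norm y)\<^sup>2 / 2)) * exp (p * (norm y)\<^sup>2 / 2))"
          by (simp only: mult_ac)
        then show "ennreal (F y powr p * W y powr (1 - p)) = ennreal (\<bar>f0 y\<bar> powr p * w0 y)"
          by (simp add: exp_add[symmetric])
      qed
      have "AE x in lborel. loc_max (\<lambda>y. ennreal (F y)) x < top"
      proof (rule AE_loc_max_finite)
        have "(\<integral>\<^sup>+ y. ennreal (F y * decay ?\<kappa> \<nu> (norm y) powr 1) \<partial>lborel) = D"
          unfolding D_def F_def phi_eq_decay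
          by (intro nn_integral_cong) (simp add: decay_pos less_imp_le mult.assoc)
        then show "(\<integral>\<^sup>+ y\<in>{y. norm y \<le> R}. ennreal (F y) \<partial>lborel) < top" for R
          using Dfin by (intro nn_integral_norm_le_finite[OF F nnF \<kappa> \<nu>, of 1]) simp_all
      qed measurable
      then have "AE x in lborel. \<forall>t\<in>{0<..<a}. Poisson_exists m \<nu> t f0 x"
        by eventually_elim (use C(3)[OF f0] Dfin in \<open>auto simp: F_def D_def\<close>)
      then have ex: "AE x in lebesgue. \<forall>t\<in>{0<..<a}. Poisson_exists m \<nu> t f0 x"
        by (rule AE_completion)
      have "Poisson_max m \<nu> a f0 x \<le> ennreal (C * exp ((norm x)\<^sup>2 / 2) * (1 + norm x) powr ?A) * (loc_max (\<lambda>y. ennreal (F y)) x + D)" for x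
        unfolding Poisson_max_def F_def D_def by (intro SUP_least C(2) f0) auto
      then have "(\<integral>\<^sup>+ x. ennpowr (Poisson_max m \<nu> a f0 x) p * ennreal (v x) \<partial>lborel) \<le> ennreal K * (I + ennpowr D p)"
        using K[rule_format, OF F nnF, of "Poisson_max m \<nu> a f0" D] unfolding FI by simp
      also have "\<dots> \<le> ennreal K * (1 * I + ennreal ((1 + J) powr p) * I)"
        using DI by (intro mult_left_mono add_mono) auto
      also have "\<dots> = ennreal Q * I"
        unfolding Q_def using K0
        by (simp add: distrib_right[symmetric] mult.assoc[symmetric] ennreal_mult flip: ennreal_plus ennreal_1)
      finally have "Lp_norm p v (Poisson_max m \<nu> a f0) \<le> ennpowr (ennreal Q * I) (1 / p)"
        unfolding Lp_norm_def nn_integral_completion using p by (intro ennpowr_mono) auto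
      also have "\<dots> = ennreal (Q powr (1 / p)) * ennpowr I (1 / p)"
        by (rule ennpowr_cmult[OF Q])
      finally show ?thesis
        using Poisson_max_measurable[OF f0 ex \<nu>] ex unfolding cong norm_f by blast
    qed
    then show ?thesis unfolding Poisson_max_bounded_def by blast
  qed
  ultimately show ?thesis unfolding dw by blast
qed

theorem theorem1p3:
  fixes m \<nu> p p' \<alpha> :: real
  assumes "m \<ge> - real CARD('n::finite)" and "\<nu> > 0"
    and "1 < p" and "1 / p + 1 / p' = 1"
    and "\<alpha> > 1"
  shows "\<exists>N0::real. \<forall>w :: real ^ 'n \<Rightarrow> real.
    weight w \<and> Lp_norm p' (\<lambda>x. 1) (\<lambda>x. ennreal \<bar>w x powr (- 1 / p) * phi m \<nu> x\<bar>) < top \<longrightarrow>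
    (\<forall>N>N0. weight (dual_weight p p' \<alpha> N w) \<and>
       (\<forall>a>0. Poisson_max_bounded m \<nu> a p w (dual_weight p p' \<alpha> N w)))"
  by (intro exI[of _ "real CARD('n) * (\<alpha> * (p - 1)) + (m + 3 * real CARD('n) + 2 * \<nu> + 2) * p + real CARD('n) + 1"]
      allI impI Poisson_max_bounded_dual_weight assms) auto

end
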